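(* Let $K$ be an algebraically closed field, let $C$ be a pointed colocal $K$-coalgebra (i.e. the coradical of $C$ is $C_0=Kg$ with $g$ a grouplike element), and let $C_\infty^\vee$ be the coalgebra constructed from $C$ in the context. Then $C_\infty^\vee$ is colocal and has the property that every indecomposable finite dimensional right $C_\infty^\vee$-comodule is a quotient (as a right $C_\infty^\vee$-comodule) of $C_\infty^\vee$. Consequently, $C_\infty^\vee$ has the right generating condition, i.e. every right $C_\infty^\vee$-comodule is a quotient of a direct sum of copies of the right $C_\infty^\vee$-comodule $C_\infty^\vee$.
   Context: A coalgebra is colocal if its coradical is a simple coalgebra; it is pointed colocal (also called connected) if its coradical is $Kg$ with $g$ grouplike, i.e. $\Delta(g)=g\otimes g$, $\varepsilon(g)=1$. Construction of $C^\vee$ from a pointed colocal coalgebra $(C,\Delta,\varepsilon)$, with $C_0=Kg$, over an algebraically closed field $K$. For a finite dimensional right $C$-comodule $(M,\rho_M)$, let $\mathrm{End}(M^C)$ be the finite dimensional algebra of right $C$-comodule endomorphisms of $M$, with multiplication the opposite of composition, so that $M$ is a right $\mathrm{End}(M^C)$-module via $m\cdot f=f(m)$. Let $(A_M,\delta_M,e_M)$ be the finite dimensional coalgebra dual to this algebra (so $A_M^*=\mathrm{End}(M^C)$ with convolution product). The module structure corresponds to a left $A_M$-comodule structure $r_M:M\to A_M\otimes M$, $r_M(m)=m_{(-1)}\otimes m_{(0)}$, determined by $f(m)=f(m_{(-1)})\,m_{(0)}$ for $f\in\mathrm{End}(M^C)=A_M^*$. Let $\mathcal L(C)$ be a set of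 representatives of the isomorphism types of indecomposable finite dimensional right $C$-comodules. For $M\in\mathcal L(C)$ the algebra $\mathrm{End}(M^C)$ is local with residue field $K$, so $A_M$ is colocal and has a unique grouplike element $g_M$. Let, as a vector space, $$C^\sim=\Big(\bigoplus_{M\in\mathcal L(C)}(A_M\oplus M)\Big)\oplus C,$$ which is a coalgebra with comultiplication $\delta$ and counit $e$ given by: $\delta(a)=\delta_M(a)$, $e(a)=e_M(a)$ for $a\in A_M$; $\delta(m)=r_M(m)+\rho_M(m)\in A_M\otimes M+M\otimes C$, $e(m)=0$ for $m\in M$, $M\in\mathcal L(C)$; $\delta(c)=\Delta(c)$, $e(c)=\varepsilon(c)$ for $c\in C$. Let $I$ be the linear span of $\{g-g_M\mid M\in\mathcal L(C)\}$, a coideal of $C^\sim$, and put $C^\vee=C^\sim/I$. The coalgebra $C^\vee$ is again pointed colocal, and the composite $C\hookrightarrow C^\sim\to C^\vee$ is an injective coalgebra morphism, by which $C$ is viewed as a subcoalgebra of $C^\vee$. Construction of $C_\infty^\vee$: put $C^{[0]}=C$, $C^{[n+1]}=(C^{[n]})^\vee$ for $n\ge 0$, and $C_\infty^\vee=\bigcup_{n\ge 0}C^{[n]}$, the union (direct limit) of coalgebras along these embeddings. *)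

theory Defs
  imports
    "HOL-Computational_Algebra.Polynomial"
    "HOL-Library.Poly_Mapping"
    "HOL-Library.Function_Algebras"
    "HOL-Library.Product_Plus"
begin

section \<open>Vector spaces and tensor products\<close>

text \<open>
  A vector space is a subspace (the carrier) of an ambient vector space given by a type together
  with a scalar multiplication.
\<close>

record ('k, 'v) vspc =
  vcarrier :: "'v set"
  vscale :: "'k \<Rightarrow> 'v \<Rightarrow> 'v"

definition vspace :: "('k::field, 'v::ab_group_add, 'z) vspc_scheme \<Rightarrow> bool" where
  "vspace V \<longleftrightarrow> vector_space (vscale V) \<and> module.subspace (vscale V) (vcarrier V)"

definition fin_dim :: "('k::field, 'v::ab_group_add, 'z) vspc_scheme \<Rightarrow> bool" where
  "fin_dim V \<longleftrightarrow> (\<exists>B. finite B \<and> module.span (vscale V) B = vcarrier V)"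

definition linear_map ::
  "('k::field, 'v::ab_group_add, 'z) vspc_scheme \<Rightarrow> ('k, 'w::ab_group_add, 'y) vspc_scheme
    \<Rightarrow> ('v \<Rightarrow> 'w) \<Rightarrow> bool" where
  "linear_map V W f \<longleftrightarrow>
     (\<forall>x\<in>vcarrier V. f x \<in> vcarrier W) \<and>
     (\<forall>x\<in>vcarrier V. \<forall>y\<in>vcarrier V. f (x + y) = f x + f y) \<and>
     (\<forall>r. \<forall>x\<in>vcarrier V. f (vscale V r x) = vscale W r (f x))"

text \<open>
  \<^typ>\<open>'x \<Rightarrow>\<^sub>0 'k\<close> is the free vector space on \<^typ>\<open>'x\<close>, with scalar multiplication \<open>fscale\<close>;
  \<open>lin_ext s h\<close> is the linear extension of \<open>h\<close> to it, where \<open>s\<close> is the scalar multiplication of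
  the target.
\<close>

definition fscale :: "'k::field \<Rightarrow> ('x \<Rightarrow>\<^sub>0 'k) \<Rightarrow> ('x \<Rightarrow>\<^sub>0 'k)" where
  "fscale r p = Poly_Mapping.map ((*) r) p"

definition lin_ext ::
  "('k \<Rightarrow> 'y \<Rightarrow> 'y::ab_group_add) \<Rightarrow> ('x \<Rightarrow> 'y) \<Rightarrow> ('x \<Rightarrow>\<^sub>0 'k::field) \<Rightarrow> 'y" where
  "lin_ext s h t = (\<Sum>x\<in>Poly_Mapping.keys t. s (Poly_Mapping.lookup t x) (h x))"

text \<open>
  The tensor product of \<open>V\<close> and \<open>W\<close> is the free vector space on \<open>V \<times> W\<close> modulo the bilinearity
  relations. Its elements are given by representatives (elements of \<open>tensors V W\<close>), and equality
  in the tensor product is \<open>tensor_eq V W\<close>. All structure maps into tensor products below are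
  representative-valued, and all identities between tensors are stated with \<open>tensor_eq\<close>; likewise
  \<open>tensor3_eq\<close> for threefold tensor products.
\<close>

abbreviation pure :: "'x \<Rightarrow> ('x \<Rightarrow>\<^sub>0 'k::field)" where
  "pure x \<equiv> Poly_Mapping.single x 1"

definition tensors ::
  "('k::field, 'v::ab_group_add, 'z) vspc_scheme \<Rightarrow> ('k, 'w::ab_group_add, 'y) vspc_scheme
    \<Rightarrow> ('v \<times> 'w \<Rightarrow>\<^sub>0 'k) set" where
  "tensors V W = {t. Poly_Mapping.keys t \<subseteq> vcarrier V \<times> vcarrier W}"

definition tensor_relations ::
  "('k::field, 'v::ab_group_add, 'z) vspc_scheme \<Rightarrow> ('k, 'w::ab_group_add, 'y) vspc_scheme
    \<Rightarrow> ('v \<times> 'w \<Rightarrow>\<^sub>0 'k) set" where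
  "tensor_relations V W =
     {pure (v + v', w) - pure (v, w) - pure (v', w) | v v' w.
        v \<in> vcarrier V \<and> v' \<in> vcarrier V \<and> w \<in> vcarrier W} \<union>
     {pure (v, w + w') - pure (v, w) - pure (v, w') | v w w'.
        v \<in> vcarrier V \<and> w \<in> vcarrier W \<and> w' \<in> vcarrier W} \<union>
     {pure (vscale V r v, w) - fscale r (pure (v, w)) | r v w.
        v \<in> vcarrier V \<and> w \<in> vcarrier W} \<union>
     {pure (v, vscale W r w) - fscale r (pure (v, w)) | r v w.
        v \<in> vcarrier V \<and> w \<in> vcarrier W}"

definition tensor_eq ::
  "('k::field, 'v::ab_group_add, 'z) vspc_scheme \<Rightarrow> ('k, 'w::ab_group_add, 'y) vspc_scheme
    \<Rightarrow> ('v \<times> 'w \<Rightarrow>\<^sub>0 'k) \<Rightarrow> ('v \<times> 'w \<Rightarrow>\<^sub>0 'k) \<Rightarrow> bool" where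
  "tensor_eq V W t u \<longleftrightarrow> t - u \<in> module.span fscale (tensor_relations V W)"

definition tensor3_relations ::
  "('k::field, 'u::ab_group_add, 'x) vspc_scheme \<Rightarrow> ('k, 'v::ab_group_add, 'y) vspc_scheme
    \<Rightarrow> ('k, 'w::ab_group_add, 'z) vspc_scheme \<Rightarrow> ('u \<times> 'v \<times> 'w \<Rightarrow>\<^sub>0 'k) set" where
  "tensor3_relations U V W =
     {pure (u + u', v, w) - pure (u, v, w) - pure (u', v, w) | u u' v w.
        u \<in> vcarrier U \<and> u' \<in> vcarrier U \<and> v \<in> vcarrier V \<and> w \<in> vcarrier W} \<union>
     {pure (u, v + v', w) - pure (u, v, w) - pure (u, v', w) | u v v' w.
        u \<in> vcarrier U \<and> v \<in> vcarrier V \<and> v' \<in> vcarrier V \<and> w \<in> vcarrier W} \<union>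
     {pure (u, v, w + w') - pure (u, v, w) - pure (u, v, w') | u v w w'.
        u \<in> vcarrier U \<and> v \<in> vcarrier V \<and> w \<in> vcarrier W \<and> w' \<in> vcarrier W} \<union>
     {pure (vscale U r u, v, w) - fscale r (pure (u, v, w)) | r u v w.
        u \<in> vcarrier U \<and> v \<in> vcarrier V \<and> w \<in> vcarrier W} \<union>
     {pure (u, vscale V r v, w) - fscale r (pure (u, v, w)) | r u v w.
        u \<in> vcarrier U \<and> v \<in> vcarrier V \<and> w \<in> vcarrier W} \<union>
     {pure (u, v, vscale W r w) - fscale r (pure (u, v, w)) | r u v w.
        u \<in> vcarrier U \<and> v \<in> vcarrier V \<and> w \<in> vcarrier W}"

definition tensor3_eq ::
  "('k::field, 'u::ab_group_add, 'x) vspc_scheme \<Rightarrow> ('k, 'v::ab_group_add, 'y) vspc_scheme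
    \<Rightarrow> ('k, 'w::ab_group_add, 'z) vspc_scheme
    \<Rightarrow> ('u \<times> 'v \<times> 'w \<Rightarrow>\<^sub>0 'k) \<Rightarrow> ('u \<times> 'v \<times> 'w \<Rightarrow>\<^sub>0 'k) \<Rightarrow> bool" where
  "tensor3_eq U V W t u \<longleftrightarrow> t - u \<in> module.span fscale (tensor3_relations U V W)"

text \<open>The map \<open>f \<otimes> g\<close> for linear \<open>f\<close> and \<open>g\<close>:\<close>

definition tmap ::
  "('v \<Rightarrow> 'v') \<Rightarrow> ('w \<Rightarrow> 'w') \<Rightarrow> ('v \<times> 'w \<Rightarrow>\<^sub>0 'k::field) \<Rightarrow> ('v' \<times> 'w' \<Rightarrow>\<^sub>0 'k)" where
  "tmap f g = lin_ext fscale (\<lambda>(v, w). pure (f v, g w))"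

text \<open>The maps \<open>\<rho> \<otimes> id\<close> and \<open>id \<otimes> \<rho>\<close> for tensor-valued \<open>\<rho>\<close>:\<close>

definition expand_left ::
  "('v \<Rightarrow> ('a \<times> 'b \<Rightarrow>\<^sub>0 'k::field)) \<Rightarrow> ('v \<times> 'w \<Rightarrow>\<^sub>0 'k) \<Rightarrow> ('a \<times> 'b \<times> 'w \<Rightarrow>\<^sub>0 'k)" where
  "expand_left \<rho> = lin_ext fscale (\<lambda>(v, w). lin_ext fscale (\<lambda>(a, b). pure (a, b, w)) (\<rho> v))"

definition expand_right ::
  "('w \<Rightarrow> ('a \<times> 'b \<Rightarrow>\<^sub>0 'k::field)) \<Rightarrow> ('v \<times> 'w \<Rightarrow>\<^sub>0 'k) \<Rightarrow> ('v \<times> 'a \<times> 'b \<Rightarrow>\<^sub>0 'k)" where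
  "expand_right \<rho> = lin_ext fscale (\<lambda>(v, w). lin_ext fscale (\<lambda>(a, b). pure (v, a, b)) (\<rho> w))"


section \<open>Coalgebras\<close>

record (overloaded) ('k, 'c) coalg = "('k, 'c) vspc" +
  comult :: "'c \<Rightarrow> ('c \<times> 'c \<Rightarrow>\<^sub>0 'k)"
  counit :: "'c \<Rightarrow> 'k"

definition linear_to_tensor ::
  "('k::field, 'x::ab_group_add, 'z) vspc_scheme \<Rightarrow> ('k, 'v::ab_group_add, 'y) vspc_scheme
    \<Rightarrow> ('k, 'w::ab_group_add, 'u) vspc_scheme \<Rightarrow> ('x \<Rightarrow> ('v \<times> 'w \<Rightarrow>\<^sub>0 'k)) \<Rightarrow> bool" where
  "linear_to_tensor X V W \<rho> \<longleftrightarrow>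
     (\<forall>x\<in>vcarrier X. \<rho> x \<in> tensors V W) \<and>
     (\<forall>x\<in>vcarrier X. \<forall>y\<in>vcarrier X. tensor_eq V W (\<rho> (x + y)) (\<rho> x + \<rho> y)) \<and>
     (\<forall>r. \<forall>x\<in>vcarrier X. tensor_eq V W (\<rho> (vscale X r x)) (fscale r (\<rho> x)))"

definition coalgebra :: "('k::field, 'c::ab_group_add) coalg \<Rightarrow> bool" where
  "coalgebra C \<longleftrightarrow>
     vspace C \<and>
     linear_to_tensor C C C (comult C) \<and>
     (\<forall>c\<in>vcarrier C. \<forall>d\<in>vcarrier C. counit C (c + d) = counit C c + counit C d) \<and>
     (\<forall>r. \<forall>c\<in>vcarrier C. counit C (vscale C r c) = r * counit C c) \<and>
     (\<forall>c\<in>vcarrier C. tensor3_eq C C C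
        (expand_left (comult C) (comult C c)) (expand_right (comult C) (comult C c))) \<and>
     (\<forall>c\<in>vcarrier C. lin_ext (vscale C) (\<lambda>(a, b). vscale C (counit C a) b) (comult C c) = c) \<and>
     (\<forall>c\<in>vcarrier C. lin_ext (vscale C) (\<lambda>(a, b). vscale C (counit C b) a) (comult C c) = c)"

definition coalg_hom ::
  "('k::field, 'c::ab_group_add) coalg \<Rightarrow> ('k, 'd::ab_group_add) coalg \<Rightarrow> ('c \<Rightarrow> 'd) \<Rightarrow> bool" where
  "coalg_hom C D f \<longleftrightarrow>
     linear_map C D f \<and>
     (\<forall>c\<in>vcarrier C. tensor_eq D D (comult D (f c)) (tmap f f (comult C c))) \<and>
     (\<forall>c\<in>vcarrier C. counit D (f c) = counit C c)"

definition coalg_iso ::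
  "('k::field, 'c::ab_group_add) coalg \<Rightarrow> ('k, 'd::ab_group_add) coalg \<Rightarrow> bool" where
  "coalg_iso C D \<longleftrightarrow> (\<exists>f. coalg_hom C D f \<and> bij_betw f (vcarrier C) (vcarrier D))"

definition subcoalgebra :: "('k::field, 'c::ab_group_add) coalg \<Rightarrow> 'c set \<Rightarrow> bool" where
  "subcoalgebra C D \<longleftrightarrow>
     module.subspace (vscale C) D \<and> D \<subseteq> vcarrier C \<and>
     (\<forall>d\<in>D. \<exists>t. Poly_Mapping.keys t \<subseteq> D \<times> D \<and> tensor_eq C C (comult C d) t)"

definition simple_subcoalgebra :: "('k::field, 'c::ab_group_add) coalg \<Rightarrow> 'c set \<Rightarrow> bool" where
  "simple_subcoalgebra C D \<longleftrightarrow>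
     subcoalgebra C D \<and> D \<noteq> {0} \<and> (\<forall>E. subcoalgebra C E \<and> E \<subseteq> D \<longrightarrow> E = {0} \<or> E = D)"

definition coradical :: "('k::field, 'c::ab_group_add) coalg \<Rightarrow> 'c set" where
  "coradical C = module.span (vscale C) (\<Union>{D. simple_subcoalgebra C D})"

definition colocal :: "('k::field, 'c::ab_group_add) coalg \<Rightarrow> bool" where
  "colocal C \<longleftrightarrow> coalgebra C \<and> simple_subcoalgebra C (coradical C)"

definition grouplike :: "('k::field, 'c::ab_group_add) coalg \<Rightarrow> 'c \<Rightarrow> bool" where
  "grouplike C g \<longleftrightarrow> g \<in> vcarrier C \<and> tensor_eq C C (comult C g) (pure (g, g)) \<and> counit C g = 1"

definition pointed_colocal :: "('k::field, 'c::ab_group_add) coalg \<Rightarrow> bool" where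
  "pointed_colocal C \<longleftrightarrow>
     coalgebra C \<and> (\<exists>g. grouplike C g \<and> coradical C = range (\<lambda>r. vscale C r g))"

text \<open>Only used for coalgebras that have exactly one grouplike element.\<close>

definition the_grouplike :: "('k::field, 'c::ab_group_add) coalg \<Rightarrow> 'c" where
  "the_grouplike C = (THE g. grouplike C g)"


section \<open>Right comodules\<close>

record (overloaded) ('k, 'c, 'm) comod = "('k, 'm) vspc" +
  coact :: "'m \<Rightarrow> ('m \<times> 'c \<Rightarrow>\<^sub>0 'k)"

definition right_comodule ::
  "('k::field, 'c::ab_group_add) coalg \<Rightarrow> ('k, 'c, 'm::ab_group_add) comod \<Rightarrow> bool" where
  "right_comodule C M \<longleftrightarrow>
     vspace M \<and>
     linear_to_tensor M M C (coact M) \<and>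
     (\<forall>m\<in>vcarrier M. tensor3_eq M C C
        (expand_left (coact M) (coact M m)) (expand_right (comult C) (coact M m))) \<and>
     (\<forall>m\<in>vcarrier M. lin_ext (vscale M) (\<lambda>(n, c). vscale M (counit C c) n) (coact M m) = m)"

definition comod_hom ::
  "('k::field, 'c::ab_group_add) coalg \<Rightarrow> ('k, 'c, 'm::ab_group_add) comod
    \<Rightarrow> ('k, 'c, 'n::ab_group_add) comod \<Rightarrow> ('m \<Rightarrow> 'n) \<Rightarrow> bool" where
  "comod_hom C M N f \<longleftrightarrow>
     linear_map M N f \<and>
     (\<forall>m\<in>vcarrier M. tensor_eq N C (coact N (f m)) (tmap f id (coact M m)))"

definition comod_iso ::
  "('k::field, 'c::ab_group_add) coalg \<Rightarrow> ('k, 'c, 'm::ab_group_add) comod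
    \<Rightarrow> ('k, 'c, 'n::ab_group_add) comod \<Rightarrow> bool" where
  "comod_iso C M N \<longleftrightarrow> (\<exists>f. comod_hom C M N f \<and> bij_betw f (vcarrier M) (vcarrier N))"

text \<open>\<open>N\<close> is (isomorphic to) a quotient comodule of \<open>M\<close>:\<close>

definition is_quotient_of ::
  "('k::field, 'c::ab_group_add) coalg \<Rightarrow> ('k, 'c, 'n::ab_group_add) comod
    \<Rightarrow> ('k, 'c, 'm::ab_group_add) comod \<Rightarrow> bool" where
  "is_quotient_of C N M \<longleftrightarrow> (\<exists>f. comod_hom C M N f \<and> f ` vcarrier M = vcarrier N)"

definition subcomodule ::
  "('k::field, 'c::ab_group_add) coalg \<Rightarrow> ('k, 'c, 'm::ab_group_add) comod \<Rightarrow> 'm set \<Rightarrow> bool" where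
  "subcomodule C M N \<longleftrightarrow>
     module.subspace (vscale M) N \<and> N \<subseteq> vcarrier M \<and>
     (\<forall>n\<in>N. \<exists>t. Poly_Mapping.keys t \<subseteq> N \<times> vcarrier C \<and> tensor_eq M C (coact M n) t)"

definition indecomposable ::
  "('k::field, 'c::ab_group_add) coalg \<Rightarrow> ('k, 'c, 'm::ab_group_add) comod \<Rightarrow> bool" where
  "indecomposable C M \<longleftrightarrow>
     vcarrier M \<noteq> {0} \<and>
     (\<forall>N P. subcomodule C M N \<and> subcomodule C M P \<and> N \<inter> P = {0} \<and>
        {n + p | n p. n \<in> N \<and> p \<in> P} = vcarrier M \<longrightarrow> N = {0} \<or> P = {0})"

definition regular_comod :: "('k::field, 'c::ab_group_add) coalg \<Rightarrow> ('k, 'c, 'c) comod" where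
  "regular_comod C = \<lparr>vcarrier = vcarrier C, vscale = vscale C, coact = comult C\<rparr>"

text \<open>The direct sum of copies of \<open>M\<close> indexed by \<open>I\<close>:\<close>

definition copower ::
  "'i set \<Rightarrow> ('k::field, 'c::ab_group_add, 'm::ab_group_add) comod \<Rightarrow> ('k, 'c, 'i \<Rightarrow>\<^sub>0 'm) comod" where
  "copower I M =
     \<lparr>vcarrier = {x. Poly_Mapping.keys x \<subseteq> I \<and> (\<forall>i\<in>I. Poly_Mapping.lookup x i \<in> vcarrier M)},
      vscale = (\<lambda>r. Poly_Mapping.map (vscale M r)),
      coact = (\<lambda>x. \<Sum>i\<in>Poly_Mapping.keys x.
                 tmap (Poly_Mapping.single i) id (coact M (Poly_Mapping.lookup x i)))\<rparr>"


section \<open>The coalgebra dual to an endomorphism algebra\<close>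

text \<open>
  Endomorphisms are extended by 0 outside the carrier, so that they are determined as functions;
  the multiplication of the algebra is the opposite of composition, \<open>(f, f') \<mapsto> f' \<circ> f\<close>.
\<close>

definition comod_end ::
  "('k::field, 'c::ab_group_add) coalg \<Rightarrow> ('k, 'c, 'm::ab_group_add) comod \<Rightarrow> ('m \<Rightarrow> 'm) set" where
  "comod_end C M = {f. comod_hom C M M f \<and> (\<forall>x. x \<notin> vcarrier M \<longrightarrow> f x = 0)}"

definition end_one :: "('k::field, 'c::ab_group_add, 'm::ab_group_add) comod \<Rightarrow> 'm \<Rightarrow> 'm" where
  "end_one M x = (if x \<in> vcarrier M then x else 0)"

text \<open>
  For finite dimensional \<open>M\<close>, \<open>A\<^sub>M\<close> is the linear dual of the endomorphism algebra (functionals are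
  again extended by 0), and an endomorphism \<open>f\<close> is identified with the functional \<open>a \<mapsto> a f\<close> on it.
  Then \<open>\<delta>\<^sub>M a = \<Sum>a\<^sub>1 \<otimes> a\<^sub>2\<close> is the unique tensor with \<open>\<Sum>a\<^sub>1 f \<cdot> a\<^sub>2 f' = a (f' \<circ> f)\<close> for all \<open>f, f'\<close>.
\<close>

definition end_dual_space ::
  "('k::field, 'c::ab_group_add) coalg \<Rightarrow> ('k, 'c, 'm::ab_group_add) comod
    \<Rightarrow> ('k, ('m \<Rightarrow> 'm) \<Rightarrow> 'k) vspc" where
  "end_dual_space C M =
     \<lparr>vcarrier = {a.
        (\<forall>f\<in>comod_end C M. \<forall>f'\<in>comod_end C M. a (\<lambda>x. f x + f' x) = a f + a f') \<and>
        (\<forall>r. \<forall>f\<in>comod_end C M.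
           a (\<lambda>x. if x \<in> vcarrier M then vscale M r (f x) else 0) = r * a f) \<and>
        (\<forall>f. f \<notin> comod_end C M \<longrightarrow> a f = 0)},
      vscale = (\<lambda>r a f. r * a f)\<rparr>"

definition end_dual ::
  "('k::field, 'c::ab_group_add) coalg \<Rightarrow> ('k, 'c, 'm::ab_group_add) comod
    \<Rightarrow> ('k, ('m \<Rightarrow> 'm) \<Rightarrow> 'k) coalg" where
  "end_dual C M =
     \<lparr>vcarrier = vcarrier (end_dual_space C M),
      vscale = vscale (end_dual_space C M),
      comult = (\<lambda>a. SOME t. t \<in> tensors (end_dual_space C M) (end_dual_space C M) \<and>
         (\<forall>f\<in>comod_end C M. \<forall>f'\<in>comod_end C M.
            lin_ext (*) (\<lambda>(a1, a2). a1 f * a2 f') t = a (f' \<circ> f))),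
      counit = (\<lambda>a. a (end_one M))\<rparr>"

text \<open>
  The left coaction \<open>r\<^sub>M\<close>: \<open>r\<^sub>M m = \<Sum>m\<^sub>-\<^sub>1 \<otimes> m\<^sub>0\<close> is the unique tensor with
  \<open>f m = \<Sum>m\<^sub>-\<^sub>1 f \<cdot> m\<^sub>0\<close> for all endomorphisms \<open>f\<close>.
\<close>

definition end_coact ::
  "('k::field, 'c::ab_group_add) coalg \<Rightarrow> ('k, 'c, 'm::ab_group_add) comod
    \<Rightarrow> 'm \<Rightarrow> ((('m \<Rightarrow> 'm) \<Rightarrow> 'k) \<times> 'm \<Rightarrow>\<^sub>0 'k)" where
  "end_coact C M m = (SOME t. t \<in> tensors (end_dual C M) M \<and>
     (\<forall>f\<in>comod_end C M. lin_ext (vscale M) (\<lambda>(a, m0). vscale M (a f) m0) t = f m))"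


section \<open>The construction \<open>C\<^sup>\<or>\<close>\<close>

text \<open>
  Every finite dimensional comodule is isomorphic to one whose underlying space is a subspace of
  the free vector space on \<^typ>\<open>nat\<close>, so representatives of isomorphism types are chosen there.
\<close>

type_synonym ('k, 'c) fdcomod = "('k, 'c, nat \<Rightarrow>\<^sub>0 'k) comod"

definition fd_indecomposable ::
  "('k::field, 'c::ab_group_add) coalg \<Rightarrow> ('k, 'c) fdcomod \<Rightarrow> bool" where
  "fd_indecomposable C M \<longleftrightarrow>
     vscale M = fscale \<and> right_comodule C M \<and> fin_dim M \<and> indecomposable C M"

definition is_representative_set ::
  "('k::field, 'c::ab_group_add) coalg \<Rightarrow> ('k, 'c) fdcomod set \<Rightarrow> bool" where
  "is_representative_set C L \<longleftrightarrow>
     (\<forall>M\<in>L. fd_indecomposable C M) \<and>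
     (\<forall>M\<in>L. \<forall>N\<in>L. comod_iso C M N \<longrightarrow> M = N) \<and>
     (\<forall>M. fd_indecomposable C M \<longrightarrow> (\<exists>N\<in>L. comod_iso C M N))"

text \<open>
  An element \<open>(\<alpha>, \<mu>, c)\<close> of \<open>C\<^sup>\<sim>\<close> consists of the components \<open>\<alpha> M\<close> in \<open>A\<^sub>M\<close> and \<open>\<mu> M\<close> in \<open>M\<close>, for
  \<open>M\<close> in the chosen set \<open>L\<close> of representatives, and the component \<open>c\<close> in \<open>C\<close>.
\<close>

type_synonym ('k, 'c) tilde =
  "(('k, 'c) fdcomod \<Rightarrow>\<^sub>0 (((nat \<Rightarrow>\<^sub>0 'k) \<Rightarrow> (nat \<Rightarrow>\<^sub>0 'k)) \<Rightarrow> 'k)) \<times>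
   (('k, 'c) fdcomod \<Rightarrow>\<^sub>0 (nat \<Rightarrow>\<^sub>0 'k)) \<times> 'c"

definition in_A ::
  "('k, 'c) fdcomod \<Rightarrow> (((nat \<Rightarrow>\<^sub>0 'k) \<Rightarrow> (nat \<Rightarrow>\<^sub>0 'k)) \<Rightarrow> 'k)
    \<Rightarrow> ('k::field, 'c::ab_group_add) tilde" where
  "in_A M a = (Poly_Mapping.single M a, 0, 0)"

definition in_M ::
  "('k, 'c) fdcomod \<Rightarrow> (nat \<Rightarrow>\<^sub>0 'k) \<Rightarrow> ('k::field, 'c::ab_group_add) tilde" where
  "in_M M m = (0, Poly_Mapping.single M m, 0)"

definition in_C :: "'c \<Rightarrow> ('k::field, 'c::ab_group_add) tilde" where
  "in_C c = (0, 0, c)"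

definition tilde ::
  "('k::field, 'c::ab_group_add) coalg \<Rightarrow> ('k, 'c) fdcomod set \<Rightarrow> ('k, ('k, 'c) tilde) coalg" where
  "tilde C L =
     \<lparr>vcarrier = {(\<alpha>, \<mu>, c).
        Poly_Mapping.keys \<alpha> \<subseteq> L \<and> (\<forall>M\<in>L. Poly_Mapping.lookup \<alpha> M \<in> vcarrier (end_dual C M)) \<and>
        Poly_Mapping.keys \<mu> \<subseteq> L \<and> (\<forall>M\<in>L. Poly_Mapping.lookup \<mu> M \<in> vcarrier M) \<and>
        c \<in> vcarrier C},
      vscale = (\<lambda>r (\<alpha>, \<mu>, c).
        (Poly_Mapping.map (\<lambda>a f. r * a f) \<alpha>, Poly_Mapping.map (fscale r) \<mu>, vscale C r c)),
      comult = (\<lambda>(\<alpha>, \<mu>, c).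
        (\<Sum>M\<in>Poly_Mapping.keys \<alpha>.
           tmap (in_A M) (in_A M) (comult (end_dual C M) (Poly_Mapping.lookup \<alpha> M))) +
        (\<Sum>M\<in>Poly_Mapping.keys \<mu>.
           tmap (in_A M) (in_M M) (end_coact C M (Poly_Mapping.lookup \<mu> M)) +
           tmap (in_M M) in_C (coact M (Poly_Mapping.lookup \<mu> M))) +
        tmap in_C in_C (comult C c)),
      counit = (\<lambda>(\<alpha>, \<mu>, c).
        (\<Sum>M\<in>Poly_Mapping.keys \<alpha>. counit (end_dual C M) (Poly_Mapping.lookup \<alpha> M)) + counit C c)\<rparr>"

definition tilde_coideal ::
  "('k::field, 'c::ab_group_add) coalg \<Rightarrow> ('k, 'c) fdcomod set \<Rightarrow> ('k, 'c) tilde set" where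
  "tilde_coideal C L = module.span (vscale (tilde C L))
     {in_C (the_grouplike C) - in_A M (the_grouplike (end_dual C M)) | M. M \<in> L}"

text \<open>
  \<open>is_vee C D\<close>: the coalgebra \<open>D\<close> is the quotient of \<open>C\<^sup>\<sim>\<close> by the coideal \<open>I\<close>, with projection \<open>\<pi>\<close>, and
  \<open>C\<close> is identified with its image under \<open>C \<hookrightarrow> C\<^sup>\<sim> \<rightarrow> C\<^sup>\<or>\<close>. The two coalgebras live in the same
  ambient vector space, so that the construction can be iterated inside one type.
\<close>

definition is_vee ::
  "('k::field, 'c::ab_group_add) coalg \<Rightarrow> ('k, 'c) coalg \<Rightarrow> bool" where
  "is_vee C D \<longleftrightarrow>
     coalgebra D \<and> vscale D = vscale C \<and>
     (\<exists>L \<pi>. is_representative_set C L \<and>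
        coalg_hom (tilde C L) D \<pi> \<and>
        \<pi> ` vcarrier (tilde C L) = vcarrier D \<and>
        {x \<in> vcarrier (tilde C L). \<pi> x = 0} = tilde_coideal C L \<and>
        (\<forall>c\<in>vcarrier C. \<pi> (in_C c) = c))"


section \<open>The union \<open>C\<^sub>\<infinity>\<^sup>\<or>\<close>\<close>

text \<open>
  The coalgebras \<open>C\<^bsup>[n]\<^esup>\<close> form an increasing chain of subcoalgebras in one ambient space, starting
  with a copy of \<open>C\<close>. (\<open>C\<close> itself may fill its type, hence the change of type; over an algebraically
  closed field and for \<open>C\<close> of type \<^typ>\<open>'c\<close>, the free vector space on \<^typ>\<open>nat \<times> 'c\<close> is large enough
  to contain all of them.)
\<close>

definition vee_tower ::
  "('k::field, 'c::ab_group_add) coalg \<Rightarrow> (nat \<Rightarrow> ('k, 'd::ab_group_add) coalg) \<Rightarrow> bool" where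
  "vee_tower C X \<longleftrightarrow> coalgebra (X 0) \<and> coalg_iso C (X 0) \<and> (\<forall>n. is_vee (X n) (X (Suc n)))"

definition coalg_union ::
  "(nat \<Rightarrow> ('k::field, 'd::ab_group_add) coalg) \<Rightarrow> ('k, 'd) coalg" where
  "coalg_union X =
     \<lparr>vcarrier = (\<Union>n. vcarrier (X n)),
      vscale = vscale (X 0),
      comult = (\<lambda>c. comult (X (LEAST n. c \<in> vcarrier (X n))) c),
      counit = (\<lambda>c. counit (X (LEAST n. c \<in> vcarrier (X n))) c)\<rparr>"

end

theory Submission
  imports Defs
begin

text \<open>
  A step \<open>C \<subseteq> C\<^sup>\<or>\<close> of the tower has three properties that together give the theorem.

  It preserves connectedness. The coalgebra \<open>C\<close> is pointed colocal with grouplike element \<open>g\<close> if and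
  only if \<open>g\<close> lies in every nonzero subcoalgebra (\<open>connected_at\<close>), and in this form the property is easy
  to follow. Let \<open>E\<close> be a nonzero subcoalgebra of \<open>C\<^sup>\<or>\<close>. Applying functionals to one factor of the
  comultiplication, one moves a nonzero component of an element of \<open>E\<close> from \<open>M\<close> into \<open>A\<^sub>M\<close>, and a component
  in \<open>A\<^sub>M\<close> that is not a multiple of \<open>g\<^sub>M\<close> to a nonzero element of \<open>A\<^sub>M\<close> alone. So \<open>E\<close> meets \<open>C\<close> or some
  \<open>A\<^sub>M\<close> nontrivially. In the second case it contains \<open>g\<^sub>M = g\<close>: the algebra \<open>End(M)\<close> is local with residue
  field \<open>K\<close> by Fitting's lemma and the existence of eigenvalues, and \<open>g\<^sub>M\<close> is its residue character
  (\<open>character_in_twist_stable\<close>, \<open>connected_D\<close>). Membership of \<open>g\<close> also passes to the union of the tower.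

  It makes the chosen indecomposables quotients. In \<open>\<delta>(m) = r\<^sub>M(m) + \<rho>\<^sub>M(m)\<close> the first factor of \<open>r\<^sub>M(m)\<close> lies in
  \<open>A\<^sub>M\<close>, hence the projection \<open>C\<^sup>\<or> \<rightarrow> M\<close> is a map of right comodules (\<open>projection_onto_representative\<close>).

  It lets colinear maps extend. The projection kills \<open>g\<close>, and a colinear map \<open>C \<rightarrow> Y\<close> that kills \<open>g\<close> extends
  to \<open>C\<^sup>\<or>\<close> by \<open>0\<close> on all \<open>A\<^sub>M\<close> and \<open>M\<close> (\<open>extend_colinear\<close>). So the projection from one level of the tower extends
  to all later levels and to the union (\<open>extend_to_union\<close>).

  A finite-dimensional comodule over the union has its coefficients in one level (\<open>descend_to_level\<close>),
  which gives the statement on indecomposables. An arbitrary comodule is the sum of its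
  finite-dimensional subcomodules, these are sums of indecomposable ones, and therefore all
  homomorphisms from the union together cover it.

  Tensors are representatives modulo the bilinearity relations, but over a field equality of tensors
  can be tested by pairs of functionals (\<open>tensor_eq_iff\<close>). This is the tool for all computations: a right
  comodule becomes a module over the convolution algebra of functionals, subcomodules are the stable
  subspaces, and colinear maps are the linear maps that commute with the action.
\<close>

section \<open>Linear maps and functionals\<close>

text \<open>
  The field as a vector space over itself, so that the lemmas on linear maps apply to functionals.
\<close>

definition fld :: "('k::field, 'k) vspc" where
  "fld = \<lparr>vcarrier = UNIV, vscale = (*)\<rparr>"

abbreviation functional :: "('k::field, 'v::ab_group_add, 'z) vspc_scheme \<Rightarrow> ('v \<Rightarrow> 'k) \<Rightarrow> bool" where
  "functional V \<phi> \<equiv> linear_map V fld \<phi>"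

lemma fld_simps [simp]: "vcarrier fld = UNIV" "vscale fld = (*)"
  by (simp_all add: fld_def)

lemma vector_space_mult: "vector_space ((*) :: 'k::field \<Rightarrow> 'k \<Rightarrow> 'k)"
  by unfold_locales (auto simp: algebra_simps)

lemma vspace_fld [simp]: "vspace (fld :: ('k::field, 'k) vspc)"
proof -
  interpret vector_space "(*) :: 'k \<Rightarrow> 'k \<Rightarrow> 'k" by (rule vector_space_mult)
  show ?thesis unfolding vspace_def by (simp add: vector_space_mult)
qed

lemma vspace_vector_space: "vspace V \<Longrightarrow> vector_space (vscale V)"
  by (simp add: vspace_def)

lemma vspace_module: "vspace V \<Longrightarrow> module (vscale V)"
  by (simp add: vspace_def module_iff_vector_space)

lemma vspace_subspace: "vspace V \<Longrightarrow> module.subspace (vscale V) (vcarrier V)"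
  by (simp add: vspace_def)

lemma vspace_zero: "vspace V \<Longrightarrow> 0 \<in> vcarrier V"
  by (meson module.subspace_0 vspace_module vspace_subspace)

lemma vspace_add: "vspace V \<Longrightarrow> x \<in> vcarrier V \<Longrightarrow> y \<in> vcarrier V \<Longrightarrow> x + y \<in> vcarrier V"
  by (meson module.subspace_add vspace_module vspace_subspace)

lemma vspace_diff: "vspace V \<Longrightarrow> x \<in> vcarrier V \<Longrightarrow> y \<in> vcarrier V \<Longrightarrow> x - y \<in> vcarrier V"
  by (meson module.subspace_diff vspace_module vspace_subspace)

lemma vspace_scale: "vspace V \<Longrightarrow> x \<in> vcarrier V \<Longrightarrow> vscale V r x \<in> vcarrier V"
  by (meson module.subspace_scale vspace_module vspace_subspace)

lemma vspace_sum: "vspace V \<Longrightarrow> (\<And>i. i \<in> I \<Longrightarrow> f i \<in> vcarrier V) \<Longrightarrow> sum f I \<in> vcarrier V"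
  by (meson module.subspace_sum vspace_module vspace_subspace)

lemmas vspace_closed = vspace_zero vspace_add vspace_diff vspace_scale vspace_sum

lemma vspace_scale_simps:
  assumes "vspace V"
  shows "vscale V r 0 = 0" "vscale V 0 x = 0" "vscale V 1 x = x"
    "vscale V r (vscale V s x) = vscale V (r * s) x"
    "vscale V r (x + y) = vscale V r x + vscale V r y"
    "vscale V (r + s) x = vscale V r x + vscale V s x"
    "vscale V r (x - y) = vscale V r x - vscale V r y"
    "vscale V (- r) x = - vscale V r x"
proof -
  interpret vector_space "vscale V" by (rule vspace_vector_space[OF assms])
  show "vscale V r 0 = 0" "vscale V 0 x = 0" "vscale V 1 x = x"
    "vscale V r (vscale V s x) = vscale V (r * s) x"
    "vscale V r (x + y) = vscale V r x + vscale V r y"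
    "vscale V (r + s) x = vscale V r x + vscale V s x"
    "vscale V r (x - y) = vscale V r x - vscale V r y"
    "vscale V (- r) x = - vscale V r x"
    by (simp_all add: scale_right_distrib scale_left_distrib scale_right_diff_distrib)
qed

lemma vspace_scale_eq_0: "vspace V \<Longrightarrow> vscale V r x = 0 \<longleftrightarrow> r = 0 \<or> x = 0"
  using vector_space.scale_eq_0_iff vspace_vector_space by blast

lemma subspace_iff:
  assumes "vspace V"
  shows "module.subspace (vscale V) N \<longleftrightarrow>
    0 \<in> N \<and> (\<forall>x\<in>N. \<forall>y\<in>N. x + y \<in> N) \<and> (\<forall>r. \<forall>x\<in>N. vscale V r x \<in> N)"
  by (auto simp: module.subspace_def[OF vspace_module[OF assms]])

lemma vspace_restrict:
  "vspace V \<Longrightarrow> module.subspace (vscale V) N \<Longrightarrow> vspace (V\<lparr>vcarrier := N\<rparr>)"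
  by (simp add: vspace_def)

lemma linear_mapI:
  assumes "\<And>x. x \<in> vcarrier V \<Longrightarrow> f x \<in> vcarrier W"
    and "\<And>x y. x \<in> vcarrier V \<Longrightarrow> y \<in> vcarrier V \<Longrightarrow> f (x + y) = f x + f y"
    and "\<And>r x. x \<in> vcarrier V \<Longrightarrow> f (vscale V r x) = vscale W r (f x)"
  shows "linear_map V W f"
  using assms by (auto simp: linear_map_def)

lemma linear_map_closed: "linear_map V W f \<Longrightarrow> x \<in> vcarrier V \<Longrightarrow> f x \<in> vcarrier W"
  by (simp add: linear_map_def)

lemma linear_map_add:
  "linear_map V W f \<Longrightarrow> x \<in> vcarrier V \<Longrightarrow> y \<in> vcarrier V \<Longrightarrow> f (x + y) = f x + f y"
  by (simp add: linear_map_def)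

lemma linear_map_scale:
  "linear_map V W f \<Longrightarrow> x \<in> vcarrier V \<Longrightarrow> f (vscale V r x) = vscale W r (f x)"
  by (simp add: linear_map_def)

lemma linear_map_zero: "vspace V \<Longrightarrow> linear_map V W f \<Longrightarrow> f 0 = 0"
  using linear_map_add[of V W f 0 0] by (simp add: vspace_zero)

lemma linear_map_diff:
  "vspace V \<Longrightarrow> linear_map V W f \<Longrightarrow> x \<in> vcarrier V \<Longrightarrow> y \<in> vcarrier V \<Longrightarrow> f (x - y) = f x - f y"
  using linear_map_add[of V W f "x - y" y] by (simp add: vspace_diff algebra_simps)

lemma linear_map_sum:
  assumes "vspace V" "linear_map V W f" "\<And>i. i \<in> I \<Longrightarrow> g i \<in> vcarrier V"
  shows "f (sum g I) = (\<Sum>i\<in>I. f (g i))"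
  using assms(3)
  by (induction I rule: infinite_finite_induct)
     (auto simp: linear_map_zero[OF assms(1,2)] linear_map_add[OF assms(2)] vspace_sum[OF assms(1)])

lemma linear_map_comp:
  "linear_map U V f \<Longrightarrow> linear_map V W g \<Longrightarrow> linear_map U W (\<lambda>x. g (f x))"
  by (simp add: linear_map_def)

lemma linear_map_cong:
  assumes "vspace V" "linear_map V W f" "\<And>x. x \<in> vcarrier V \<Longrightarrow> f x = g x"
  shows "linear_map V W g"
  using assms by (auto simp: linear_map_def vspace_add vspace_scale)

lemma functionalI:
  assumes "\<And>x y. x \<in> vcarrier V \<Longrightarrow> y \<in> vcarrier V \<Longrightarrow> \<phi> (x + y) = \<phi> x + \<phi> y"
    and "\<And>r x. x \<in> vcarrier V \<Longrightarrow> \<phi> (vscale V r x) = r * \<phi> x"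
  shows "functional V \<phi>"
  using assms by (auto simp: linear_map_def)

lemma functional_scale: "functional V \<phi> \<Longrightarrow> x \<in> vcarrier V \<Longrightarrow> \<phi> (vscale V r x) = r * \<phi> x"
  by (simp add: linear_map_def)

lemma functional_mono:
  "functional V \<phi> \<Longrightarrow> vcarrier W \<subseteq> vcarrier V \<Longrightarrow> vscale W = vscale V \<Longrightarrow> functional W \<phi>"
  by (simp add: linear_map_def subset_eq)

lemma subspace_kernel:
  assumes "vspace V" "linear_map V W f" "vspace W"
  shows "module.subspace (vscale V) {x \<in> vcarrier V. f x = 0}"
  using assms(2) unfolding subspace_iff[OF assms(1)]
  by (auto simp: vspace_closed[OF assms(1)] linear_map_zero[OF assms(1,2)] linear_map_add linear_map_scale
      vspace_scale_simps[OF assms(3)])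

lemma subspace_image:
  assumes "vspace V" "linear_map V W f" "vspace W"
  shows "module.subspace (vscale W) (f ` vcarrier V)"
  unfolding subspace_iff[OF assms(3)]
proof (intro conjI ballI allI)
  show "0 \<in> f ` vcarrier V"
    using linear_map_zero[OF assms(1,2)] vspace_zero[OF assms(1)] by (metis imageI)
qed (use assms in \<open>auto simp: linear_map_add[symmetric] linear_map_scale[symmetric]
      vspace_add vspace_scale intro!: imageI\<close>)

lemma linear_map_inv_into:
  assumes V: "vspace V" and f: "linear_map V W f" and bij: "bij_betw f (vcarrier V) (vcarrier W)"
  shows "linear_map W V (inv_into (vcarrier V) f)"
    "\<And>x. x \<in> vcarrier V \<Longrightarrow> inv_into (vcarrier V) f (f x) = x"
    "\<And>y. y \<in> vcarrier W \<Longrightarrow> f (inv_into (vcarrier V) f y) = y"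
proof -
  let ?h = "inv_into (vcarrier V) f"
  show hf: "?h (f x) = x" if "x \<in> vcarrier V" for x
    using bij that by (simp add: bij_betw_def)
  show fh: "f (?h y) = y" if "y \<in> vcarrier W" for y
    using bij that by (simp add: bij_betw_def f_inv_into_f)
  have cl: "?h y \<in> vcarrier V" if "y \<in> vcarrier W" for y
    using bij that by (metis bij_betw_def inv_into_into)
  show "linear_map W V ?h"
  proof (rule linear_mapI)
    fix x y r assume x: "x \<in> vcarrier W"
    show "?h (vscale W r x) = vscale V r (?h x)"
      using hf[OF vspace_scale[OF V cl[OF x]], of r] x by (simp add: linear_map_scale[OF f] cl fh)
    assume y: "y \<in> vcarrier W"
    show "?h (x + y) = ?h x + ?h y"
      using hf[OF vspace_add[OF V cl[OF x] cl[OF y]]] x y by (simp add: linear_map_add[OF f] cl fh)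
  qed (rule cl)
qed

text \<open>
  A basis of the subspace is independent in the ambient space as well, so values on it, and on one
  further vector outside its span, can be prescribed freely.
\<close>

lemma functional_extend:
  assumes V: "vspace V" and \<phi>: "functional V \<phi>"
  shows "\<exists>\<phi>'. functional (V\<lparr>vcarrier := UNIV\<rparr>) \<phi>' \<and> (\<forall>x\<in>vcarrier V. \<phi>' x = \<phi> x)"
proof -
  interpret vector_space_pair "vscale V" "(*) :: 'a \<Rightarrow> 'a \<Rightarrow> 'a"
    using vspace_vector_space[OF V] vector_space_mult by (simp add: vector_space_pair_def)
  obtain B where B: "B \<subseteq> vcarrier V" "vs1.independent B" "vcarrier V \<subseteq> vs1.span B"
    using vs1.maximal_independent_subset by blast
  obtain \<psi> where \<psi>: "Vector_Spaces.linear (vscale V) (*) \<psi>" "\<forall>x\<in>B. \<psi> x = \<phi> x"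
    using linear_independent_extend[OF B(2), of \<phi>] by blast
  have "\<psi> x = \<phi> x \<and> x \<in> vcarrier V" if "x \<in> vcarrier V" for x
  proof -
    have "x \<in> vs1.span B" using that B(3) by blast
    then show ?thesis
    proof (induction rule: vs1.span_induct_alt)
      case base
      show ?case using linear_map_zero[OF V \<phi>] vspace_zero[OF V] \<psi>(1)
        by (simp add: linear_iff_module_hom module_hom.zero)
    next
      case (step c x y)
      then have "x \<in> vcarrier V" "\<psi> x = \<phi> x" using B \<psi> by auto
      moreover have "\<psi> (vscale V c x + y) = c * \<psi> x + \<psi> y" using \<psi>(1) by (simp add: Vector_Spaces.linear_iff)
      ultimately show ?case using step V \<phi>
        by (simp add: linear_map_add functional_scale vspace_closed)
    qed
  qed
  then show ?thesis using \<psi>(1) by (intro exI[of _ \<psi>]) (auto simp: linear_map_def Vector_Spaces.linear_iff)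
qed

lemma functional_separates:
  assumes V: "vspace V" and N: "module.subspace (vscale V) N" and x: "x \<notin> N"
  shows "\<exists>\<phi>. functional V \<phi> \<and> (\<forall>n\<in>N. \<phi> n = 0) \<and> \<phi> x = 1"
proof -
  interpret vector_space_pair "vscale V" "(*) :: 'a \<Rightarrow> 'a \<Rightarrow> 'a"
    using vspace_vector_space[OF V] vector_space_mult by (simp add: vector_space_pair_def)
  obtain B where B: "B \<subseteq> N" "vs1.independent B" "N \<subseteq> vs1.span B"
    using vs1.maximal_independent_subset by blast
  have "vs1.span B \<subseteq> N" by (rule vs1.span_minimal[OF B(1) N])
  then have xs: "x \<notin> vs1.span B" using x by blast
  then have ind: "vs1.independent (insert x B)" using B(2) by (simp add: vs1.independent_insertI)
  obtain \<psi> where \<psi>: "Vector_Spaces.linear (vscale V) (*) \<psi>"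
      "\<forall>y\<in>insert x B. \<psi> y = (if y = x then 1 else 0)"
    using linear_independent_extend[OF ind, of "\<lambda>y. if y = x then 1 else 0"] by blast
  have "\<psi> b = 0" if "b \<in> B" for b using that \<psi>(2) xs vs1.span_base by fastforce
  then have "\<forall>n\<in>N. \<psi> n = 0" using B(3) \<psi>(1)
    by (metis linear_iff_module_hom module_hom.eq_0_on_span subsetD)
  then show ?thesis using \<psi> by (intro exI[of _ \<psi>]) (auto simp: linear_map_def Vector_Spaces.linear_iff)
qed

lemma functional_eqI:
  assumes V: "vspace V" and "\<And>\<phi>. functional V \<phi> \<Longrightarrow> \<phi> x = \<phi> y"
    and "x \<in> vcarrier V" "y \<in> vcarrier V"
  shows "x = y"
proof (rule ccontr)
  assume "x \<noteq> y"
  interpret vector_space "vscale V" by (rule vspace_vector_space[OF V])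
  have "x - y \<notin> {0}" using \<open>x \<noteq> y\<close> by simp
  then obtain \<phi> where "functional V \<phi>" "\<phi> (x - y) = 1"
    using functional_separates[OF V subspace_single_0] by blast
  then show False using assms(2)[of \<phi>] linear_map_diff[OF V, of fld \<phi> x y] assms by simp
qed

section \<open>Tensors are determined by pairs of functionals\<close>

lemma lookup_fscale [simp]: "Poly_Mapping.lookup (fscale r p) x = r * Poly_Mapping.lookup p x"
  unfolding fscale_def by (simp add: Poly_Mapping.map.rep_eq when_def)

lemma vector_space_fscale: "vector_space (fscale :: 'k::field \<Rightarrow> ('x \<Rightarrow>\<^sub>0 'k) \<Rightarrow> _)"
  by unfold_locales (auto intro!: poly_mapping_eqI simp: lookup_add algebra_simps)

lemma fscale_single [simp]: "fscale r (Poly_Mapping.single x s) = Poly_Mapping.single x (r * s)"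
  by (rule poly_mapping_eqI) (simp add: lookup_single when_def)

interpretation free: vector_space "fscale :: 'k::field \<Rightarrow> ('x \<Rightarrow>\<^sub>0 'k) \<Rightarrow> _"
  by (rule vector_space_fscale)

lemma keys_fscale: "Poly_Mapping.keys (fscale r p) \<subseteq> Poly_Mapping.keys p"
  by (auto simp: in_keys_iff)

lemma poly_mapping_eq_sum_pure:
  fixes t :: "'x \<Rightarrow>\<^sub>0 'k::field"
  shows "t = (\<Sum>x\<in>Poly_Mapping.keys t. fscale (Poly_Mapping.lookup t x) (pure x))"
  by (rule poly_mapping_eqI)
     (simp add: lookup_sum lookup_single when_def in_keys_iff)

context vector_space
begin

lemma lin_ext_superset:
  assumes "finite A" "Poly_Mapping.keys t \<subseteq> A"
  shows "lin_ext scale h t = (\<Sum>x\<in>A. scale (Poly_Mapping.lookup t x) (h x))"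
  unfolding lin_ext_def by (rule sum.mono_neutral_left) (use assms in \<open>auto simp: in_keys_iff\<close>)

lemma lin_ext_zero [simp]: "lin_ext scale h 0 = 0"
  by (simp add: lin_ext_def)

lemma lin_ext_add: "lin_ext scale h (t + u) = lin_ext scale h t + lin_ext scale h u"
proof -
  let ?A = "Poly_Mapping.keys t \<union> Poly_Mapping.keys u"
  have k: "finite ?A" "Poly_Mapping.keys t \<subseteq> ?A" "Poly_Mapping.keys u \<subseteq> ?A"
    "Poly_Mapping.keys (t + u) \<subseteq> ?A"
    using Poly_Mapping.keys_add[of t u] by auto
  show ?thesis
    unfolding lin_ext_superset[OF k(1,2)] lin_ext_superset[OF k(1,3)] lin_ext_superset[OF k(1,4)]
    by (simp add: lookup_add scale_left_distrib sum.distrib)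
qed

lemma lin_ext_fscale: "lin_ext scale h (fscale r t) = scale r (lin_ext scale h t)"
  unfolding lin_ext_superset[OF finite_keys keys_fscale]
  by (simp add: lin_ext_def scale_sum_right)

lemma lin_ext_diff: "lin_ext scale h (t - u) = lin_ext scale h t - lin_ext scale h u"
  using lin_ext_add[of h "t - u" u] by (simp add: algebra_simps)

lemma lin_ext_sum: "lin_ext scale h (sum f I) = (\<Sum>i\<in>I. lin_ext scale h (f i))"
  by (induction I rule: infinite_finite_induct) (auto simp: lin_ext_add)

lemma lin_ext_single [simp]: "lin_ext scale h (Poly_Mapping.single x r) = scale r (h x)"
  by (cases "r = 0") (auto simp: lin_ext_def)

lemma lin_ext_lin_ext:
  "lin_ext scale h (lin_ext fscale g t) = lin_ext scale (\<lambda>x. lin_ext scale h (g x)) t"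
  unfolding lin_ext_def[of fscale g t] lin_ext_sum lin_ext_fscale
  by (rule lin_ext_def[symmetric])

lemma lin_ext_in_span: "(\<And>x. x \<in> Poly_Mapping.keys t \<Longrightarrow> h x \<in> S) \<Longrightarrow> lin_ext scale h t \<in> span S"
  unfolding lin_ext_def by (intro span_sum span_scale span_base)

end

lemma lin_ext_cong:
  "(\<And>x. x \<in> Poly_Mapping.keys t \<Longrightarrow> h x = h' x) \<Longrightarrow> lin_ext s h t = lin_ext s h' t"
  by (simp add: lin_ext_def)

lemma lin_ext_closed:
  "vspace V \<Longrightarrow> (\<And>x. x \<in> Poly_Mapping.keys t \<Longrightarrow> h x \<in> vcarrier V) \<Longrightarrow> lin_ext (vscale V) h t \<in> vcarrier V"
  unfolding lin_ext_def by (intro vspace_sum vspace_scale) auto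

lemma linear_map_lin_ext:
  assumes "vspace V" "linear_map V W f" "\<And>x. x \<in> Poly_Mapping.keys t \<Longrightarrow> h x \<in> vcarrier V"
  shows "f (lin_ext (vscale V) h t) = lin_ext (vscale W) (\<lambda>x. f (h x)) t"
  unfolding lin_ext_def using assms
  by (simp add: linear_map_sum[OF assms(1,2)] vspace_scale linear_map_scale)

lemmas scalar_lin_ext_zero [simp] = vector_space.lin_ext_zero[OF vector_space_mult]
  and scalar_lin_ext_single [simp] = vector_space.lin_ext_single[OF vector_space_mult]
  and scalar_lin_ext_add = vector_space.lin_ext_add[OF vector_space_mult]
  and scalar_lin_ext_diff = vector_space.lin_ext_diff[OF vector_space_mult]
  and scalar_lin_ext_fscale = vector_space.lin_ext_fscale[OF vector_space_mult]
  and scalar_lin_ext_sum = vector_space.lin_ext_sum[OF vector_space_mult]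
  and scalar_lin_ext_lin_ext = vector_space.lin_ext_lin_ext[OF vector_space_mult]

text \<open>
  On a representative of a tensor, \<open>ev \<phi> \<psi>\<close> is \<open>\<phi> \<otimes> \<psi>\<close>, and \<open>ev3 \<phi> \<psi> \<chi>\<close> is \<open>\<phi> \<otimes> \<psi> \<otimes> \<chi>\<close>.
\<close>

definition ev :: "('v \<Rightarrow> 'k) \<Rightarrow> ('w \<Rightarrow> 'k) \<Rightarrow> ('v \<times> 'w \<Rightarrow>\<^sub>0 'k::field) \<Rightarrow> 'k" where
  "ev \<phi> \<psi> = lin_ext (*) (\<lambda>(v, w). \<phi> v * \<psi> w)"

definition ev3 :: "('u \<Rightarrow> 'k) \<Rightarrow> ('v \<Rightarrow> 'k) \<Rightarrow> ('w \<Rightarrow> 'k) \<Rightarrow> ('u \<times> 'v \<times> 'w \<Rightarrow>\<^sub>0 'k::field) \<Rightarrow> 'k" where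
  "ev3 \<phi> \<psi> \<chi> = lin_ext (*) (\<lambda>(u, v, w). \<phi> u * \<psi> v * \<chi> w)"

lemma ev_simps [simp]:
  "ev \<phi> \<psi> 0 = 0"
  "ev \<phi> \<psi> (t + u) = ev \<phi> \<psi> t + ev \<phi> \<psi> u"
  "ev \<phi> \<psi> (t - u) = ev \<phi> \<psi> t - ev \<phi> \<psi> u"
  "ev \<phi> \<psi> (fscale r t) = r * ev \<phi> \<psi> t"
  "ev \<phi> \<psi> (sum f I) = (\<Sum>i\<in>I. ev \<phi> \<psi> (f i))"
  "ev \<phi> \<psi> (Poly_Mapping.single (v, w) r) = r * (\<phi> v * \<psi> w)"
  by (simp_all add: ev_def scalar_lin_ext_add scalar_lin_ext_diff scalar_lin_ext_fscale scalar_lin_ext_sum)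

lemma ev3_simps [simp]:
  "ev3 \<phi> \<psi> \<chi> 0 = 0"
  "ev3 \<phi> \<psi> \<chi> (t + u) = ev3 \<phi> \<psi> \<chi> t + ev3 \<phi> \<psi> \<chi> u"
  "ev3 \<phi> \<psi> \<chi> (t - u) = ev3 \<phi> \<psi> \<chi> t - ev3 \<phi> \<psi> \<chi> u"
  "ev3 \<phi> \<psi> \<chi> (fscale r t) = r * ev3 \<phi> \<psi> \<chi> t"
  "ev3 \<phi> \<psi> \<chi> (Poly_Mapping.single (u', v, w) r) = r * (\<phi> u' * \<psi> v * \<chi> w)"
  by (simp_all add: ev3_def scalar_lin_ext_add scalar_lin_ext_diff scalar_lin_ext_fscale)

lemma ev_tmap: "ev \<phi> \<psi> (tmap f g t) = ev (\<lambda>x. \<phi> (f x)) (\<lambda>x. \<psi> (g x)) t"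
  unfolding ev_def tmap_def scalar_lin_ext_lin_ext
  by (rule lin_ext_cong) (auto split: prod.splits)

lemma lin_ext_mult:
  fixes h :: "'x \<Rightarrow> 'k::field"
  shows "lin_ext (*) (\<lambda>x. r * h x) t = r * lin_ext (*) h t"
  unfolding lin_ext_def sum_distrib_left by (rule sum.cong) (simp_all add: mult.left_commute)

lemma lin_ext_mult_right:
  fixes h :: "'x \<Rightarrow> 'k::field"
  shows "lin_ext (*) (\<lambda>x. h x * r) t = lin_ext (*) h t * r"
  using lin_ext_mult[of r h t] by (simp add: mult.commute)

lemma ev3_expand_left: "ev3 \<phi> \<psi> \<chi> (expand_left \<rho> t) = ev (\<lambda>x. ev \<phi> \<psi> (\<rho> x)) \<chi> t"
  unfolding ev_def ev3_def expand_left_def scalar_lin_ext_lin_ext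
  by (rule lin_ext_cong)
     (simp add: scalar_lin_ext_lin_ext case_prod_unfold lin_ext_mult_right)

lemma ev3_expand_right: "ev3 \<phi> \<psi> \<chi> (expand_right \<rho> t) = ev \<phi> (\<lambda>x. ev \<psi> \<chi> (\<rho> x)) t"
proof -
  have 1: "ev3 \<phi> \<psi> \<chi> (lin_ext fscale (\<lambda>(a, b). pure (v, a, b)) u) = \<phi> v * ev \<psi> \<chi> u" for v u
    unfolding ev_def ev3_def scalar_lin_ext_lin_ext
    by (subst lin_ext_mult[symmetric], rule lin_ext_cong) (auto simp: mult.assoc)
  have "ev3 \<phi> \<psi> \<chi> (expand_right \<rho> t) = lin_ext (*) (\<lambda>x. ev3 \<phi> \<psi> \<chi> (case x of (v, w) \<Rightarrow>
      lin_ext fscale (\<lambda>(a, b). pure (v, a, b)) (\<rho> w))) t"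
    unfolding ev3_def expand_right_def by (rule scalar_lin_ext_lin_ext)
  also have "\<dots> = ev \<phi> (\<lambda>x. ev \<psi> \<chi> (\<rho> x)) t"
    unfolding ev_def[of \<phi>] by (rule lin_ext_cong) (auto simp: 1)
  finally show ?thesis .
qed

lemma ev_cong:
  assumes "\<And>v w. (v, w) \<in> Poly_Mapping.keys t \<Longrightarrow> \<phi> v = \<phi>' v"
    and "\<And>v w. (v, w) \<in> Poly_Mapping.keys t \<Longrightarrow> \<psi> w = \<psi>' w"
  shows "ev \<phi> \<psi> t = ev \<phi>' \<psi>' t"
  unfolding ev_def by (rule lin_ext_cong) (use assms in auto)

lemma lin_ext_plus:
  fixes h :: "'x \<Rightarrow> 'k::field"
  shows "lin_ext (*) (\<lambda>x. h x + h' x) t = lin_ext (*) h t + lin_ext (*) h' t"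
  by (simp add: lin_ext_def distrib_left sum.distrib)

lemma ev_add_right: "ev \<phi> (\<lambda>x. \<psi> x + \<psi>' x) t = ev \<phi> \<psi> t + ev \<phi> \<psi>' t"
  by (simp add: ev_def case_prod_unfold distrib_left lin_ext_plus)

lemma ev_scale_right: "ev \<phi> (\<lambda>x. r * \<psi> x) t = r * ev \<phi> \<psi> t"
  unfolding ev_def by (subst lin_ext_mult[symmetric], rule lin_ext_cong) (auto simp: mult_ac)

lemma ev_zero [simp]: "ev (\<lambda>x. 0) \<psi> t = 0" "ev \<phi> (\<lambda>x. 0) t = 0"
  unfolding ev_def lin_ext_def by (simp_all add: case_prod_unfold)

lemma subspace_ev_zero: "module.subspace fscale {t. ev \<phi> \<psi> t = 0}"
  by (simp add: free.subspace_def)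

lemma subspace_ev3_zero: "module.subspace fscale {t. ev3 \<phi> \<psi> \<chi> t = 0}"
  by (simp add: free.subspace_def)

lemma tensor_eq_imp_ev:
  assumes "tensor_eq V W t u" "functional V \<phi>" "functional W \<psi>"
  shows "ev \<phi> \<psi> t = ev \<phi> \<psi> u"
proof -
  have "tensor_relations V W \<subseteq> {t. ev \<phi> \<psi> t = 0}"
    using assms(2,3) unfolding tensor_relations_def linear_map_def by (auto simp: distrib_left distrib_right mult_ac)
  from free.span_minimal[OF this subspace_ev_zero] assms(1)
  have "ev \<phi> \<psi> (t - u) = 0" unfolding tensor_eq_def by blast
  then show ?thesis by simp
qed

lemma tensor3_eq_imp_ev3:
  assumes "tensor3_eq U V W t u" "functional U \<phi>" "functional V \<psi>" "functional W \<chi>"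
  shows "ev3 \<phi> \<psi> \<chi> t = ev3 \<phi> \<psi> \<chi> u"
proof -
  have "tensor3_relations U V W \<subseteq> {t. ev3 \<phi> \<psi> \<chi> t = 0}"
    using assms(2,3,4) unfolding tensor3_relations_def linear_map_def by (auto simp: distrib_left distrib_right mult_ac)
  from free.span_minimal[OF this subspace_ev3_zero] assms(1)
  have "ev3 \<phi> \<psi> \<chi> (t - u) = 0" unfolding tensor3_eq_def by blast
  then show ?thesis by simp
qed

text \<open>
  Finitely many vectors involve only finitely many elements of a basis, even if the basis is
  infinite.
\<close>

lemma coordinates_exist:
  assumes V: "vspace V" and A: "finite A" "\<And>x. x \<in> A \<Longrightarrow> f x \<in> vcarrier V"
  obtains J r where "finite J" "J \<subseteq> vcarrier V" "\<And>b. functional V (\<lambda>v. r v b)"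
    "\<And>x. x \<in> A \<Longrightarrow> f x = (\<Sum>b\<in>J. vscale V (r (f x) b) b)"
proof -
  interpret vector_space "vscale V" by (rule vspace_vector_space[OF V])
  obtain B where B: "B \<subseteq> vcarrier V" "independent B" "vcarrier V \<subseteq> span B"
    using maximal_independent_subset by blast
  define r where "r = representation B"
  have func: "functional V (\<lambda>v. r v b)" for b
    by (rule functionalI)
       (use B in \<open>auto simp: r_def representation_add representation_scale subset_iff\<close>)
  let ?J = "\<Union>x\<in>A. {b. r (f x) b \<noteq> 0}"
  have fin: "finite ?J"
    unfolding r_def using A by (intro finite_UN_I) (auto simp: finite_representation)
  have "?J \<subseteq> B" unfolding r_def using representation_ne_zero by blast
  then have JV: "?J \<subseteq> vcarrier V" using B by blast
  have "f x = (\<Sum>b\<in>?J. vscale V (r (f x) b) b)" if x: "x \<in> A" for x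
  proof -
    have "f x \<in> span B" using x A B by blast
    then have "f x = (\<Sum>b | r (f x) b \<noteq> 0. vscale V (r (f x) b) b)"
      unfolding r_def by (rule sum_nonzero_representation_eq[OF B(2), symmetric])
    also have "\<dots> = (\<Sum>b\<in>?J. vscale V (r (f x) b) b)"
      by (rule sum.mono_neutral_left) (use fin x in auto)
    finally show ?thesis .
  qed
  then show thesis by (rule that[OF fin JV func])
qed

text \<open>
  Maps such as \<open>v \<mapsto> pure (v, w)\<close> into the free vector space are linear only modulo the bilinearity
  relations.
\<close>

lemma linear_modulo_sum:
  fixes p :: "'v::ab_group_add \<Rightarrow> 'x \<Rightarrow>\<^sub>0 'k::field"
  assumes V: "vspace V" and R: "module.subspace fscale R"
    and add: "\<And>x y. x \<in> vcarrier V \<Longrightarrow> y \<in> vcarrier V \<Longrightarrow> p (x + y) - p x - p y \<in> R"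
    and scale: "\<And>r x. x \<in> vcarrier V \<Longrightarrow> p (vscale V r x) - fscale r (p x) \<in> R"
    and g: "\<And>i. i \<in> I \<Longrightarrow> g i \<in> vcarrier V"
  shows "p (\<Sum>i\<in>I. vscale V (c i) (g i)) - (\<Sum>i\<in>I. fscale (c i) (p (g i))) \<in> R"
proof -
  have p0: "p 0 \<in> R" using scale[of 0 0]
    by (simp add: vspace_zero[OF V] vspace_scale_simps[OF V])
  show ?thesis using g
  proof (induction I rule: infinite_finite_induct)
    case (insert i I)
    let ?s = "\<Sum>i\<in>I. vscale V (c i) (g i)"
    have s: "?s \<in> vcarrier V" "vscale V (c i) (g i) \<in> vcarrier V"
      using insert by (auto intro!: vspace_closed[OF V])
    have "p (vscale V (c i) (g i) + ?s) - p (vscale V (c i) (g i)) - p ?s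
      + ((p (vscale V (c i) (g i)) - fscale (c i) (p (g i)))
      + (p ?s - (\<Sum>i\<in>I. fscale (c i) (p (g i))))) \<in> R"
      using insert by (intro free.subspace_add[OF R] add scale s) auto
    then show ?case using insert by (simp add: algebra_simps)
  qed (use p0 in auto)
qed

text \<open>
  A tensor whose first factors are expanded in a basis has the form \<open>\<Sum>i q i (w i)\<close>, and the
  remaining factors \<open>w i\<close> can be collected because \<open>q i\<close> is linear modulo the relations. This
  covers two and three factors, and an expansion on either side.
\<close>

lemma tensor_normal_form:
  fixes t :: "'x \<Rightarrow>\<^sub>0 'k::field" and q :: "'i \<Rightarrow> 'w::ab_group_add \<Rightarrow> 'x \<Rightarrow>\<^sub>0 'k"
  assumes W: "vspace W" and R: "module.subspace fscale R" and J: "finite J"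
    and add: "\<And>i x y. i \<in> J \<Longrightarrow> x \<in> vcarrier W \<Longrightarrow> y \<in> vcarrier W \<Longrightarrow> q i (x + y) - q i x - q i y \<in> R"
    and scale: "\<And>i r x. i \<in> J \<Longrightarrow> x \<in> vcarrier W \<Longrightarrow> q i (vscale W r x) - fscale r (q i x) \<in> R"
    and s: "\<And>x. x \<in> Poly_Mapping.keys t \<Longrightarrow> s x \<in> vcarrier W"
    and expand: "\<And>x. x \<in> Poly_Mapping.keys t \<Longrightarrow>
      pure x - (\<Sum>i\<in>J. fscale (c i x) (q i (s x))) \<in> R"
  shows "t - (\<Sum>i\<in>J. q i (\<Sum>x\<in>Poly_Mapping.keys t.
      vscale W (Poly_Mapping.lookup t x * c i x) (s x))) \<in> R"
proof -
  let ?l = "Poly_Mapping.lookup t" and ?K = "Poly_Mapping.keys t"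
  define w where "w i = (\<Sum>x\<in>?K. vscale W (?l x * c i x) (s x))" for i
  have 1: "(\<Sum>x\<in>?K. fscale (?l x) (pure x - (\<Sum>i\<in>J. fscale (c i x) (q i (s x))))) \<in> R"
    by (intro free.subspace_sum[OF R] free.subspace_scale[OF R] expand)
  have 2: "(\<Sum>i\<in>J. q i (w i) - (\<Sum>x\<in>?K. fscale (?l x * c i x) (q i (s x)))) \<in> R"
    unfolding w_def
    by (intro free.subspace_sum[OF R] linear_modulo_sum[OF W R] add scale s)
  have "(\<Sum>x\<in>?K. fscale (?l x) (pure x - (\<Sum>i\<in>J. fscale (c i x) (q i (s x)))))
    = t - (\<Sum>x\<in>?K. \<Sum>i\<in>J. fscale (?l x * c i x) (q i (s x)))"
    by (subst (3) poly_mapping_eq_sum_pure)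
       (simp add: free.scale_right_diff_distrib sum_subtractf free.scale_sum_right)
  also have "(\<Sum>x\<in>?K. \<Sum>i\<in>J. fscale (?l x * c i x) (q i (s x)))
    = (\<Sum>i\<in>J. \<Sum>x\<in>?K. fscale (?l x * c i x) (q i (s x)))"
    by (rule sum.swap)
  finally have "t - (\<Sum>i\<in>J. q i (w i)) = (\<Sum>x\<in>?K. fscale (?l x) (pure x - (\<Sum>i\<in>J. fscale (c i x) (q i (s x)))))
    - (\<Sum>i\<in>J. q i (w i) - (\<Sum>x\<in>?K. fscale (?l x * c i x) (q i (s x))))"
    by (simp add: sum_subtractf)
  then show ?thesis unfolding w_def[symmetric] using free.subspace_diff[OF R 1 2] by simp
qed

text \<open>
  Functionals separate points, so a coefficient \<open>w i\<close> on which all functionals vanish is zero.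
\<close>

lemma tensor_normal_form_zero:
  fixes t :: "'x \<Rightarrow>\<^sub>0 'k::field" and q :: "'i \<Rightarrow> 'w::ab_group_add \<Rightarrow> 'x \<Rightarrow>\<^sub>0 'k"
  assumes W: "vspace W" and R: "module.subspace fscale R" and J: "finite J"
    and add: "\<And>i x y. i \<in> J \<Longrightarrow> x \<in> vcarrier W \<Longrightarrow> y \<in> vcarrier W \<Longrightarrow> q i (x + y) - q i x - q i y \<in> R"
    and scale: "\<And>i r x. i \<in> J \<Longrightarrow> x \<in> vcarrier W \<Longrightarrow> q i (vscale W r x) - fscale r (q i x) \<in> R"
    and s: "\<And>x. x \<in> Poly_Mapping.keys t \<Longrightarrow> s x \<in> vcarrier W"
    and expand: "\<And>x. x \<in> Poly_Mapping.keys t \<Longrightarrow>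
      pure x - (\<Sum>i\<in>J. fscale (c i x) (q i (s x))) \<in> R"
    and zero: "\<And>i \<psi>. i \<in> J \<Longrightarrow> functional W \<psi> \<Longrightarrow>
      lin_ext (*) (\<lambda>x. c i x * \<psi> (s x)) t = 0"
  shows "t \<in> R"
proof -
  let ?l = "Poly_Mapping.lookup t" and ?K = "Poly_Mapping.keys t"
  define w where "w i = (\<Sum>x\<in>?K. vscale W (?l x * c i x) (s x))" for i
  have "w i = 0" if "i \<in> J" for i
  proof (rule functional_eqI[OF W])
    show "w i \<in> vcarrier W" "0 \<in> vcarrier W"
      unfolding w_def by (auto intro!: vspace_closed[OF W] s)
    fix \<psi> assume \<psi>: "functional W \<psi>"
    have "\<psi> (w i) = lin_ext (*) (\<lambda>x. c i x * \<psi> (s x)) t"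
      unfolding w_def lin_ext_def
      by (subst linear_map_sum[OF W \<psi>])
         (auto intro!: vspace_scale[OF W] s sum.cong simp: functional_scale[OF \<psi> s])
    then show "\<psi> (w i) = \<psi> 0" using zero[OF that \<psi>] linear_map_zero[OF W \<psi>] by simp
  qed
  moreover have "q i 0 \<in> R" if "i \<in> J" for i
    using scale[OF that, of 0 0] by (simp add: vspace_zero[OF W] vspace_scale_simps[OF W])
  ultimately have "(\<Sum>i\<in>J. q i (w i)) \<in> R" by (auto intro!: free.subspace_sum[OF R])
  moreover have "t - (\<Sum>i\<in>J. q i (w i)) \<in> R"
    unfolding w_def by (rule tensor_normal_form[OF W R J add scale s expand])
  ultimately show ?thesis using free.subspace_add[OF R] by fastforce
qed

lemma tensor_relation_left:
  fixes V :: "('k::field, 'v::ab_group_add, 'z) vspc_scheme" and W :: "('k, 'w::ab_group_add, 'y) vspc_scheme"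
  assumes "w \<in> vcarrier W"
  shows "x \<in> vcarrier V \<Longrightarrow> y \<in> vcarrier V \<Longrightarrow>
      pure (x + y, w) - pure (x, w) - pure (y, w) \<in> module.span fscale (tensor_relations V W)"
    and "x \<in> vcarrier V \<Longrightarrow> pure (vscale V r x, w) - fscale r (pure (x, w))
      \<in> module.span fscale (tensor_relations V W)"
  unfolding tensor_relations_def by (rule free.span_base, use assms in blast)+

lemma tensor_relation_right:
  fixes V :: "('k::field, 'v::ab_group_add, 'z) vspc_scheme" and W :: "('k, 'w::ab_group_add, 'y) vspc_scheme"
  assumes "v \<in> vcarrier V"
  shows "x \<in> vcarrier W \<Longrightarrow> y \<in> vcarrier W \<Longrightarrow>
      pure (v, x + y) - pure (v, x) - pure (v, y) \<in> module.span fscale (tensor_relations V W)"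
    and "x \<in> vcarrier W \<Longrightarrow> pure (v, vscale W r x) - fscale r (pure (v, x))
      \<in> module.span fscale (tensor_relations V W)"
  unfolding tensor_relations_def by (rule free.span_base, use assms in blast)+

lemma pure_expand_left:
  fixes V :: "('k::field, 'v::ab_group_add, 'z) vspc_scheme" and W :: "('k, 'w::ab_group_add, 'y) vspc_scheme"
  assumes V: "vspace V" and w: "w \<in> vcarrier W" and J: "J \<subseteq> vcarrier V"
  shows "pure (\<Sum>b\<in>J. vscale V (r b) b, w) - (\<Sum>b\<in>J. fscale (r b) (pure (b, w)))
    \<in> module.span fscale (tensor_relations V W)"
  using J by (intro linear_modulo_sum[where p = "\<lambda>v. pure (v, w)", OF V free.subspace_span]
      tensor_relation_left w) auto

lemma pure_expand_right:
  fixes V :: "('k::field, 'v::ab_group_add, 'z) vspc_scheme" and W :: "('k, 'w::ab_group_add, 'y) vspc_scheme"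
  assumes W: "vspace W" and v: "v \<in> vcarrier V" and J: "J \<subseteq> vcarrier W"
  shows "pure (v, \<Sum>b\<in>J. vscale W (r b) b) - (\<Sum>b\<in>J. fscale (r b) (pure (v, b)))
    \<in> module.span fscale (tensor_relations V W)"
  using J by (intro linear_modulo_sum[where p = "\<lambda>w. pure (v, w)", OF W free.subspace_span]
      tensor_relation_right v) auto

lemma tensors_diff: "t \<in> tensors V W \<Longrightarrow> u \<in> tensors V W \<Longrightarrow> t - u \<in> tensors V W"
  using keys_diff[of t u] by (auto simp: tensors_def)

text \<open>
  Expand the first factors of \<open>t - u\<close> in a basis. The coordinate functionals, paired with an arbitrary
  functional on the second space, detect the coefficients. The resulting test no longer depends on
  the space of relations, which makes tensors over different carriers comparable.
\<close>

theorem tensor_eq_iff: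
  fixes V :: "('k::field, 'v::ab_group_add, 'z) vspc_scheme" and W :: "('k, 'w::ab_group_add, 'y) vspc_scheme"
  assumes V: "vspace V" and W: "vspace W" and t: "t \<in> tensors V W" and u: "u \<in> tensors V W"
  shows "tensor_eq V W t u \<longleftrightarrow>
    (\<forall>\<phi> \<psi>. functional V \<phi> \<longrightarrow> functional W \<psi> \<longrightarrow> ev \<phi> \<psi> t = ev \<phi> \<psi> u)" (is "?l \<longleftrightarrow> ?r")
proof
  assume ?r
  let ?d = "t - u" and ?R = "module.span fscale (tensor_relations V W)"
  have d: "fst x \<in> vcarrier V \<and> snd x \<in> vcarrier W" if "x \<in> Poly_Mapping.keys ?d" for x
    using tensors_diff[OF t u] that by (cases x) (auto simp: tensors_def)
  obtain J r where J: "finite J" "J \<subseteq> vcarrier V" and r: "\<And>b. functional V (\<lambda>v. r v b)"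
    and J_sum: "\<And>x. x \<in> Poly_Mapping.keys ?d \<Longrightarrow> fst x = (\<Sum>b\<in>J. vscale V (r (fst x) b) b)"
    using coordinates_exist[OF V finite_keys[of "?d"], of "\<lambda>x. fst x"] d by blast
  have "?d \<in> ?R"
  proof (rule tensor_normal_form_zero[OF W free.subspace_span J(1)])
    show "pure x - (\<Sum>b\<in>J. fscale (r (fst x) b) (pure (b, snd x))) \<in> ?R"
      if "x \<in> Poly_Mapping.keys ?d" for x
      using pure_expand_left[OF V, of "snd x" W J "r (fst x)"] J J_sum[OF that] d[OF that] by (cases x) auto
    show "lin_ext (*) (\<lambda>x. r (fst x) b * \<psi> (snd x)) ?d = 0" if "functional W \<psi>" for b \<psi>
    proof -
      have "ev (\<lambda>v. r v b) \<psi> ?d = 0" using \<open>?r\<close> r that by simp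
      then show ?thesis by (simp add: ev_def case_prod_unfold)
    qed
  qed (use J d in \<open>auto intro!: tensor_relation_right simp del: fscale_single\<close>)
  then show ?l by (simp add: tensor_eq_def)
qed (use tensor_eq_imp_ev in blast)

text \<open>
  The same argument after an expansion of the first two factors.
\<close>

theorem tensor3_eq_iff:
  fixes U :: "('k::field, 'u::ab_group_add, 'x) vspc_scheme"
    and V :: "('k::field, 'v::ab_group_add, 'z) vspc_scheme" and W :: "('k, 'w::ab_group_add, 'y) vspc_scheme"
  assumes U: "vspace U" and V: "vspace V" and W: "vspace W"
    and t: "Poly_Mapping.keys t \<subseteq> vcarrier U \<times> vcarrier V \<times> vcarrier W"
    and u: "Poly_Mapping.keys u \<subseteq> vcarrier U \<times> vcarrier V \<times> vcarrier W"
  shows "tensor3_eq U V W t u \<longleftrightarrow> (\<forall>\<phi> \<psi> \<chi>. functional U \<phi> \<longrightarrow> functional V \<psi> \<longrightarrow> functional W \<chi>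
      \<longrightarrow> ev3 \<phi> \<psi> \<chi> t = ev3 \<phi> \<psi> \<chi> u)" (is "?l \<longleftrightarrow> ?r")
proof
  assume ?r
  let ?d = "t - u" and ?R = "module.span fscale (tensor3_relations U V W)"
  have d: "fst x \<in> vcarrier U \<and> fst (snd x) \<in> vcarrier V \<and> snd (snd x) \<in> vcarrier W"
    if "x \<in> Poly_Mapping.keys ?d" for x
    using keys_diff[of t u] that t u by (cases x) auto
  obtain J r where J: "finite J" "J \<subseteq> vcarrier U" and r: "\<And>b. functional U (\<lambda>v. r v b)"
    and J_sum: "\<And>x. x \<in> Poly_Mapping.keys ?d \<Longrightarrow> fst x = (\<Sum>b\<in>J. vscale U (r (fst x) b) b)"
    using coordinates_exist[OF U finite_keys[of "?d"], of "\<lambda>x. fst x"] d by blast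
  obtain J' r' where J': "finite J'" "J' \<subseteq> vcarrier V" and r': "\<And>b. functional V (\<lambda>v. r' v b)"
    and J'_sum: "\<And>x. x \<in> Poly_Mapping.keys ?d \<Longrightarrow> fst (snd x) = (\<Sum>b\<in>J'. vscale V (r' (fst (snd x)) b) b)"
    using coordinates_exist[OF V finite_keys[of "?d"], of "\<lambda>x. fst (snd x)"] d by blast
  have rel: "pure (a + a', b, c) - pure (a, b, c) - pure (a', b, c) \<in> ?R"
      "pure (vscale U s a, b, c) - fscale s (pure (a, b, c)) \<in> ?R"
      "pure (a, b + b', c) - pure (a, b, c) - pure (a, b', c) \<in> ?R"
      "pure (a, vscale V s b, c) - fscale s (pure (a, b, c)) \<in> ?R"
      "pure (a, b, c + c') - pure (a, b, c) - pure (a, b, c') \<in> ?R"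
      "pure (a, b, vscale W s c) - fscale s (pure (a, b, c)) \<in> ?R"
    if "a \<in> vcarrier U" "a' \<in> vcarrier U" "b \<in> vcarrier V" "b' \<in> vcarrier V"
      "c \<in> vcarrier W" "c' \<in> vcarrier W" for a a' b b' c c' s
    unfolding tensor3_relations_def by - (rule free.span_base, use that in fast)+
  have "?d \<in> ?R"
  proof (rule tensor_normal_form_zero[where J = "J \<times> J'" and q = "\<lambda>i w. pure (fst i, snd i, w)"
      and s = "\<lambda>x. snd (snd x)" and c = "\<lambda>i x. r (fst x) (fst i) * r' (fst (snd x)) (snd i)",
      OF W free.subspace_span])
    fix x assume x: "x \<in> Poly_Mapping.keys ?d"
    obtain a b c where abc: "x = (a, b, c)" by (cases x)
    have m: "a \<in> vcarrier U" "b \<in> vcarrier V" "c \<in> vcarrier W" using d[OF x] abc by auto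
    have 1: "pure (\<Sum>i\<in>J. vscale U (r a i) i, b, c) - (\<Sum>i\<in>J. fscale (r a i) (pure (i, b, c))) \<in> ?R"
      using J m by (intro linear_modulo_sum[where p = "\<lambda>v. pure (v, b, c)", OF U free.subspace_span])
        (auto intro: rel simp del: fscale_single)
    have 2: "pure (i, \<Sum>j\<in>J'. vscale V (r' b j) j, c) - (\<Sum>j\<in>J'. fscale (r' b j) (pure (i, j, c))) \<in> ?R"
      if "i \<in> J" for i
      using J m that J'
      by (intro linear_modulo_sum[where p = "\<lambda>v. pure (i, v, c)", OF V free.subspace_span])
        (auto intro: rel simp del: fscale_single)
    have "(\<Sum>i\<in>J. fscale (r a i) (pure (i, \<Sum>j\<in>J'. vscale V (r' b j) j, c) - (\<Sum>j\<in>J'. fscale (r' b j) (pure (i, j, c))))) \<in> ?R"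
      by (intro free.span_sum free.span_scale 2)
    from free.span_add[OF 1 this]
    show "pure x - (\<Sum>i\<in>J \<times> J'. fscale (r (fst x) (fst i) * r' (fst (snd x)) (snd i))
           (pure (fst i, snd i, snd (snd x)))) \<in> ?R"
      using J_sum[OF x, symmetric] J'_sum[OF x, symmetric]
      by (simp add: abc free.scale_right_diff_distrib sum_subtractf free.scale_sum_right
          sum.cartesian_product case_prod_unfold)
  next
    fix i \<psi> assume "functional W \<psi>"
    then have "ev3 (\<lambda>v. r v (fst i)) (\<lambda>v. r' v (snd i)) \<psi> ?d = 0" using \<open>?r\<close> r r' by simp
    then show "lin_ext (*) (\<lambda>x. r (fst x) (fst i) * r' (fst (snd x)) (snd i) * \<psi> (snd (snd x))) ?d = 0"
      by (simp add: ev3_def case_prod_unfold)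
  qed (use J J' d in \<open>auto intro!: rel simp del: fscale_single\<close>)
  then show ?l by (simp add: tensor3_eq_def)
qed (use tensor3_eq_imp_ev3 in blast)

section \<open>Slices\<close>

text \<open>
  The maps \<open>id \<otimes> \<psi>\<close> and \<open>\<phi> \<otimes> id\<close>, followed by the identification of \<open>V \<otimes> K\<close> with \<open>V\<close> and of \<open>K \<otimes> W\<close> with \<open>W\<close>.
\<close>

definition rslice :: "('k \<Rightarrow> 'v \<Rightarrow> 'v::ab_group_add) \<Rightarrow> ('w \<Rightarrow> 'k) \<Rightarrow> ('v \<times> 'w \<Rightarrow>\<^sub>0 'k::field) \<Rightarrow> 'v" where
  "rslice s \<psi> = lin_ext s (\<lambda>(v, w). s (\<psi> w) v)"

definition lslice :: "('k \<Rightarrow> 'w \<Rightarrow> 'w::ab_group_add) \<Rightarrow> ('v \<Rightarrow> 'k) \<Rightarrow> ('v \<times> 'w \<Rightarrow>\<^sub>0 'k::field) \<Rightarrow> 'w" where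
  "lslice s \<phi> = lin_ext s (\<lambda>(v, w). s (\<phi> v) w)"

lemma rslice_closed:
  "vspace V \<Longrightarrow> Poly_Mapping.keys t \<subseteq> vcarrier V \<times> UNIV \<Longrightarrow> rslice (vscale V) \<psi> t \<in> vcarrier V"
  unfolding rslice_def by (rule lin_ext_closed) (auto intro!: vspace_scale)

lemma lslice_closed:
  "vspace W \<Longrightarrow> Poly_Mapping.keys t \<subseteq> UNIV \<times> vcarrier W \<Longrightarrow> lslice (vscale W) \<phi> t \<in> vcarrier W"
  unfolding lslice_def by (rule lin_ext_closed) (auto intro!: vspace_scale)

lemma functional_rslice:
  assumes "vspace V" "functional V \<phi>" "Poly_Mapping.keys t \<subseteq> vcarrier V \<times> UNIV"
  shows "\<phi> (rslice (vscale V) \<psi> t) = ev \<phi> \<psi> t"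
  unfolding rslice_def using assms(3)
  by (subst linear_map_lin_ext[OF assms(1,2)])
     (auto simp: ev_def vspace_scale[OF assms(1)] functional_scale[OF assms(2)] mult.commute intro!: lin_ext_cong)

lemma functional_lslice:
  assumes "vspace W" "functional W \<psi>" "Poly_Mapping.keys t \<subseteq> UNIV \<times> vcarrier W"
  shows "\<psi> (lslice (vscale W) \<phi> t) = ev \<phi> \<psi> t"
  unfolding lslice_def using assms(3)
  by (subst linear_map_lin_ext[OF assms(1,2)])
     (auto simp: ev_def vspace_scale[OF assms(1)] functional_scale[OF assms(2)] intro!: lin_ext_cong)

lemma rslice_eqI:
  assumes "vspace V" "x \<in> vcarrier V" "Poly_Mapping.keys t \<subseteq> vcarrier V \<times> UNIV"
    and "\<And>\<phi>. functional V \<phi> \<Longrightarrow> ev \<phi> \<psi> t = \<phi> x"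
  shows "rslice (vscale V) \<psi> t = x"
  using assms by (intro functional_eqI[OF assms(1)]) (auto simp: functional_rslice rslice_closed)

lemma lslice_eqI:
  assumes "vspace W" "x \<in> vcarrier W" "Poly_Mapping.keys t \<subseteq> UNIV \<times> vcarrier W"
    and "\<And>\<psi>. functional W \<psi> \<Longrightarrow> ev \<phi> \<psi> t = \<psi> x"
  shows "lslice (vscale W) \<phi> t = x"
  using assms by (intro functional_eqI[OF assms(1)]) (auto simp: functional_lslice lslice_closed)

lemma tensors_keys:
  "t \<in> tensors V W \<Longrightarrow> Poly_Mapping.keys t \<subseteq> vcarrier V \<times> UNIV"
  "t \<in> tensors V W \<Longrightarrow> Poly_Mapping.keys t \<subseteq> UNIV \<times> vcarrier W"
  by (auto simp: tensors_def)

lemma keys_sum_subset: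
  "(\<And>i. i \<in> I \<Longrightarrow> Poly_Mapping.keys (f i) \<subseteq> S) \<Longrightarrow> Poly_Mapping.keys (sum f I) \<subseteq> S"
  by (rule order_trans[OF keys_sum]) blast

lemma keys_sum_pure:
  "finite J \<Longrightarrow> Poly_Mapping.keys (\<Sum>i\<in>J. pure (f i) :: 'x \<Rightarrow>\<^sub>0 'k::field) \<subseteq> f ` J"
  by (rule order_trans[OF keys_sum]) auto

text \<open>
  In an expansion of the second factors in a basis of \<open>W\<close>, the coefficients are the slices with the
  coordinate functionals.
\<close>

lemma rslice_representative:
  fixes V :: "('k::field, 'v::ab_group_add, 'z) vspc_scheme" and W :: "('k, 'w::ab_group_add, 'y) vspc_scheme"
  assumes V: "vspace V" and W: "vspace W" and t: "t \<in> tensors V W"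
    and N: "module.subspace (vscale V) N" "N \<subseteq> vcarrier V"
  shows "(\<exists>t'. Poly_Mapping.keys t' \<subseteq> N \<times> vcarrier W \<and> tensor_eq V W t t') \<longleftrightarrow>
    (\<forall>\<psi>. functional W \<psi> \<longrightarrow> rslice (vscale V) \<psi> t \<in> N)"
proof safe
  fix t' \<psi> assume t': "Poly_Mapping.keys t' \<subseteq> N \<times> vcarrier W" "tensor_eq V W t t'" and \<psi>: "functional W \<psi>"
  have "rslice (vscale V) \<psi> t' \<in> N"
    using rslice_closed[OF vspace_restrict[OF V N(1)], of t' \<psi>] t' by auto
  moreover have "rslice (vscale V) \<psi> t = rslice (vscale V) \<psi> t'"
    by (rule rslice_eqI[OF V])
      (use t' \<psi> t N in \<open>auto simp: tensors_def functional_rslice[OF V] tensor_eq_imp_ev rslice_closed[OF V] subset_iff\<close>)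
  ultimately show "rslice (vscale V) \<psi> t \<in> N" by simp
next
  assume sl: "\<forall>\<psi>. functional W \<psi> \<longrightarrow> rslice (vscale V) \<psi> t \<in> N"
  let ?R = "module.span fscale (tensor_relations V W)"
  have d: "fst x \<in> vcarrier V \<and> snd x \<in> vcarrier W" if "x \<in> Poly_Mapping.keys t" for x
    using t that by (cases x) (auto simp: tensors_def)
  obtain J r where J: "finite J" "J \<subseteq> vcarrier W" and r: "\<And>b. functional W (\<lambda>v. r v b)"
    and J_sum: "\<And>x. x \<in> Poly_Mapping.keys t \<Longrightarrow> snd x = (\<Sum>b\<in>J. vscale W (r (snd x) b) b)"
    using coordinates_exist[OF W finite_keys[of "t"], of "\<lambda>x. snd x"] d by blast
  let ?w = "\<lambda>b. \<Sum>x\<in>Poly_Mapping.keys t. vscale V (Poly_Mapping.lookup t x * r (snd x) b) (fst x)"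
  have "t - (\<Sum>b\<in>J. pure (?w b, b)) \<in> ?R"
  proof (rule tensor_normal_form[OF V free.subspace_span J(1)])
    show "pure x - (\<Sum>b\<in>J. fscale (r (snd x) b) (pure (fst x, b))) \<in> ?R"
      if "x \<in> Poly_Mapping.keys t" for x
      using pure_expand_right[OF W, of "fst x" V J "r (snd x)"] J J_sum[OF that] d[OF that] by (cases x) auto
  qed (use J d in \<open>auto intro!: tensor_relation_left simp del: fscale_single\<close>)
  moreover have "?w b \<in> N" for b
    using sl[rule_format, OF r[of b]] by (simp add: rslice_def lin_ext_def case_prod_unfold vspace_scale_simps[OF V])
  then have "Poly_Mapping.keys (\<Sum>b\<in>J. pure (?w b, b) :: _ \<Rightarrow>\<^sub>0 'k) \<subseteq> N \<times> vcarrier W"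
    using keys_sum_pure[OF J(1), of "\<lambda>b. (?w b, b)"] J by fastforce
  ultimately show "\<exists>t'. Poly_Mapping.keys t' \<subseteq> N \<times> vcarrier W \<and> tensor_eq V W t t'"
    unfolding tensor_eq_def by blast
qed

lemma lslice_representative:
  fixes V :: "('k::field, 'v::ab_group_add, 'z) vspc_scheme" and W :: "('k, 'w::ab_group_add, 'y) vspc_scheme"
  assumes V: "vspace V" and W: "vspace W" and t: "t \<in> tensors V W"
    and sl: "\<forall>\<phi>. functional V \<phi> \<longrightarrow> lslice (vscale W) \<phi> t \<in> N"
  shows "\<exists>t'. Poly_Mapping.keys t' \<subseteq> vcarrier V \<times> N \<and> tensor_eq V W t t'"
proof -
  let ?R = "module.span fscale (tensor_relations V W)"
  have d: "fst x \<in> vcarrier V \<and> snd x \<in> vcarrier W" if "x \<in> Poly_Mapping.keys t" for x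
    using t that by (cases x) (auto simp: tensors_def)
  obtain J r where J: "finite J" "J \<subseteq> vcarrier V" and r: "\<And>b. functional V (\<lambda>v. r v b)"
    and J_sum: "\<And>x. x \<in> Poly_Mapping.keys t \<Longrightarrow> fst x = (\<Sum>b\<in>J. vscale V (r (fst x) b) b)"
    using coordinates_exist[OF V finite_keys[of "t"], of "\<lambda>x. fst x"] d by blast
  let ?w = "\<lambda>b. \<Sum>x\<in>Poly_Mapping.keys t. vscale W (Poly_Mapping.lookup t x * r (fst x) b) (snd x)"
  have "t - (\<Sum>b\<in>J. pure (b, ?w b)) \<in> ?R"
  proof (rule tensor_normal_form[OF W free.subspace_span J(1)])
    show "pure x - (\<Sum>b\<in>J. fscale (r (fst x) b) (pure (b, snd x))) \<in> ?R"
      if "x \<in> Poly_Mapping.keys t" for x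
      using pure_expand_left[OF V, of "snd x" W J "r (fst x)"] J J_sum[OF that] d[OF that] by (cases x) auto
  qed (use J d in \<open>auto intro!: tensor_relation_right simp del: fscale_single\<close>)
  moreover have "?w b \<in> N" for b
    using sl[rule_format, OF r[of b]] by (simp add: lslice_def lin_ext_def case_prod_unfold vspace_scale_simps[OF W])
  then have "Poly_Mapping.keys (\<Sum>b\<in>J. pure (b, ?w b) :: _ \<Rightarrow>\<^sub>0 'k) \<subseteq> vcarrier V \<times> N"
    using keys_sum_pure[OF J(1), of "\<lambda>b. (b, ?w b)"] J by fastforce
  ultimately show ?thesis
    unfolding tensor_eq_def by blast
qed

section \<open>Comodules as modules over functionals\<close>

text \<open>
  Slicing is well defined and linear before any comodule axiom is known, so comodule axioms can be
  verified in terms of slices.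
\<close>

definition precomodule ::
  "('k::field, 'c::ab_group_add) coalg \<Rightarrow> ('k, 'c, 'm::ab_group_add) comod \<Rightarrow> bool" where
  "precomodule C M \<longleftrightarrow> vspace C \<and> vspace M \<and> linear_to_tensor M M C (coact M)"

text \<open>
  \<open>act M\<close> and \<open>lact C\<close> are the actions of the dual algebra of \<open>C\<close> on a right comodule \<open>M\<close> and, from the other
  side, on \<open>C\<close> itself; \<open>conv C\<close> is the convolution product of this algebra.
\<close>

definition act ::
  "('k::field, 'c::ab_group_add, 'm::ab_group_add) comod \<Rightarrow> ('c \<Rightarrow> 'k) \<Rightarrow> 'm \<Rightarrow> 'm" where
  "act M \<psi> m = rslice (vscale M) \<psi> (coact M m)"

definition lact :: "('k::field, 'c::ab_group_add) coalg \<Rightarrow> ('c \<Rightarrow> 'k) \<Rightarrow> 'c \<Rightarrow> 'c" where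
  "lact C \<phi> c = lslice (vscale C) \<phi> (comult C c)"

definition conv :: "('k::field, 'c::ab_group_add) coalg \<Rightarrow> ('c \<Rightarrow> 'k) \<Rightarrow> ('c \<Rightarrow> 'k) \<Rightarrow> 'c \<Rightarrow> 'k" where
  "conv C \<psi> \<chi> c = ev \<psi> \<chi> (comult C c)"

lemma functional_of_linear_to_tensor:
  assumes "linear_to_tensor X V W \<rho>" "functional V \<phi>" "functional W \<psi>"
  shows "functional X (\<lambda>x. ev \<phi> \<psi> (\<rho> x))"
proof (rule functionalI)
  note ev = tensor_eq_imp_ev[OF _ assms(2,3)]
  fix x y r assume x: "x \<in> vcarrier X"
  have "tensor_eq V W (\<rho> (vscale X r x)) (fscale r (\<rho> x))"
    using assms(1) x by (simp add: linear_to_tensor_def)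
  from ev[OF this] show "ev \<phi> \<psi> (\<rho> (vscale X r x)) = r * ev \<phi> \<psi> (\<rho> x)" by simp
  assume y: "y \<in> vcarrier X"
  have "tensor_eq V W (\<rho> (x + y)) (\<rho> x + \<rho> y)"
    using assms(1) x y by (simp add: linear_to_tensor_def)
  from ev[OF this] show "ev \<phi> \<psi> (\<rho> (x + y)) = ev \<phi> \<psi> (\<rho> x) + ev \<phi> \<psi> (\<rho> y)" by simp
qed

text \<open>
  Linearity of a tensor-valued map only has to be checked after application of functionals.
\<close>

lemma linear_to_tensorI:
  assumes X: "vspace X" and V: "vspace V" and W: "vspace W"
    and t: "\<And>x. x \<in> vcarrier X \<Longrightarrow> \<rho> x \<in> tensors V W"
    and ev: "\<And>\<phi> \<psi>. functional V \<phi> \<Longrightarrow> functional W \<psi> \<Longrightarrow> functional X (\<lambda>x. ev \<phi> \<psi> (\<rho> x))"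
  shows "linear_to_tensor X V W \<rho>"
  unfolding linear_to_tensor_def
proof (intro conjI ballI allI t)
  fix x y r assume x: "x \<in> vcarrier X"
  have "fscale r (\<rho> x) \<in> tensors V W"
    using t[OF x] keys_fscale[of r "\<rho> x"] by (auto simp: tensors_def)
  then show "tensor_eq V W (\<rho> (vscale X r x)) (fscale r (\<rho> x))"
    using functional_scale[OF ev x] by (simp add: tensor_eq_iff[OF V W t[OF vspace_scale[OF X x]]])
  assume y: "y \<in> vcarrier X"
  have "\<rho> x + \<rho> y \<in> tensors V W"
    using t[OF x] t[OF y] Poly_Mapping.keys_add[of "\<rho> x" "\<rho> y"] by (auto simp: tensors_def)
  then show "tensor_eq V W (\<rho> (x + y)) (\<rho> x + \<rho> y)"
    using linear_map_add[OF ev x y] by (simp add: tensor_eq_iff[OF V W t[OF vspace_add[OF X x y]]])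
qed

context
  fixes C :: "('k::field, 'c::ab_group_add) coalg" and M :: "('k, 'c, 'm::ab_group_add) comod"
  assumes pre: "precomodule C M"
begin

lemma precomodule_vspace: "vspace M"
  using pre by (simp add: precomodule_def)

lemma coact_tensors: "m \<in> vcarrier M \<Longrightarrow> coact M m \<in> tensors M C"
  using pre by (simp add: precomodule_def linear_to_tensor_def)

lemma functional_act: "functional M \<phi> \<Longrightarrow> m \<in> vcarrier M \<Longrightarrow> \<phi> (act M \<psi> m) = ev \<phi> \<psi> (coact M m)"
  unfolding act_def by (rule functional_rslice[OF precomodule_vspace _ tensors_keys(1)[OF coact_tensors]])

lemma act_closed: "m \<in> vcarrier M \<Longrightarrow> act M \<psi> m \<in> vcarrier M"
  unfolding act_def by (rule rslice_closed[OF precomodule_vspace tensors_keys(1)[OF coact_tensors]])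

lemma functional_coact: "functional M \<phi> \<Longrightarrow> functional C \<psi> \<Longrightarrow> functional M (\<lambda>m. ev \<phi> \<psi> (coact M m))"
  using pre by (intro functional_of_linear_to_tensor[of M M C]) (simp_all add: precomodule_def)

lemma act_eqI:
  assumes "m \<in> vcarrier M" "x \<in> vcarrier M" "\<And>\<phi>. functional M \<phi> \<Longrightarrow> ev \<phi> \<psi> (coact M m) = \<phi> x"
  shows "act M \<psi> m = x"
  using assms by (intro functional_eqI[OF precomodule_vspace]) (auto simp: functional_act act_closed)

lemma linear_map_act: "functional C \<psi> \<Longrightarrow> linear_map M M (act M \<psi>)"
proof (rule linear_mapI)
  note V = precomodule_vspace
  fix x y r assume \<psi>: "functional C \<psi>" and x: "x \<in> vcarrier M"
  show "act M \<psi> (vscale M r x) = vscale M r (act M \<psi> x)"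
    using x \<psi> by (intro act_eqI)
      (auto simp: vspace_closed[OF V] act_closed functional_scale functional_act functional_scale[OF functional_coact])
  assume y: "y \<in> vcarrier M"
  show "act M \<psi> (x + y) = act M \<psi> x + act M \<psi> y"
    using x y \<psi> by (intro act_eqI)
      (auto simp: vspace_closed[OF V] act_closed linear_map_add functional_act linear_map_add[OF functional_coact])
qed (rule act_closed)

lemma act_add: "m \<in> vcarrier M \<Longrightarrow> act M (\<lambda>c. \<psi> c + \<chi> c) m = act M \<psi> m + act M \<chi> m"
  by (rule act_eqI) (auto simp: vspace_closed[OF precomodule_vspace] act_closed ev_add_right linear_map_add functional_act)

lemma act_scale: "m \<in> vcarrier M \<Longrightarrow> act M (\<lambda>c. r * \<psi> c) m = vscale M r (act M \<psi> m)"
  by (rule act_eqI) (auto simp: vspace_closed[OF precomodule_vspace] act_closed ev_scale_right functional_scale functional_act)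

lemma subcomodule_iff:
  "subcomodule C M N \<longleftrightarrow> module.subspace (vscale M) N \<and> N \<subseteq> vcarrier M \<and>
    (\<forall>\<psi>. functional C \<psi> \<longrightarrow> (\<forall>n\<in>N. act M \<psi> n \<in> N))"
proof -
  have "(\<exists>t. Poly_Mapping.keys t \<subseteq> N \<times> vcarrier C \<and> tensor_eq M C (coact M n) t) \<longleftrightarrow>
      (\<forall>\<psi>. functional C \<psi> \<longrightarrow> act M \<psi> n \<in> N)"
    if "module.subspace (vscale M) N" "N \<subseteq> vcarrier M" "n \<in> N" for n
    unfolding act_def using that pre
    by (intro rslice_representative coact_tensors) (auto simp: precomodule_def)
  then show ?thesis unfolding subcomodule_def by blast
qed

lemma comod_hom_iff:
  fixes N :: "('k, 'c, 'n::ab_group_add) comod"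
  assumes N: "vspace N" "\<And>n. n \<in> vcarrier N \<Longrightarrow> coact N n \<in> tensors N C"
  shows "comod_hom C M N f \<longleftrightarrow> linear_map M N f \<and>
    (\<forall>\<psi>. functional C \<psi> \<longrightarrow> (\<forall>m\<in>vcarrier M. act N \<psi> (f m) = f (act M \<psi> m)))"
proof -
  have "tensor_eq N C (coact N (f m)) (tmap f id (coact M m)) \<longleftrightarrow>
      (\<forall>\<psi>. functional C \<psi> \<longrightarrow> act N \<psi> (f m) = f (act M \<psi> m))"
    if f: "linear_map M N f" and m: "m \<in> vcarrier M" for m
  proof -
    have keys: "tmap f id (coact M m) \<in> tensors N C"
    proof -
      have "Poly_Mapping.keys (tmap f id (coact M m)) \<subseteq> (\<lambda>x. (f (fst x), snd x)) ` Poly_Mapping.keys (coact M m)"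
        unfolding tmap_def lin_ext_def
        by (rule order_trans[OF keys_sum]) (auto simp: image_iff case_prod_unfold split: if_splits)
      then show ?thesis using coact_tensors[OF m] linear_map_closed[OF f] by (fastforce simp: tensors_def)
    qed
    have fm: "f m \<in> vcarrier N" using linear_map_closed[OF f m] .
    have key: "\<phi> (f (act M \<psi> m)) = ev \<phi> \<psi> (tmap f id (coact M m))" if "functional N \<phi>" for \<phi> \<psi>
      using functional_act[OF linear_map_comp[OF f that] m] by (simp add: ev_tmap)
    have key2: "\<phi> (act N \<psi> (f m)) = ev \<phi> \<psi> (coact N (f m))" if "functional N \<phi>" for \<phi> \<psi>
      unfolding act_def by (rule functional_rslice[OF N(1) that tensors_keys(1)[OF N(2)[OF fm]]])
    have cl: "act N \<psi> (f m) \<in> vcarrier N" for \<psi>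
      unfolding act_def by (rule rslice_closed[OF N(1) tensors_keys(1)[OF N(2)[OF fm]]])
    have "vspace C" using pre by (simp add: precomodule_def)
    then show ?thesis
      unfolding tensor_eq_iff[OF N(1) \<open>vspace C\<close> N(2)[OF fm] keys]
      using key key2 functional_eqI[OF N(1) _ cl linear_map_closed[OF f act_closed[OF m]]]
      by auto
  qed
  then show ?thesis unfolding comod_hom_def by blast
qed

end

lemma coalgebra_vspace: "coalgebra C \<Longrightarrow> vspace C"
  by (simp add: coalgebra_def)

lemma functional_counit: "coalgebra C \<Longrightarrow> functional C (counit C)"
  by (rule functionalI) (simp_all add: coalgebra_def)

lemma comult_tensors: "coalgebra C \<Longrightarrow> c \<in> vcarrier C \<Longrightarrow> comult C c \<in> tensors C C"
  by (simp add: coalgebra_def linear_to_tensor_def)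

lemma functional_conv:
  "coalgebra C \<Longrightarrow> functional C \<psi> \<Longrightarrow> functional C \<chi> \<Longrightarrow> functional C (conv C \<psi> \<chi>)"
  unfolding conv_def by (rule functional_of_linear_to_tensor[of C C C]) (simp_all add: coalgebra_def)

lemma keys_lin_ext: "Poly_Mapping.keys (lin_ext fscale h t) \<subseteq> (\<Union>x\<in>Poly_Mapping.keys t. Poly_Mapping.keys (h x))"
  unfolding lin_ext_def by (rule order_trans[OF keys_sum]) (use keys_fscale in fast)

lemma keys_tmap: "Poly_Mapping.keys (tmap f g t) \<subseteq> (\<lambda>(x, y). (f x, g y)) ` Poly_Mapping.keys t"
  unfolding tmap_def by (rule order_trans[OF keys_lin_ext]) (auto split: if_splits)

lemma keys_expand_left:
  assumes "Poly_Mapping.keys t \<subseteq> V \<times> W" "\<And>v. v \<in> V \<Longrightarrow> Poly_Mapping.keys (\<rho> v) \<subseteq> A \<times> B"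
  shows "Poly_Mapping.keys (expand_left \<rho> t) \<subseteq> A \<times> B \<times> W"
  unfolding expand_left_def
proof (rule order_trans[OF keys_lin_ext], rule UN_least)
  fix x assume x: "x \<in> Poly_Mapping.keys t"
  obtain v w where vw: "x = (v, w)" by (cases x)
  have "Poly_Mapping.keys (lin_ext fscale (\<lambda>(a, b). pure (a, b, w) ) (\<rho> v)) \<subseteq> A \<times> B \<times> W"
    by (rule order_trans[OF keys_lin_ext]) (use x assms in \<open>fastforce simp: vw split: if_splits\<close>)
  then show "Poly_Mapping.keys (case x of (v, w) \<Rightarrow> lin_ext fscale (\<lambda>(a, b). pure (a, b, w)) (\<rho> v)) \<subseteq> A \<times> B \<times> W"
    by (simp add: vw)
qed

lemma keys_expand_right:
  assumes "Poly_Mapping.keys t \<subseteq> V \<times> W" "\<And>w. w \<in> W \<Longrightarrow> Poly_Mapping.keys (\<rho> w) \<subseteq> A \<times> B"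
  shows "Poly_Mapping.keys (expand_right \<rho> t) \<subseteq> V \<times> A \<times> B"
  unfolding expand_right_def
proof (rule order_trans[OF keys_lin_ext], rule UN_least)
  fix x assume x: "x \<in> Poly_Mapping.keys t"
  obtain v w where vw: "x = (v, w)" by (cases x)
  have "Poly_Mapping.keys (lin_ext fscale (\<lambda>(a, b). pure (v, a, b) ) (\<rho> w)) \<subseteq> V \<times> A \<times> B"
    by (rule order_trans[OF keys_lin_ext]) (use x assms in \<open>fastforce simp: vw split: if_splits\<close>)
  then show "Poly_Mapping.keys (case x of (v, w) \<Rightarrow> lin_ext fscale (\<lambda>(a, b). pure (v, a, b)) (\<rho> w)) \<subseteq> V \<times> A \<times> B"
    by (simp add: vw)
qed

text \<open>
  Paired with functionals on the three factors, coassociativity says that the action is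
  associative for the convolution product.
\<close>

lemma right_comodule_iff:
  assumes C: "coalgebra C"
  shows "right_comodule C M \<longleftrightarrow> precomodule C M \<and>
    (\<forall>\<psi> \<chi>. functional C \<psi> \<longrightarrow> functional C \<chi> \<longrightarrow>
      (\<forall>m\<in>vcarrier M. act M \<psi> (act M \<chi> m) = act M (conv C \<psi> \<chi>) m)) \<and>
    (\<forall>m\<in>vcarrier M. act M (counit C) m = m)"
proof -
  note vC = coalgebra_vspace[OF C]
  have "tensor3_eq M C C (expand_left (coact M) (coact M m)) (expand_right (comult C) (coact M m)) \<longleftrightarrow>
    (\<forall>\<psi> \<chi>. functional C \<psi> \<longrightarrow> functional C \<chi> \<longrightarrow> act M \<psi> (act M \<chi> m) = act M (conv C \<psi> \<chi>) m)"
    if M: "precomodule C M" and m: "m \<in> vcarrier M" for m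
  proof -
    note vM = precomodule_vspace[OF M]
    have km: "Poly_Mapping.keys (coact M n) \<subseteq> vcarrier M \<times> vcarrier C" if "n \<in> vcarrier M" for n
      using coact_tensors[OF M that] by (simp add: tensors_def)
    have kc: "Poly_Mapping.keys (comult C n) \<subseteq> vcarrier C \<times> vcarrier C" if "n \<in> vcarrier C" for n
      using comult_tensors[OF C that] by (simp add: tensors_def)
    have l: "ev3 \<phi> \<psi> \<chi> (expand_left (coact M) (coact M m)) = \<phi> (act M \<psi> (act M \<chi> m))"
      if "functional M \<phi>" "functional C \<psi>" for \<phi> \<psi> \<chi>
      using functional_act[OF M functional_coact[OF M that], OF m, of \<chi>]
        functional_act[OF M that(1) act_closed[OF M m]]
      by (simp add: ev3_expand_left)
    have r: "ev3 \<phi> \<psi> \<chi> (expand_right (comult C) (coact M m)) = \<phi> (act M (conv C \<psi> \<chi>) m)"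
      if "functional M \<phi>" for \<phi> \<psi> \<chi>
      by (simp add: functional_act[OF M that m] ev3_expand_right conv_def[abs_def])
    have k: "Poly_Mapping.keys (expand_left (coact M) (coact M m)) \<subseteq> vcarrier M \<times> vcarrier C \<times> vcarrier C"
      "Poly_Mapping.keys (expand_right (comult C) (coact M m)) \<subseteq> vcarrier M \<times> vcarrier C \<times> vcarrier C"
      by (rule keys_expand_left[OF km[OF m]] keys_expand_right[OF km[OF m]], simp add: km kc)+
    show ?thesis
      unfolding tensor3_eq_iff[OF vM vC vC k]
      using l r functional_eqI[OF vM _ act_closed[OF M act_closed[OF M m]] act_closed[OF M m]]
      by auto
  qed
  moreover have "lin_ext (vscale M) (\<lambda>(n, c). vscale M (counit C c) n) (coact M m) = act M (counit C) m" for m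
    by (simp add: act_def rslice_def)
  ultimately show ?thesis
    using vC unfolding right_comodule_def precomodule_def by auto
qed

lemma right_comodule_precomodule: "coalgebra C \<Longrightarrow> right_comodule C M \<Longrightarrow> precomodule C M"
  by (simp add: right_comodule_iff)

lemma act_act:
  assumes "coalgebra C" "right_comodule C M" "functional C \<psi>" "functional C \<chi>" "m \<in> vcarrier M"
  shows "act M \<psi> (act M \<chi> m) = act M (conv C \<psi> \<chi>) m"
  using assms by (simp add: right_comodule_iff)

lemma act_counit: "coalgebra C \<Longrightarrow> right_comodule C M \<Longrightarrow> m \<in> vcarrier M \<Longrightarrow> act M (counit C) m = m"
  by (simp add: right_comodule_iff)

lemma regular_comod_simps [simp]:
  "vcarrier (regular_comod C) = vcarrier C" "vscale (regular_comod C) = vscale C"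
  "coact (regular_comod C) = comult C"
  by (simp_all add: regular_comod_def)

lemma functional_regular [simp]: "functional (regular_comod C) \<phi> \<longleftrightarrow> functional C \<phi>"
  by (simp add: linear_map_def)

lemma right_comodule_regular:
  assumes C: "coalgebra C"
  shows "right_comodule C (regular_comod C)"
proof -
  have 1: "vspace (regular_comod C)" using coalgebra_vspace[OF C] by (simp add: vspace_def)
  have 2: "tensor_relations (regular_comod C) C = tensor_relations C C"
    "tensor3_relations (regular_comod C) C C = tensor3_relations C C C"
    by (simp_all add: tensor_relations_def tensor3_relations_def)
  show ?thesis
    using C 1 unfolding coalgebra_def right_comodule_def linear_to_tensor_def tensor_eq_def tensor3_eq_def 2
    by (simp add: tensors_def)
qed

lemma precomodule_regular: "coalgebra C \<Longrightarrow> precomodule C (regular_comod C)"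
  by (simp add: right_comodule_precomodule right_comodule_regular)

context
  fixes C :: "('k::field, 'c::ab_group_add) coalg"
  assumes C: "coalgebra C"
begin

lemma functional_lact: "functional C \<psi> \<Longrightarrow> c \<in> vcarrier C \<Longrightarrow> \<psi> (lact C \<phi> c) = ev \<phi> \<psi> (comult C c)"
  unfolding lact_def
  by (rule functional_lslice[OF coalgebra_vspace[OF C] _ tensors_keys(2)[OF comult_tensors[OF C]]])

lemma lact_closed: "c \<in> vcarrier C \<Longrightarrow> lact C \<phi> c \<in> vcarrier C"
  unfolding lact_def by (rule lslice_closed[OF coalgebra_vspace[OF C] tensors_keys(2)[OF comult_tensors[OF C]]])

lemma lact_eqI:
  assumes "c \<in> vcarrier C" "x \<in> vcarrier C" "\<And>\<psi>. functional C \<psi> \<Longrightarrow> ev \<phi> \<psi> (comult C c) = \<psi> x"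
  shows "lact C \<phi> c = x"
  using assms by (intro functional_eqI[OF coalgebra_vspace[OF C]]) (auto simp: functional_lact lact_closed)

lemma linear_map_lact: "functional C \<phi> \<Longrightarrow> linear_map C C (lact C \<phi>)"
proof (rule linear_mapI)
  note V = coalgebra_vspace[OF C]
  fix x y r assume \<phi>: "functional C \<phi>" and x: "x \<in> vcarrier C"
  have F: "functional C (\<lambda>c. ev \<phi> \<psi> (comult C c))" if "functional C \<psi>" for \<psi>
    using functional_conv[OF C \<phi> that] by (simp add: conv_def[abs_def])
  show "lact C \<phi> (vscale C r x) = vscale C r (lact C \<phi> x)"
    using x by (intro lact_eqI)
      (auto simp: vspace_closed[OF V] lact_closed functional_scale functional_lact functional_scale[OF F])
  assume y: "y \<in> vcarrier C"
  show "lact C \<phi> (x + y) = lact C \<phi> x + lact C \<phi> y"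
    using x y by (intro lact_eqI)
      (auto simp: vspace_closed[OF V] lact_closed linear_map_add functional_lact linear_map_add[OF F])
qed (rule lact_closed)

lemma functional_act_regular:
  "functional C \<phi> \<Longrightarrow> c \<in> vcarrier C \<Longrightarrow> \<phi> (act (regular_comod C) \<psi> c) = ev \<phi> \<psi> (comult C c)"
  using functional_act[OF precomodule_regular[OF C], of \<phi> c \<psi>] by simp

lemma coassoc_ev:
  assumes "functional C \<phi>" "functional C \<psi>" "functional C \<chi>" "c \<in> vcarrier C"
  shows "ev (conv C \<phi> \<psi>) \<chi> (comult C c) = ev \<phi> (conv C \<psi> \<chi>) (comult C c)"
proof -
  have "tensor3_eq C C C (expand_left (comult C) (comult C c)) (expand_right (comult C) (comult C c))"
    using C assms by (simp add: coalgebra_def)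
  from tensor3_eq_imp_ev3[OF this assms(1-3)] show ?thesis
    by (simp add: ev3_expand_left ev3_expand_right conv_def[abs_def])
qed

lemma lact_lact:
  assumes "functional C \<phi>" "functional C \<phi>'" "c \<in> vcarrier C"
  shows "lact C \<phi>' (lact C \<phi> c) = lact C (conv C \<phi> \<phi>') c"
proof (rule lact_eqI)
  fix \<psi> assume \<psi>: "functional C \<psi>"
  have "ev \<phi>' \<psi> (comult C (lact C \<phi> c)) = ev \<phi> (conv C \<phi>' \<psi>) (comult C c)"
    using functional_lact[OF functional_conv[OF C assms(2) \<psi>] assms(3), of \<phi>] by (simp add: conv_def)
  also have "\<dots> = ev (conv C \<phi> \<phi>') \<psi> (comult C c)" using assms \<psi> by (simp add: coassoc_ev)
  also have "\<dots> = \<psi> (lact C (conv C \<phi> \<phi>') c)" using assms \<psi> by (simp add: functional_lact)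
  finally show "ev \<phi>' \<psi> (comult C (lact C \<phi> c)) = \<psi> (lact C (conv C \<phi> \<phi>') c)" .
qed (use assms in \<open>auto intro: lact_closed\<close>)

lemma act_lact:
  assumes "functional C \<phi>" "functional C \<psi>" "c \<in> vcarrier C"
  shows "act (regular_comod C) \<psi> (lact C \<phi> c) = lact C \<phi> (act (regular_comod C) \<psi> c)"
proof (rule functional_eqI[OF coalgebra_vspace[OF C]])
  note cl = act_closed[OF precomodule_regular[OF C], simplified] lact_closed
  show "act (regular_comod C) \<psi> (lact C \<phi> c) \<in> vcarrier C"
    "lact C \<phi> (act (regular_comod C) \<psi> c) \<in> vcarrier C" using assms by (auto intro: cl)
  fix \<chi> assume \<chi>: "functional C \<chi>"
  have "\<chi> (act (regular_comod C) \<psi> (lact C \<phi> c)) = conv C \<chi> \<psi> (lact C \<phi> c)"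
    using assms \<chi> by (simp add: functional_act_regular cl conv_def)
  also have "\<dots> = ev \<phi> (conv C \<chi> \<psi>) (comult C c)"
    using assms \<chi> by (simp add: functional_lact functional_conv[OF C])
  also have "\<dots> = ev (conv C \<phi> \<chi>) \<psi> (comult C c)" using assms \<chi> by (simp add: coassoc_ev)
  also have "\<dots> = conv C \<phi> \<chi> (act (regular_comod C) \<psi> c)"
    using assms \<chi> by (simp add: functional_act_regular functional_conv[OF C])
  also have "\<dots> = \<chi> (lact C \<phi> (act (regular_comod C) \<psi> c))"
    using assms \<chi> by (simp add: functional_lact cl conv_def)
  finally show "\<chi> (act (regular_comod C) \<psi> (lact C \<phi> c)) = \<chi> (lact C \<phi> (act (regular_comod C) \<psi> c))" .
qed

lemma lact_counit: "c \<in> vcarrier C \<Longrightarrow> lact C (counit C) c = c"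
  using C by (simp add: lact_def lslice_def coalgebra_def)

lemma act_counit_regular: "c \<in> vcarrier C \<Longrightarrow> act (regular_comod C) (counit C) c = c"
  using act_counit[OF C right_comodule_regular[OF C]] by simp

text \<open>
  If the right slices of a tensor lie in \<open>E\<close>, it comes from \<open>E \<otimes> C\<close>; the left slices of this new tensor
  then bring it into \<open>E \<otimes> E\<close>.
\<close>

lemma subcoalgebra_iff:
  "subcoalgebra C E \<longleftrightarrow> module.subspace (vscale C) E \<and> E \<subseteq> vcarrier C \<and>
    (\<forall>\<psi>. functional C \<psi> \<longrightarrow> (\<forall>e\<in>E. act (regular_comod C) \<psi> e \<in> E \<and> lact C \<psi> e \<in> E))" (is "?l \<longleftrightarrow> ?r")
proof
  note V = coalgebra_vspace[OF C]
  assume ?l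
  then have E: "module.subspace (vscale C) E" "E \<subseteq> vcarrier C" by (auto simp: subcoalgebra_def)
  note VE = vspace_restrict[OF V E(1)]
  show ?r
  proof (intro conjI E allI impI ballI)
    fix \<psi> e assume \<psi>: "functional C \<psi>" and e: "e \<in> E"
    obtain t where t: "Poly_Mapping.keys t \<subseteq> E \<times> E" "tensor_eq C C (comult C e) t"
      using \<open>?l\<close> e by (auto simp: subcoalgebra_def)
    have eC: "e \<in> vcarrier C" using e E by blast
    have 1: "rslice (vscale C) \<psi> t \<in> E" "lslice (vscale C) \<psi> t \<in> E"
      using rslice_closed[OF VE, of t \<psi>] lslice_closed[OF VE, of t \<psi>] t by auto
    have k: "Poly_Mapping.keys t \<subseteq> vcarrier C \<times> UNIV" "Poly_Mapping.keys t \<subseteq> UNIV \<times> vcarrier C"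
      using t E by auto
    have "rslice (vscale C) \<psi> t = act (regular_comod C) \<psi> e"
      by (rule rslice_eqI[OF V _ k(1)])
        (use \<psi> eC t in \<open>auto simp: act_closed[OF precomodule_regular[OF C], simplified] functional_act_regular tensor_eq_imp_ev\<close>)
    moreover have "lslice (vscale C) \<psi> t = lact C \<psi> e"
      by (rule lslice_eqI[OF V _ k(2)])
        (use \<psi> eC t in \<open>auto simp: lact_closed functional_lact tensor_eq_imp_ev\<close>)
    ultimately show "act (regular_comod C) \<psi> e \<in> E" "lact C \<psi> e \<in> E" using 1 by auto
  qed
next
  note V = coalgebra_vspace[OF C]
  assume ?r
  then have E: "module.subspace (vscale C) E" "E \<subseteq> vcarrier C"
    and st: "\<And>\<psi> e. functional C \<psi> \<Longrightarrow> e \<in> E \<Longrightarrow> act (regular_comod C) \<psi> e \<in> E"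
      "\<And>\<psi> e. functional C \<psi> \<Longrightarrow> e \<in> E \<Longrightarrow> lact C \<psi> e \<in> E" by auto
  let ?E = "C\<lparr>vcarrier := E\<rparr>"
  note VE = vspace_restrict[OF V E(1)]
  have "\<exists>t. Poly_Mapping.keys t \<subseteq> E \<times> E \<and> tensor_eq C C (comult C e) t" if e: "e \<in> E" for e
  proof -
    have eC: "e \<in> vcarrier C" using e E by blast
    have "\<forall>\<psi>. functional C \<psi> \<longrightarrow> rslice (vscale C) \<psi> (comult C e) \<in> E"
      using st(1)[OF _ e] by (simp add: act_def)
    then obtain t where t: "Poly_Mapping.keys t \<subseteq> E \<times> vcarrier C" "tensor_eq C C (comult C e) t"
      using rslice_representative[OF V V comult_tensors[OF C eC] E] by blast
    have te: "t \<in> tensors ?E C" using t by (simp add: tensors_def)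
    \<comment> \<open>Functionals on \<open>E\<close> extend to \<open>C\<close>, so the left slices of \<open>t\<close> are those of the comultiplication.\<close>
    have "\<forall>\<phi>. functional ?E \<phi> \<longrightarrow> lslice (vscale C) \<phi> t \<in> E"
    proof (intro allI impI)
      fix \<phi> assume \<phi>: "functional ?E \<phi>"
      obtain \<phi>' where \<phi>': "functional (?E\<lparr>vcarrier := UNIV\<rparr>) \<phi>'" "\<forall>x\<in>E. \<phi>' x = \<phi> x"
        using functional_extend[OF VE \<phi>] by auto
      have f: "functional C \<phi>'" by (rule functional_mono[OF \<phi>'(1)]) auto
      have "lslice (vscale C) \<phi> t = lact C \<phi>' e"
      proof (rule lslice_eqI[OF V])
        show "lact C \<phi>' e \<in> vcarrier C" by (rule lact_closed[OF eC])
        show "Poly_Mapping.keys t \<subseteq> UNIV \<times> vcarrier C" using t by auto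
        fix \<psi> assume \<psi>: "functional C \<psi>"
        have "ev \<phi> \<psi> t = ev \<phi>' \<psi> t" by (rule ev_cong) (use t \<phi>' in auto)
        then show "ev \<phi> \<psi> t = \<psi> (lact C \<phi>' e)"
          using tensor_eq_imp_ev[OF t(2) f \<psi>] by (simp add: functional_lact \<psi> eC)
      qed
      then show "lslice (vscale C) \<phi> t \<in> E" using st(2)[OF f e] by simp
    qed
    then obtain t' where t': "Poly_Mapping.keys t' \<subseteq> E \<times> E" "tensor_eq ?E C t t'"
      using lslice_representative[OF VE V te, of E] by fastforce
    have "t' \<in> tensors C C" using t' E by (auto simp: tensors_def)
    moreover have "ev \<phi> \<psi> (comult C e) = ev \<phi> \<psi> t'" if "functional C \<phi>" "functional C \<psi>" for \<phi> \<psi>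
    proof -
      have "functional ?E \<phi>" by (rule functional_mono[OF that(1)]) (use E in auto)
      then show ?thesis using tensor_eq_imp_ev[OF t(2) that] tensor_eq_imp_ev[OF t'(2) _ that(2)] by simp
    qed
    ultimately have "tensor_eq C C (comult C e) t'"
      by (simp add: tensor_eq_iff[OF V V comult_tensors[OF C eC]])
    then show ?thesis using t'(1) by blast
  qed
  then show ?l unfolding subcoalgebra_def using E by blast
qed

end

section \<open>Finite dimension\<close>

text \<open>
  The ambient space may have infinite dimension, so that \<open>dim\<close> is meaningful only for subsets of the
  span of a finite set.
\<close>

definition fin_spanned :: "('k::field, 'v::ab_group_add, 'z) vspc_scheme \<Rightarrow> 'v set \<Rightarrow> bool" where
  "fin_spanned V S \<longleftrightarrow> (\<exists>B. finite B \<and> S \<subseteq> module.span (vscale V) B)"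

lemma fin_spanned_mono: "fin_spanned V T \<Longrightarrow> S \<subseteq> T \<Longrightarrow> fin_spanned V S"
  unfolding fin_spanned_def by blast

lemma fin_dim_iff: "vspace V \<Longrightarrow> fin_dim V \<longleftrightarrow> fin_spanned V (vcarrier V)"
proof
  assume V: "vspace V" and "fin_spanned V (vcarrier V)"
  interpret vector_space "vscale V" by (rule vspace_vector_space[OF V])
  obtain T where T: "finite T" "vcarrier V \<subseteq> span T"
    using \<open>fin_spanned V (vcarrier V)\<close> by (auto simp: fin_spanned_def)
  obtain B where B: "B \<subseteq> vcarrier V" "independent B" "vcarrier V \<subseteq> span B"
    using maximal_independent_subset by blast
  have "finite B" using independent_span_bound[OF T(1) B(2)] B T by auto
  moreover have "span B = vcarrier V"
    using span_minimal[OF B(1) vspace_subspace[OF V]] B(3) by blast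
  ultimately show "fin_dim V" by (auto simp: fin_dim_def)
qed (auto simp: fin_dim_def fin_spanned_def)

lemma dim_strict_mono:
  assumes V: "vspace V" and T: "fin_spanned V T" and S: "module.subspace (vscale V) S" "S \<subset> T"
  shows "vector_space.dim (vscale V) S < vector_space.dim (vscale V) T"
proof -
  interpret vector_space "vscale V" by (rule vspace_vector_space[OF V])
  obtain B where B: "finite B" "T \<subseteq> span B" using T by (auto simp: fin_spanned_def)
  obtain A where A: "A \<subseteq> S" "independent A" "S \<subseteq> span A" "card A = dim S" by (rule basis_exists)
  have "A \<subseteq> T" using A S by blast
  then obtain A' where A': "A \<subseteq> A'" "A' \<subseteq> T" "independent A'" "T \<subseteq> span A'"
    using A(2) by (rule maximal_independent_subset_extend)
  have "finite A'" using independent_span_bound[OF B(1) A'(3)] A'(2) B(2) by auto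
  moreover have "A \<noteq> A'" using A'(4) span_minimal[OF A(1) S(1)] S(2) by blast
  ultimately have "card A < card A'" using A'(1) by (simp add: psubset_card_mono psubset_eq)
  then show ?thesis using basis_card_eq_dim[OF A'(2,4,3)] A(4) by simp
qed

lemma dim_bounded:
  assumes "vspace V" "fin_spanned V T"
  obtains d where "\<And>S. S \<subseteq> T \<Longrightarrow> vector_space.dim (vscale V) S \<le> d"
proof -
  interpret vector_space "vscale V" by (rule vspace_vector_space[OF assms(1)])
  obtain B where B: "finite B" "T \<subseteq> span B" using assms(2) by (auto simp: fin_spanned_def)
  show thesis by (rule that[of "card B"]) (use B in \<open>auto intro: dim_le_card\<close>)
qed

lemma ascending_subspaces_stabilize:
  fixes S :: "nat \<Rightarrow> 'v::ab_group_add set"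
  assumes V: "vspace V" and T: "fin_spanned V T"
    and S: "\<And>i. module.subspace (vscale V) (S i)" "\<And>i. S i \<subseteq> T" "\<And>i j. i \<le> j \<Longrightarrow> S i \<subseteq> S j"
  obtains i where "\<And>j. i \<le> j \<Longrightarrow> S j = S i"
proof -
  let ?d = "\<lambda>i. vector_space.dim (vscale V) (S i)"
  obtain d where d: "\<And>i. ?d i \<le> d" using dim_bounded[OF V T] S(2) by metis
  then obtain i where i: "\<And>j. ?d j \<le> ?d i"
    using ex_has_greatest_nat[of "\<lambda>_. True" 0 ?d "Suc d"] by (auto simp: less_Suc_eq_le)
  have "S j = S i" if "i \<le> j" for j
    using dim_strict_mono[OF V fin_spanned_mono[OF T S(2)] S(1), of i j] S(3)[OF that] i[of j] by force
  then show thesis using that by blast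
qed

lemma descending_subspaces_stabilize:
  fixes S :: "nat \<Rightarrow> 'v::ab_group_add set"
  assumes V: "vspace V" and T: "fin_spanned V T"
    and S: "\<And>i. module.subspace (vscale V) (S i)" "\<And>i. S i \<subseteq> T" "\<And>i j. i \<le> j \<Longrightarrow> S j \<subseteq> S i"
  obtains i where "\<And>j. i \<le> j \<Longrightarrow> S j = S i"
proof -
  let ?d = "\<lambda>i. vector_space.dim (vscale V) (S i)"
  obtain i where i: "\<And>j. ?d i \<le> ?d j"
    using ex_has_least_nat[of "\<lambda>_. True" 0 ?d] by auto
  have "S j = S i" if "i \<le> j" for j
    using dim_strict_mono[OF V fin_spanned_mono[OF T S(2)] S(1), of j i] S(3)[OF that] i[of j] by force
  then show thesis using that by blast
qed

lemma fin_spanned_coordinates: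
  assumes V: "vspace V" and fin: "fin_dim V"
  obtains J r where "finite J" "J \<subseteq> vcarrier V" "\<And>b. functional V (\<lambda>v. r v b)"
    "\<And>v. v \<in> vcarrier V \<Longrightarrow> v = (\<Sum>b\<in>J. vscale V (r v b) b)"
proof -
  interpret vector_space "vscale V" by (rule vspace_vector_space[OF V])
  obtain T where T: "finite T" "span T = vcarrier V" using fin by (auto simp: fin_dim_def)
  have TV: "T \<subseteq> vcarrier V" using T(2) span_superset by blast
  obtain J r where J: "finite J" "J \<subseteq> vcarrier V" and r: "\<And>b. functional V (\<lambda>v. r v b)"
    and sum: "\<And>v. v \<in> T \<Longrightarrow> v = (\<Sum>b\<in>J. vscale V (r v b) b)"
    using coordinates_exist[OF V T(1), of "\<lambda>v. v"] TV by blast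
  have repr: "(\<Sum>b\<in>J. vscale V (r v b) b) = v \<and> v \<in> vcarrier V" if "v \<in> span T" for v
    using that
  proof (induction rule: span_induct_alt)
    case base
    show ?case using linear_map_zero[OF V r] by (simp add: vspace_zero[OF V])
  next
    case (step c x y)
    then have x: "x \<in> vcarrier V" "(\<Sum>b\<in>J. vscale V (r x b) b) = x" using TV sum[of x] by auto
    have "(\<Sum>b\<in>J. vscale V (r (vscale V c x + y) b) b)
        = vscale V c (\<Sum>b\<in>J. vscale V (r x b) b) + (\<Sum>b\<in>J. vscale V (r y b) b)"
      using x(1) step by (simp add: linear_map_add[OF r] functional_scale[OF r] vspace_closed[OF V]
          scale_left_distrib sum.distrib scale_sum_right)
    then show ?case using x step by (simp add: vspace_closed[OF V])
  qed
  show thesis by (rule that[OF J, of r]) (use r repr T(2) in auto)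
qed

lemma fin_spanned_image:
  assumes V: "vspace V" and f: "linear_map V W f" and W: "vspace W" and fin: "fin_dim V"
  shows "fin_spanned W (f ` vcarrier V)"
proof -
  interpret vector_space "vscale W" by (rule vspace_vector_space[OF W])
  obtain J r where J: "finite J" "J \<subseteq> vcarrier V" and r: "\<And>b. functional V (\<lambda>v. r v b)"
    and sum: "\<And>v. v \<in> vcarrier V \<Longrightarrow> v = (\<Sum>b\<in>J. vscale V (r v b) b)"
    using fin_spanned_coordinates[OF V fin] by blast
  have "f v \<in> span (f ` J)" if v: "v \<in> vcarrier V" for v
  proof -
    have "f v = (\<Sum>b\<in>J. vscale W (r v b) (f b))"
      by (subst sum[OF v], subst linear_map_sum[OF V f])
        (use J in \<open>auto simp: linear_map_scale[OF f] vspace_scale[OF V] subset_iff intro!: sum.cong\<close>)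
    also have "\<dots> \<in> span (f ` J)" by (intro span_sum span_scale span_base imageI)
    finally show ?thesis .
  qed
  then show ?thesis using J(1) by (auto simp: fin_spanned_def intro!: exI[of _ "f ` J"])
qed

lemma subspace_preimage:
  assumes "vspace V" "linear_map V W f" "vspace W" "module.subspace (vscale W) U"
  shows "module.subspace (vscale V) {x \<in> vcarrier V. f x \<in> U}"
  using assms(2,4) unfolding subspace_iff[OF assms(1)] subspace_iff[OF assms(3)]
  by (auto simp: vspace_closed[OF assms(1)] linear_map_zero[OF assms(1,2)] linear_map_add linear_map_scale)

lemma span_linear_image_subset:
  assumes V: "vspace V" and W: "vspace W" and f: "linear_map V W f" and A: "A \<subseteq> vcarrier V"
    and U: "module.subspace (vscale W) U" "\<And>a. a \<in> A \<Longrightarrow> f a \<in> U" and x: "x \<in> module.span (vscale V) A"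
  shows "f x \<in> U" "x \<in> vcarrier V"
  using module.span_minimal[OF vspace_module[OF V], of A "{x \<in> vcarrier V. f x \<in> U}"]
    subspace_preimage[OF V f W U(1)] A U(2) x by auto

section \<open>Finite-dimensional subcomodules and subcoalgebras\<close>

text \<open>
  The slices of \<open>m\<close> form a stable subspace, spanned by the finitely many first factors of one
  representative of the coaction, and slicing with the counit gives back \<open>m\<close>.
\<close>

lemma finite_subcomodule:
  assumes C: "coalgebra C" and M: "right_comodule C M" and m: "m \<in> vcarrier M"
  obtains S where "subcomodule C M S" "m \<in> S" "fin_spanned M S"
proof -
  note pre = right_comodule_precomodule[OF C M]
  note vM = precomodule_vspace[OF pre]
  interpret vector_space "vscale M" by (rule vspace_vector_space[OF vM])
  let ?S = "{act M \<psi> m | \<psi>. functional C \<psi>}"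
  have sum: "functional C (\<lambda>c. \<psi> c + \<chi> c)" if "functional C \<psi>" "functional C \<chi>" for \<psi> \<chi>
    using that by (simp add: linear_map_def algebra_simps)
  have scale: "functional C (\<lambda>c. r * \<psi> c)" if "functional C \<psi>" for r \<psi>
    using that by (simp add: linear_map_def algebra_simps)
  have "subcomodule C M ?S"
    unfolding subcomodule_iff[OF pre] subspace_iff[OF vM]
  proof (intro conjI)
    have "act M (\<lambda>c. 0 * counit C c) m = vscale M 0 (act M (counit C) m)"
      by (rule act_scale[OF pre m])
    then have "0 = act M (\<lambda>c. 0 * counit C c) m" by (simp add: vspace_scale_simps[OF vM])
    then show "0 \<in> ?S" using scale[OF functional_counit[OF C], of 0] by blast
    show "\<forall>x\<in>?S. \<forall>y\<in>?S. x + y \<in> ?S"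
    proof safe
      fix \<psi> \<chi> assume "functional C \<psi>" "functional C \<chi>"
      then show "\<exists>\<xi>. act M \<psi> m + act M \<chi> m = act M \<xi> m \<and> functional C \<xi>"
        using act_add[OF pre m, of \<psi> \<chi>, symmetric] sum by blast
    qed
    show "\<forall>r. \<forall>x\<in>?S. vscale M r x \<in> ?S"
    proof safe
      fix \<psi> r assume "functional C \<psi>"
      then show "\<exists>\<xi>. vscale M r (act M \<psi> m) = act M \<xi> m \<and> functional C \<xi>"
        using act_scale[OF pre m, of r \<psi>, symmetric] scale by blast
    qed
    show "?S \<subseteq> vcarrier M" using act_closed[OF pre m] by auto
    show "\<forall>\<psi>. functional C \<psi> \<longrightarrow> (\<forall>n\<in>?S. act M \<psi> n \<in> ?S)"
      using act_act[OF C M _ _ m] functional_conv[OF C] by auto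
  qed
  moreover have "m \<in> ?S" using act_counit[OF C M m] functional_counit[OF C] by force
  moreover have "fin_spanned M ?S" unfolding fin_spanned_def
  proof (intro exI conjI)
    show "finite (fst ` Poly_Mapping.keys (coact M m))" by simp
    have "act M \<psi> m \<in> span (span (fst ` Poly_Mapping.keys (coact M m)))" for \<psi>
      unfolding act_def rslice_def
      by (rule lin_ext_in_span, safe, rule span_scale, rule span_base) force
    then show "?S \<subseteq> span (fst ` Poly_Mapping.keys (coact M m))" by (auto simp: span_span)
  qed
  ultimately show thesis by (rule that)
qed

lemma subcoalgebra_Int:
  assumes C: "coalgebra C" and "subcoalgebra C E" "subcoalgebra C F"
  shows "subcoalgebra C (E \<inter> F)"
  using assms(2,3) module.subspace_inter[OF vspace_module[OF coalgebra_vspace[OF C]]]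
  unfolding subcoalgebra_iff[OF C] by blast

text \<open>
  Left slices commute with right slices by coassociativity. So the left slices of a
  finite-dimensional subcomodule that contains \<open>c\<close> span a subspace stable on both sides.
\<close>

lemma finite_subcoalgebra:
  assumes C: "coalgebra C" and c: "c \<in> vcarrier C"
  obtains F where "subcoalgebra C F" "c \<in> F" "fin_spanned C F"
proof -
  note V = coalgebra_vspace[OF C]
  let ?R = "regular_comod C"
  interpret vector_space "vscale C" by (rule vspace_vector_space[OF V])
  obtain S where S: "subcomodule C ?R S" "c \<in> S" "fin_spanned ?R S"
    using finite_subcomodule[OF C right_comodule_regular[OF C], of c] c by auto
  have sub: "subspace S" "S \<subseteq> vcarrier C"
    and act: "\<And>\<psi> n. functional C \<psi> \<Longrightarrow> n \<in> S \<Longrightarrow> act ?R \<psi> n \<in> S"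
    using S(1) unfolding subcomodule_iff[OF precomodule_regular[OF C]] by auto
  obtain T where T: "finite T" "S \<subseteq> span T" using S(3) by (auto simp: fin_spanned_def)
  obtain A where A: "A \<subseteq> S" "independent A" "S \<subseteq> span A" using maximal_independent_subset by blast
  have finA: "finite A" using independent_span_bound[OF T(1) A(2)] A T by blast
  define G where "G = {lact C \<phi> v | \<phi> v. functional C \<phi> \<and> v \<in> S}"
  have GC: "G \<subseteq> vcarrier C" using lact_closed[OF C] sub by (auto simp: G_def)
  have G_act: "act ?R \<psi> x \<in> G \<and> lact C \<psi> x \<in> G" if xG: "x \<in> G" and \<psi>: "functional C \<psi>" for x \<psi>
  proof -
    obtain \<phi> v where x: "x = lact C \<phi> v" and \<phi>: "functional C \<phi>" and v: "v \<in> S"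
      using xG by (auto simp: G_def)
    have "v \<in> vcarrier C" using v sub by blast
    then have "act ?R \<psi> x = lact C \<phi> (act ?R \<psi> v)" "lact C \<psi> x = lact C (conv C \<phi> \<psi>) v"
      unfolding x using \<phi> \<psi> by (auto simp: act_lact[OF C] lact_lact[OF C])
    then show ?thesis
      using \<phi> v \<psi> act functional_conv[OF C] unfolding G_def by fast
  qed
  have "subcoalgebra C (span G)"
    unfolding subcoalgebra_iff[OF C]
  proof (intro conjI allI impI ballI)
    fix \<psi> e assume \<psi>: "functional C \<psi>" and e: "e \<in> span G"
    have "linear_map C C (act ?R \<psi>)"
      using linear_map_act[OF precomodule_regular[OF C] \<psi>] by (simp add: linear_map_def)
    then show "act ?R \<psi> e \<in> span G"
      by (rule span_linear_image_subset(1)[OF V V _ GC _ _ e]) (use G_act \<psi> in \<open>auto intro: span_base\<close>)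
    show "lact C \<psi> e \<in> span G"
      by (rule span_linear_image_subset(1)[OF V V linear_map_lact[OF C \<psi>] GC _ _ e])
        (use G_act \<psi> in \<open>auto intro: span_base\<close>)
  qed (use span_minimal[OF GC vspace_subspace[OF V]] in auto)
  moreover have "c \<in> span G"
    using lact_counit[OF C c] functional_counit[OF C] S(2) by (intro span_base) (force simp: G_def)
  moreover have "fin_spanned C (span G)" unfolding fin_spanned_def
  proof (intro exI conjI)
    let ?K = "\<Union>a\<in>A. snd ` Poly_Mapping.keys (comult C a)"
    show "finite ?K" using finA by simp
    have "lact C \<phi> v \<in> span ?K" if \<phi>: "functional C \<phi>" and v: "v \<in> S" for \<phi> v
    proof (rule span_linear_image_subset(1)[OF V V linear_map_lact[OF C \<phi>]])
      show "A \<subseteq> vcarrier C" "v \<in> span A" using A sub v by auto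
      fix a assume "a \<in> A"
      then have "lact C \<phi> a \<in> span (span ?K)" unfolding lact_def lslice_def
        by (intro lin_ext_in_span, safe, intro span_scale span_base) force
      then show "lact C \<phi> a \<in> span ?K" by (simp add: span_span)
    qed simp
    then have "G \<subseteq> span ?K" by (auto simp: G_def)
    then show "span G \<subseteq> span ?K" by (simp add: span_minimal)
  qed
  ultimately show thesis by (rule that)
qed

section \<open>Connected coalgebras\<close>

text \<open>
  This is pointed colocality with grouplike element \<open>g\<close>. The coradical is avoided because it is hard to
  follow through quotients and unions, whereas a nonzero subcoalgebra of a larger coalgebra can be
  intersected with a given one.
\<close>

definition connected_at :: "('k::field, 'c::ab_group_add) coalg \<Rightarrow> 'c \<Rightarrow> bool" where
  "connected_at C g \<longleftrightarrow> coalgebra C \<and> grouplike C g \<and>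
    (\<forall>E. subcoalgebra C E \<and> E \<noteq> {0} \<longrightarrow> g \<in> E)"

lemma grouplikeI:
  assumes V: "vspace C" and t: "comult C h \<in> tensors C C" and h: "h \<in> vcarrier C" "counit C h = 1"
    and ev: "\<And>\<phi> \<psi>. functional C \<phi> \<Longrightarrow> functional C \<psi> \<Longrightarrow> ev \<phi> \<psi> (comult C h) = \<phi> h * \<psi> h"
  shows "grouplike C h"
proof -
  have "pure (h, h) \<in> tensors C C" using h(1) by (simp add: tensors_def)
  then have "tensor_eq C C (comult C h) (pure (h, h))" using ev by (simp add: tensor_eq_iff[OF V V t])
  then show ?thesis using h by (simp add: grouplike_def)
qed

lemma ev_grouplike:
  "grouplike C h \<Longrightarrow> functional C \<phi> \<Longrightarrow> functional C \<psi> \<Longrightarrow> ev \<phi> \<psi> (comult C h) = \<phi> h * \<psi> h"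
  using tensor_eq_imp_ev[of C C "comult C h" "pure (h, h)" \<phi> \<psi>] by (simp add: grouplike_def)

text \<open>
  Among the nonzero subcoalgebras of a finite-dimensional one, those of least dimension are simple.
\<close>

lemma simple_subcoalgebra_exists:
  assumes C: "coalgebra C" and E: "subcoalgebra C E" "E \<noteq> {0}"
  obtains D where "simple_subcoalgebra C D" "D \<subseteq> E"
proof -
  note V = coalgebra_vspace[OF C]
  let ?dim = "vector_space.dim (vscale C)"
  have zero: "0 \<in> F" if "subcoalgebra C F" for F
    using that module.subspace_0[OF vspace_module[OF V]] by (simp add: subcoalgebra_def)
  obtain c where c: "c \<in> E" "c \<noteq> 0" using E zero by blast
  have "c \<in> vcarrier C" using c E by (auto simp: subcoalgebra_def)
  then obtain F where F: "subcoalgebra C F" "c \<in> F" "fin_spanned C F"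
    using finite_subcoalgebra[OF C] by blast
  let ?P = "\<lambda>D. subcoalgebra C D \<and> D \<noteq> {0} \<and> D \<subseteq> E \<inter> F"
  have "?P (E \<inter> F)" using subcoalgebra_Int[OF C E(1) F(1)] c F(2) by auto
  then obtain D where D: "?P D" "\<And>D'. ?P D' \<Longrightarrow> ?dim D \<le> ?dim D'"
    using ex_has_least_nat[of ?P "E \<inter> F" ?dim] by blast
  have "D' = D" if D': "subcoalgebra C D'" "D' \<subseteq> D" "D' \<noteq> {0}" for D'
  proof (rule ccontr)
    assume "D' \<noteq> D"
    then have "?dim D' < ?dim D"
      using dim_strict_mono[OF V fin_spanned_mono[OF F(3)], of D D'] D D'
      by (auto simp: subcoalgebra_def)
    moreover have "?dim D \<le> ?dim D'" using D D' by (intro D(2)) auto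
    ultimately show False by simp
  qed
  then have "simple_subcoalgebra C D" using D by (auto simp: simple_subcoalgebra_def)
  then show thesis using D that by auto
qed

lemma grouplike_subcoalgebra:
  assumes C: "coalgebra C" and g: "grouplike C g"
  shows "subcoalgebra C (range (\<lambda>r. vscale C r g))" "range (\<lambda>r. vscale C r g) \<noteq> {0}"
proof -
  note V = coalgebra_vspace[OF C]
  have gC: "g \<in> vcarrier C" and g2: "tensor_eq C C (comult C g) (pure (g, g))" and g1: "counit C g = 1"
    using g by (auto simp: grouplike_def)
  have "\<exists>t. Poly_Mapping.keys t \<subseteq> range (\<lambda>r. vscale C r g) \<times> range (\<lambda>r. vscale C r g)
      \<and> tensor_eq C C (comult C (vscale C r g)) t" for r
  proof (intro exI conjI)
    show "Poly_Mapping.keys (fscale r (pure (g, g))) \<subseteq> range (\<lambda>r. vscale C r g) \<times> range (\<lambda>r. vscale C r g)"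
      using vspace_scale_simps(3)[OF V, of g] by (auto simp: image_iff intro!: exI[of _ 1])
    have k: "fscale r (pure (g, g)) \<in> tensors C C" using gC by (simp add: tensors_def)
    have "ev \<phi> \<psi> (comult C (vscale C r g)) = ev \<phi> \<psi> (fscale r (pure (g, g)))"
      if "functional C \<phi>" "functional C \<psi>" for \<phi> \<psi>
      using functional_scale[OF functional_conv[OF C that] gC, of r] tensor_eq_imp_ev[OF g2 that]
      by (simp add: conv_def)
    then show "tensor_eq C C (comult C (vscale C r g)) (fscale r (pure (g, g)))"
      by (simp only: tensor_eq_iff[OF V V comult_tensors[OF C vspace_scale[OF V gC]] k]) simp
  qed
  moreover have "module.subspace (vscale C) (range (\<lambda>r. vscale C r g))"
    using module.subspace_span[OF vspace_module[OF V], of "{g}"]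
    by (simp add: module.span_singleton[OF vspace_module[OF V]])
  ultimately show "subcoalgebra C (range (\<lambda>r. vscale C r g))"
    using gC by (auto simp: subcoalgebra_def vspace_scale[OF V])
  have "g \<noteq> 0" using g1 linear_map_zero[OF V functional_counit[OF C]] by force
  moreover have "g \<in> range (\<lambda>r. vscale C r g)" using vspace_scale_simps(3)[OF V, of g] by (metis rangeI)
  ultimately show "range (\<lambda>r. vscale C r g) \<noteq> {0}" by blast
qed

lemma multiples_subset:
  assumes "coalgebra C" "subcoalgebra C E" "g \<in> E"
  shows "range (\<lambda>r. vscale C r g) \<subseteq> E"
  using assms module.subspace_scale[OF vspace_module[OF coalgebra_vspace[OF assms(1)]]]
  by (auto simp: subcoalgebra_def)

text \<open>
  A nonzero subcoalgebra contains a simple one, which lies in the coradical \<open>K g\<close> and is not zero.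
\<close>

lemma pointed_colocal_connected:
  assumes "pointed_colocal C"
  obtains g where "connected_at C g"
proof -
  obtain g where C: "coalgebra C" and g: "grouplike C g" and rad: "coradical C = range (\<lambda>r. vscale C r g)"
    using assms by (auto simp: pointed_colocal_def)
  note V = coalgebra_vspace[OF C]
  have "g \<in> E" if E: "subcoalgebra C E" "E \<noteq> {0}" for E
  proof -
    obtain D where D: "simple_subcoalgebra C D" "D \<subseteq> E" using simple_subcoalgebra_exists[OF C E] .
    have "D \<subseteq> range (\<lambda>r. vscale C r g)"
      unfolding rad[symmetric] coradical_def
      using D(1) module.span_superset[OF vspace_module[OF V], of "\<Union>{D. simple_subcoalgebra C D}"] by blast
    moreover have "D \<noteq> {0}" "0 \<in> D" using D(1) module.subspace_0[OF vspace_module[OF V], of D]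
      by (auto simp: simple_subcoalgebra_def subcoalgebra_def)
    then obtain d where "d \<in> D" "d \<noteq> 0" by blast
    ultimately obtain r where r: "vscale C r g \<in> D" "vscale C r g \<noteq> 0" by fast
    then have "r \<noteq> 0" using vspace_scale_simps(2)[OF V] by metis
    have "vscale C (inverse r) (vscale C r g) \<in> D"
      using D(1) r(1) module.subspace_scale[OF vspace_module[OF V]]
      by (simp add: simple_subcoalgebra_def subcoalgebra_def)
    then show ?thesis using \<open>r \<noteq> 0\<close> D(2) by (auto simp: vspace_scale_simps[OF V])
  qed
  then have "connected_at C g" using C g by (auto simp: connected_at_def)
  then show thesis by (rule that)
qed

lemma connected_at_colocal:
  assumes g: "connected_at C g"
  shows "colocal C"
proof -
  have C: "coalgebra C" and gl: "grouplike C g" and min: "\<And>E. subcoalgebra C E \<Longrightarrow> E \<noteq> {0} \<Longrightarrow> g \<in> E"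
    using g by (auto simp: connected_at_def)
  note V = coalgebra_vspace[OF C] and Kg = grouplike_subcoalgebra[OF C gl]
  let ?Kg = "range (\<lambda>r. vscale C r g)"
  have simple: "simple_subcoalgebra C ?Kg"
    unfolding simple_subcoalgebra_def using Kg min multiples_subset[OF C] by blast
  have "D = ?Kg" if "simple_subcoalgebra C D" for D
  proof -
    have "?Kg \<subseteq> D" using that min[of D] multiples_subset[OF C, of D g] by (simp add: simple_subcoalgebra_def)
    then show ?thesis using that Kg unfolding simple_subcoalgebra_def by blast
  qed
  with simple have "{D. simple_subcoalgebra C D} = {?Kg}" by blast
  then have "\<Union>{D. simple_subcoalgebra C D} = ?Kg" by simp
  moreover have "module.span (vscale C) ?Kg = ?Kg"
    using Kg(1) module.span_eq_iff[OF vspace_module[OF V]] by (simp add: subcoalgebra_def)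
  ultimately show ?thesis using simple C by (simp add: colocal_def coradical_def)
qed

text \<open>
  A second grouplike element \<open>h\<close> spans a subcoalgebra, which must contain \<open>g\<close>; the counit then shows
  that the scalar between \<open>g\<close> and \<open>h\<close> is \<open>1\<close>.
\<close>

lemma the_grouplike_eq:
  assumes g: "connected_at C g"
  shows "the_grouplike C = g"
proof -
  have C: "coalgebra C" and gl: "grouplike C g" and min: "\<And>E. subcoalgebra C E \<Longrightarrow> E \<noteq> {0} \<Longrightarrow> g \<in> E"
    using g by (auto simp: connected_at_def)
  note V = coalgebra_vspace[OF C]
  have "h = g" if h: "grouplike C h" for h
  proof -
    obtain r where r: "g = vscale C r h" using min[OF grouplike_subcoalgebra[OF C h]] by blast
    then have "counit C g = r * counit C h"
      using h functional_scale[OF functional_counit[OF C]] by (auto simp: grouplike_def)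
    then have "r = 1" using gl h by (simp add: grouplike_def)
    then show ?thesis using r by (simp add: vspace_scale_simps[OF V])
  qed
  then show ?thesis using gl unfolding the_grouplike_def by blast
qed

section \<open>Endomorphisms of a finite-dimensional indecomposable comodule\<close>

text \<open>
  The vector \<open>p(f) v\<close>.
\<close>

definition poly_act :: "('k::field \<Rightarrow> 'v \<Rightarrow> 'v::ab_group_add) \<Rightarrow> ('v \<Rightarrow> 'v) \<Rightarrow> 'v \<Rightarrow> 'k poly \<Rightarrow> 'v" where
  "poly_act s f v p = (\<Sum>i\<le>degree p. s (coeff p i) ((f ^^ i) v))"

context vector_space
begin

lemma poly_act_superset:
  assumes "degree p < n"
  shows "poly_act scale f v p = (\<Sum>i<n. scale (coeff p i) ((f ^^ i) v))"
  unfolding poly_act_def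
  by (rule sum.mono_neutral_left) (use assms in \<open>auto simp: coeff_eq_0\<close>)

lemma poly_act_add: "poly_act scale f v (p + q) = poly_act scale f v p + poly_act scale f v q"
proof -
  let ?n = "Suc (max (degree p) (degree q))"
  have "degree (p + q) < ?n" using degree_add_le_max[of p q] by linarith
  then show ?thesis
    by (simp add: poly_act_superset[of _ ?n] scale_left_distrib sum.distrib del: sum.lessThan_Suc)
qed

lemma poly_act_smult: "poly_act scale f v (smult r p) = scale r (poly_act scale f v p)"
proof -
  have "degree (smult r p) < Suc (degree p)" using degree_smult_le[of r p] by linarith
  then show ?thesis
    by (simp add: poly_act_superset[of _ "Suc (degree p)"] scale_sum_right del: sum.lessThan_Suc)
qed

lemma poly_act_monom: "poly_act scale f v (monom 1 i) = (f ^^ i) v"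
proof -
  have "degree (monom (1 :: 'a) i) < Suc i" by (simp add: degree_monom_eq)
  then have "poly_act scale f v (monom 1 i) = (\<Sum>j<Suc i. scale (coeff (monom 1 i) j) ((f ^^ j) v))"
    by (rule poly_act_superset)
  also have "\<dots> = (\<Sum>j<Suc i. if j = i then (f ^^ i) v else 0)"
    by (rule sum.cong) auto
  finally have "poly_act scale f v (monom 1 i) = (\<Sum>j<Suc i. if j = i then (f ^^ i) v else 0)" .
  then show ?thesis by simp
qed

end

lemma poly_act_closed:
  assumes "vspace V" "linear_map V V f" "v \<in> vcarrier V"
  shows "(f ^^ i) v \<in> vcarrier V" "poly_act (vscale V) f v p \<in> vcarrier V"
proof -
  show *: "(f ^^ i) v \<in> vcarrier V" for i
    by (induction i) (use assms linear_map_closed[OF assms(2)] in auto)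
  show "poly_act (vscale V) f v p \<in> vcarrier V"
    unfolding poly_act_def by (intro vspace_sum vspace_scale * assms(1))
qed

lemma poly_act_shift:
  assumes V: "vspace V" and f: "linear_map V V f" and v: "v \<in> vcarrier V"
  shows "poly_act (vscale V) f v (pCons 0 p) = f (poly_act (vscale V) f v p)"
proof -
  interpret vector_space "vscale V" by (rule vspace_vector_space[OF V])
  let ?n = "Suc (degree p)"
  have "degree (pCons 0 p) < Suc ?n" by (simp add: degree_pCons_le le_imp_less_Suc)
  then have "poly_act (vscale V) f v (pCons 0 p)
      = (\<Sum>i<Suc ?n. vscale V (coeff (pCons 0 p) i) ((f ^^ i) v))"
    by (rule poly_act_superset)
  also have "\<dots> = (\<Sum>i<?n. vscale V (coeff p i) (f ((f ^^ i) v)))"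
    by (subst sum.lessThan_Suc_shift) (simp del: sum.lessThan_Suc)
  also have "\<dots> = f (\<Sum>i<?n. vscale V (coeff p i) ((f ^^ i) v))"
    by (subst linear_map_sum[OF V f])
      (auto simp: linear_map_scale[OF f] poly_act_closed[OF V f v] vspace_scale[OF V] simp del: sum.lessThan_Suc)
  also have "(\<Sum>i<?n. vscale V (coeff p i) ((f ^^ i) v)) = poly_act (vscale V) f v p"
    by (rule poly_act_superset[symmetric]) simp
  finally show ?thesis .
qed

definition has_eigenvalue :: "('k::field, 'v::ab_group_add, 'z) vspc_scheme \<Rightarrow> ('v \<Rightarrow> 'v) \<Rightarrow> 'k \<Rightarrow> bool" where
  "has_eigenvalue V f \<kappa> \<longleftrightarrow> (\<exists>v\<in>vcarrier V. v \<noteq> 0 \<and> f v = vscale V \<kappa> v)"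

text \<open>
  The vectors \<open>p(f) v\<close> with \<open>deg p < i\<close> form an ascending chain of subspaces. It becomes stationary, which
  gives a nonzero polynomial \<open>p\<close> with \<open>p(f) v = 0\<close>. If \<open>p\<close> has least degree and \<open>p = (x - \<kappa>) q\<close>, then
  \<open>q(f) v\<close> is an eigenvector.
\<close>

lemma eigenvalue_exists:
  fixes V :: "('k::alg_closed_field, 'v::ab_group_add, 'z) vspc_scheme"
  assumes V: "vspace V" and fin: "fin_dim V" and nz: "vcarrier V \<noteq> {0}" and f: "linear_map V V f"
  obtains \<kappa> where "has_eigenvalue V f \<kappa>"
proof -
  interpret vector_space "vscale V" by (rule vspace_vector_space[OF V])
  obtain v where v: "v \<in> vcarrier V" "v \<noteq> 0" using nz vspace_zero[OF V] by blast
  let ?a = "poly_act (vscale V) f v"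
  define W where "W i = ?a ` {p. p = 0 \<or> degree p < i}" for i :: nat
  have a0: "?a 0 = 0" by (simp add: poly_act_def)
  have "subspace (W i)" for i
    unfolding subspace_def W_def
  proof (intro conjI ballI allI)
    show "0 \<in> ?a ` {p. p = 0 \<or> degree p < i}" using a0 by force
    fix x y r assume x: "x \<in> ?a ` {p. p = 0 \<or> degree p < i}"
    then obtain p where p: "x = ?a p" "p = 0 \<or> degree p < i" by blast
    show "vscale V r x \<in> ?a ` {p. p = 0 \<or> degree p < i}"
      using p degree_smult_le[of r p] by (intro image_eqI[of _ _ "smult r p"]) (auto simp: poly_act_smult)
    assume "y \<in> ?a ` {p. p = 0 \<or> degree p < i}"
    then obtain q where q: "y = ?a q" "q = 0 \<or> degree q < i" by blast
    show "x + y \<in> ?a ` {p. p = 0 \<or> degree p < i}"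
      using p q degree_add_less[of p i q] by (intro image_eqI[of _ _ "p + q"]) (auto simp: poly_act_add)
  qed
  moreover have "W i \<subseteq> vcarrier V" for i using poly_act_closed[OF V f v(1)] by (auto simp: W_def)
  moreover have "W i \<subseteq> W j" if "i \<le> j" for i j using that by (auto simp: W_def)
  ultimately obtain i where i: "\<And>j. i \<le> j \<Longrightarrow> W j = W i"
    using ascending_subspaces_stabilize[OF V fin[unfolded fin_dim_iff[OF V]], of W] by blast
  have "(f ^^ i) v \<in> W (Suc i)" unfolding W_def
    by (rule image_eqI[of _ _ "monom 1 i"]) (auto simp: poly_act_monom degree_monom_eq)
  then have "(f ^^ i) v \<in> W i" using i[of "Suc i"] by simp
  then obtain q where q: "(f ^^ i) v = ?a q" "q = 0 \<or> degree q < i" by (auto simp: W_def)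
  \<comment> \<open>The relation of \<open>f\<^sup>i v\<close> with lower powers is a polynomial with leading coefficient \<open>1\<close>.\<close>
  have "monom 1 i + smult (-1) q \<noteq> (0 :: 'k poly)"
  proof
    assume "monom 1 i + smult (-1) q = (0 :: 'k poly)"
    then have "coeff (monom 1 i + smult (-1) q) i = (0 :: 'k)" by simp
    then show False using q(2) by (auto simp: coeff_eq_0)
  qed
  moreover have "?a (monom 1 i + smult (-1) q) = 0"
    unfolding poly_act_add poly_act_monom poly_act_smult q(1) by simp
  ultimately have "\<exists>p. p \<noteq> 0 \<and> ?a p = 0" by blast
  then obtain p where p: "p \<noteq> 0" "?a p = 0"
    and min: "\<And>q. q \<noteq> 0 \<Longrightarrow> ?a q = 0 \<Longrightarrow> degree p \<le> degree q"
    using ex_has_least_nat[of "\<lambda>p. p \<noteq> 0 \<and> ?a p = 0" _ degree] by metis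
  have "degree p > 0"
  proof (rule ccontr)
    assume "\<not> degree p > 0"
    then obtain c where c: "p = [:c:]" using degree_eq_zeroE by blast
    then have "vscale V c v = 0" using p(2) by (simp add: poly_act_def)
    then show False using p(1) v c by simp
  qed
  then obtain \<kappa> where "poly p \<kappa> = 0" using alg_closed_imp_poly_has_root by blast
  then obtain q where q: "p = [:- \<kappa>, 1:] * q" by (auto simp: poly_eq_0_iff_dvd)
  have q0: "q \<noteq> 0" using p(1) q by auto
  then have "degree p = Suc (degree q)" unfolding q by (subst degree_mult_eq) auto
  then have w: "?a q \<noteq> 0" using min[OF q0] by auto
  have "p = pCons 0 q + smult (- \<kappa>) q" unfolding q by simp
  then have "f (?a q) + vscale V (- \<kappa>) (?a q) = 0"
    using p(2) by (simp only: poly_act_add poly_act_smult poly_act_shift[OF V f v(1)])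
  then have "f (?a q) = vscale V \<kappa> (?a q)" by (simp add: vspace_scale_simps[OF V])
  then show thesis
    using that w poly_act_closed[OF V f v(1)] unfolding has_eigenvalue_def by blast
qed

context
  fixes C :: "('k::field, 'c::ab_group_add) coalg" and M :: "('k, 'c, 'm::ab_group_add) comod"
  assumes pre: "precomodule C M"
begin

lemma comod_hom_self_iff:
  "comod_hom C M M f \<longleftrightarrow> linear_map M M f \<and>
    (\<forall>\<psi>. functional C \<psi> \<longrightarrow> (\<forall>m\<in>vcarrier M. act M \<psi> (f m) = f (act M \<psi> m)))"
  by (rule comod_hom_iff[OF pre precomodule_vspace[OF pre] coact_tensors[OF pre]])

lemma comod_hom_self_linear: "comod_hom C M M f \<Longrightarrow> linear_map M M f"
  by (simp add: comod_hom_def)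

lemma comod_hom_self_add:
  assumes "comod_hom C M M f" "comod_hom C M M h"
  shows "comod_hom C M M (\<lambda>x. f x + h x)"
proof -
  note V = precomodule_vspace[OF pre]
  have l: "linear_map M M f" "linear_map M M h" using assms by (auto simp: comod_hom_def)
  have "linear_map M M (\<lambda>x. f x + h x)"
    by (rule linear_mapI) (auto simp: linear_map_closed[OF l(1)] linear_map_closed[OF l(2)]
        vspace_closed[OF V] linear_map_add[OF l(1)] linear_map_add[OF l(2)]
        linear_map_scale[OF l(1)] linear_map_scale[OF l(2)] vspace_scale_simps[OF V])
  then show ?thesis using assms unfolding comod_hom_self_iff
    by (auto simp: linear_map_add[OF linear_map_act[OF pre]] linear_map_closed[OF l(1)] linear_map_closed[OF l(2)])
qed

lemma comod_hom_self_scale: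
  assumes "comod_hom C M M f"
  shows "comod_hom C M M (\<lambda>x. vscale M r (f x))"
proof -
  note V = precomodule_vspace[OF pre]
  have l: "linear_map M M f" using assms by (auto simp: comod_hom_def)
  have "linear_map M M (\<lambda>x. vscale M r (f x))"
    by (rule linear_mapI) (auto simp: linear_map_closed[OF l] vspace_closed[OF V] linear_map_add[OF l]
        linear_map_scale[OF l] vspace_scale_simps[OF V] mult.commute)
  then show ?thesis using assms unfolding comod_hom_self_iff
    by (auto simp: linear_map_scale[OF linear_map_act[OF pre]] linear_map_closed[OF l])
qed

lemma comod_hom_self_comp:
  assumes "comod_hom C M M f" "comod_hom C M M h"
  shows "comod_hom C M M (\<lambda>x. h (f x))"
  using assms linear_map_comp[of M M f M h] linear_map_closed[of M M f] unfolding comod_hom_self_iff by auto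

lemma comod_hom_self_id: "comod_hom C M M (\<lambda>x. x)"
  unfolding comod_hom_self_iff by (simp add: linear_map_def)

lemma comod_hom_self_funpow: "comod_hom C M M f \<Longrightarrow> comod_hom C M M (f ^^ n)"
proof (induction n)
  case 0
  show ?case using comod_hom_self_id by (simp add: id_def)
next
  case (Suc n)
  then show ?case using comod_hom_self_comp[of "f ^^ n" f] by (simp add: comp_def)
qed

lemma comod_hom_self_cong:
  assumes "comod_hom C M M f" "\<And>x. x \<in> vcarrier M \<Longrightarrow> f x = h x"
  shows "comod_hom C M M h"
  using assms linear_map_cong[OF precomodule_vspace[OF pre], of M f h] act_closed[OF pre]
  unfolding comod_hom_self_iff by auto

lemma subcomodule_kernel:
  assumes f: "comod_hom C M M f"
  shows "subcomodule C M {x \<in> vcarrier M. f x = 0}"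
proof -
  note V = precomodule_vspace[OF pre] and l = comod_hom_self_linear[OF f]
  have "f (act M \<psi> x) = 0" if "functional C \<psi>" "x \<in> vcarrier M" "f x = 0" for \<psi> x
  proof -
    have "f (act M \<psi> x) = act M \<psi> (f x)" using f that(1,2) by (simp add: comod_hom_self_iff)
    then show ?thesis using that linear_map_zero[OF V linear_map_act[OF pre that(1)]] by simp
  qed
  then show ?thesis
    unfolding subcomodule_iff[OF pre] using subspace_kernel[OF V l V] act_closed[OF pre] by auto
qed

lemma subcomodule_image:
  assumes f: "comod_hom C M M f"
  shows "subcomodule C M (f ` vcarrier M)"
  using f subspace_image[OF precomodule_vspace[OF pre] comod_hom_self_linear[OF f] precomodule_vspace[OF pre]]
    act_closed[OF pre] linear_map_closed[OF comod_hom_self_linear[OF f]]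
  unfolding subcomodule_iff[OF pre] comod_hom_self_iff by auto

text \<open>
  Fitting's lemma: once the kernels and images of the powers of \<open>f\<close> are stationary, they are
  complementary subcomodules.
\<close>

lemma fitting:
  assumes f: "comod_hom C M M f" and fin: "fin_dim M" and ind: "indecomposable C M"
  shows "(\<exists>n. \<forall>x\<in>vcarrier M. (f ^^ n) x = 0) \<or> bij_betw f (vcarrier M) (vcarrier M)"
proof -
  note V = precomodule_vspace[OF pre]
  let ?V = "vcarrier M"
  let ?K = "\<lambda>i. {x \<in> ?V. (f ^^ i) x = 0}" and ?I = "\<lambda>i. (f ^^ i) ` ?V"
  have l: "linear_map M M (f ^^ i)" for i
    by (rule comod_hom_self_linear[OF comod_hom_self_funpow[OF f]])
  have cl: "(f ^^ i) x \<in> ?V" if "x \<in> ?V" for i x using linear_map_closed[OF l that] .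
  have split: "(f ^^ (i + j)) x = (f ^^ i) ((f ^^ j) x)" for i j x by (simp add: funpow_add)
  have finV: "fin_spanned M ?V" using fin fin_dim_iff[OF V] by simp
  have K_mono: "?K i \<subseteq> ?K j" if "i \<le> j" for i j
  proof -
    have "(f ^^ j) x = (f ^^ (j - i)) ((f ^^ i) x)" for x using that split[of "j - i" i x] by simp
    then show ?thesis using linear_map_zero[OF V l] by auto
  qed
  have I_mono: "?I j \<subseteq> ?I i" if "i \<le> j" for i j
  proof -
    have "(f ^^ j) x = (f ^^ i) ((f ^^ (j - i)) x)" for x using that split[of i "j - i" x] by simp
    then show ?thesis using cl by auto
  qed
  obtain i where i: "\<And>j. i \<le> j \<Longrightarrow> ?K j = ?K i"
  proof (rule ascending_subspaces_stabilize[OF V finV, of ?K])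
    show "?K i \<subseteq> ?V" for i by blast
  qed (rule subspace_kernel[OF V l V], erule K_mono, blast)
  obtain i' where i': "\<And>j. i' \<le> j \<Longrightarrow> ?I j = ?I i'"
  proof (rule descending_subspaces_stabilize[OF V finV, of ?I])
    show "?I i \<subseteq> ?V" for i using cl by blast
  qed (rule subspace_image[OF V l V], erule I_mono, blast)
  \<comment> \<open>The exponent is positive, so that a map with injective power is itself injective.\<close>
  define n where "n = Suc (max i i')"
  have K: "?K (n + n) = ?K n" using i[of n] i[of "n + n"] by (simp add: n_def)
  have I: "?I (n + n) = ?I n" using i'[of n] i'[of "n + n"] by (simp add: n_def)
  have "?K n \<inter> ?I n = {0}"
  proof
    show "?K n \<inter> ?I n \<subseteq> {0}"
    proof
      fix x assume "x \<in> ?K n \<inter> ?I n"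
      then obtain y where y: "y \<in> ?V" "x = (f ^^ n) y" "(f ^^ n) x = 0" by auto
      then have "y \<in> ?K (n + n)" by (simp add: split)
      then show "x \<in> {0}" using K y(2) by auto
    qed
    show "{0} \<subseteq> ?K n \<inter> ?I n"
      using vspace_zero[OF V] linear_map_zero[OF V l] by (auto intro!: image_eqI[of _ _ 0])
  qed
  moreover have sum: "{a + b | a b. a \<in> ?K n \<and> b \<in> ?I n} = ?V"
  proof
    show "{a + b | a b. a \<in> ?K n \<and> b \<in> ?I n} \<subseteq> ?V" using vspace_add[OF V] cl by auto
    show "?V \<subseteq> {a + b | a b. a \<in> ?K n \<and> b \<in> ?I n}"
    proof
      fix x assume x: "x \<in> ?V"
      then have "(f ^^ n) x \<in> ?I (n + n)" using I by auto
      then obtain y where y: "y \<in> ?V" "(f ^^ n) x = (f ^^ n) ((f ^^ n) y)" by (auto simp: split)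
      have "x - (f ^^ n) y \<in> ?K n"
        using x y cl[OF y(1)] by (simp add: linear_map_diff[OF V l] vspace_diff[OF V])
      moreover have "(f ^^ n) y \<in> ?I n" using y by auto
      moreover have "x = (x - (f ^^ n) y) + (f ^^ n) y" by simp
      ultimately show "x \<in> {a + b | a b. a \<in> ?K n \<and> b \<in> ?I n}" by blast
    qed
  qed
  ultimately have "?K n = {0} \<or> ?I n = {0}"
    using ind subcomodule_kernel[OF comod_hom_self_funpow[OF f, of n]]
      subcomodule_image[OF comod_hom_self_funpow[OF f, of n]]
    unfolding indecomposable_def by simp
  then show ?thesis
  proof
    assume "?I n = {0}"
    then show ?thesis by blast
  next
    assume K0: "?K n = {0}"
    have "?I n = ?V" using sum unfolding K0 by simp
    have "f ` ?V = ?V"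
    proof
      show "f ` ?V \<subseteq> ?V" using cl[of _ 1] by auto
      show "?V \<subseteq> f ` ?V"
      proof
        fix x assume "x \<in> ?V"
        then obtain y where "y \<in> ?V" "x = (f ^^ n) y" using \<open>?I n = ?V\<close> by blast
        then show "x \<in> f ` ?V" using cl[of y "max i i'"] by (auto simp: n_def)
      qed
    qed
    moreover have "inj_on f ?V"
    proof (rule inj_onI)
      fix x y assume xy: "x \<in> ?V" "y \<in> ?V" "f x = f y"
      then have "x - y \<in> ?K n"
        using linear_map_diff[OF V comod_hom_self_linear[OF f], of x y] linear_map_zero[OF V l]
        by (simp add: n_def funpow_swap1 vspace_diff[OF V])
      then have "x - y \<in> {0}" unfolding K0 .
      then show "x = y" by simp
    qed
    ultimately show ?thesis by (simp add: bij_betw_def)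
  qed
qed

end

text \<open>
  For such \<open>M\<close> the endomorphism algebra is local with residue field \<open>K\<close>: every endomorphism has exactly one
  eigenvalue, it is invertible if this eigenvalue is nonzero and nilpotent otherwise, and the
  eigenvalue is additive and multiplicative in the endomorphism.
\<close>

locale fd_indecomposable_comodule =
  fixes C :: "('k::alg_closed_field, 'c::ab_group_add) coalg" and M :: "('k, 'c, 'm::ab_group_add) comod"
  assumes C: "coalgebra C" and M: "right_comodule C M" and fin: "fin_dim M" and ind: "indecomposable C M"
begin

lemma pre: "precomodule C M" by (rule right_comodule_precomodule[OF C M])

lemma V: "vspace M" by (rule precomodule_vspace[OF pre])

lemma nonzero: "vcarrier M \<noteq> {0}" using ind by (simp add: indecomposable_def)

abbreviation endo :: "('m \<Rightarrow> 'm) \<Rightarrow> bool" where "endo f \<equiv> comod_hom C M M f"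

lemmas endo_linear = comod_hom_self_linear[OF pre]

lemma endo_eigenvalue_exists: "endo f \<Longrightarrow> \<exists>\<kappa>. has_eigenvalue M f \<kappa>"
  using eigenvalue_exists[OF V fin nonzero] endo_linear by metis

lemma endo_shift: "endo f \<Longrightarrow> endo (\<lambda>x. f x + vscale M r x)"
  using comod_hom_self_add[OF pre _ comod_hom_self_scale[OF pre comod_hom_self_id[OF pre]]] .

lemma has_eigenvalue_shift:
  "has_eigenvalue M f \<kappa> \<Longrightarrow> has_eigenvalue M (\<lambda>x. f x + vscale M r x) (\<kappa> + r)"
  unfolding has_eigenvalue_def by (auto simp: vspace_scale_simps[OF V])

lemma not_bij_if_eigenvalue_0:
  assumes "endo f" "has_eigenvalue M f 0" shows "\<not> bij_betw f (vcarrier M) (vcarrier M)"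
proof
  assume "bij_betw f (vcarrier M) (vcarrier M)"
  moreover obtain v where "v \<in> vcarrier M" "v \<noteq> 0" "f v = 0"
    using assms(2) by (auto simp: has_eigenvalue_def vspace_scale_simps[OF V])
  ultimately show False
    using linear_map_zero[OF V endo_linear[OF assms(1)]] vspace_zero[OF V]
    by (metis bij_betw_imp_inj_on inj_onD)
qed

lemma eigenvalue_0_nilpotent:
  assumes "endo f" "has_eigenvalue M f 0" obtains n where "\<forall>x\<in>vcarrier M. (f ^^ n) x = 0"
  using fitting[OF pre assms(1) fin ind] not_bij_if_eigenvalue_0[OF assms] by blast

text \<open>
  A singular endomorphism is nilpotent by Fitting's lemma, and a nilpotent endomorphism has no
  nonzero eigenvalue.
\<close>

lemma has_eigenvalue_unique_0:
  assumes f: "endo f" and 0: "has_eigenvalue M f 0" and r: "has_eigenvalue M f r"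
  shows "r = 0"
proof -
  obtain n where n: "\<forall>x\<in>vcarrier M. (f ^^ n) x = 0" using eigenvalue_0_nilpotent[OF f 0] .
  obtain v where v: "v \<in> vcarrier M" "v \<noteq> 0" "f v = vscale M r v"
    using r by (auto simp: has_eigenvalue_def)
  have "(f ^^ i) v = vscale M (r ^ i) v" for i
    by (induction i) (use v linear_map_scale[OF endo_linear[OF f] v(1)] in
      \<open>auto simp: vspace_scale_simps[OF V] mult.commute\<close>)
  then have "vscale M (r ^ n) v = 0" using n v by metis
  then show ?thesis using v by (simp add: vspace_scale_eq_0[OF V])
qed

lemma has_eigenvalue_unique:
  assumes f: "endo f" and "has_eigenvalue M f \<kappa>" "has_eigenvalue M f \<mu>"
  shows "\<kappa> = \<mu>"
  using has_eigenvalue_unique_0[OF endo_shift[OF f, of "- \<kappa>"], of "\<mu> - \<kappa>"]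
    has_eigenvalue_shift[OF assms(2), of "- \<kappa>"] has_eigenvalue_shift[OF assms(3), of "- \<kappa>"] by simp

lemma bij_if_eigenvalue_nonzero:
  assumes f: "endo f" and "has_eigenvalue M f \<kappa>" "\<kappa> \<noteq> 0"
  shows "bij_betw f (vcarrier M) (vcarrier M)"
proof (rule ccontr)
  assume "\<not> ?thesis"
  then obtain n where n: "\<forall>x\<in>vcarrier M. (f ^^ n) x = 0" using fitting[OF pre f fin ind] by blast
  have "has_eigenvalue M f 0"
  proof (rule ccontr)
    assume no: "\<not> has_eigenvalue M f 0"
    obtain v where v: "v \<in> vcarrier M" "v \<noteq> 0" using nonzero vspace_zero[OF V] by blast
    have "(f ^^ i) v \<in> vcarrier M \<and> (f ^^ i) v \<noteq> 0" for i
      by (induction i) (use v no linear_map_closed[OF endo_linear[OF f]] in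
        \<open>auto simp: has_eigenvalue_def vspace_scale_simps[OF V]\<close>)
    then show False using n v by blast
  qed
  then show False using has_eigenvalue_unique[OF f assms(2)] assms(3) by blast
qed

lemma endo_inverse:
  assumes f: "endo f" and bij: "bij_betw f (vcarrier M) (vcarrier M)"
  obtains h where "endo h" "\<And>x. x \<in> vcarrier M \<Longrightarrow> h (f x) = x" "\<And>x. x \<in> vcarrier M \<Longrightarrow> f (h x) = x"
proof -
  let ?h = "inv_into (vcarrier M) f"
  note h = linear_map_inv_into[OF V endo_linear[OF f] bij]
  have "act M \<psi> (?h x) = ?h (act M \<psi> x)" if "functional C \<psi>" "x \<in> vcarrier M" for \<psi> x
  proof -
    have hx: "?h x \<in> vcarrier M" by (rule linear_map_closed[OF h(1) that(2)])
    have "f (act M \<psi> (?h x)) = act M \<psi> (f (?h x))"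
      using f that(1) hx by (simp add: comod_hom_self_iff[OF pre])
    then show ?thesis using h(2)[OF act_closed[OF pre hx], of \<psi>] h(3)[OF that(2)] by simp
  qed
  then have "endo ?h" using h(1) by (simp add: comod_hom_self_iff[OF pre])
  then show thesis using that h(2,3) by blast
qed

text \<open>
  The endomorphisms with eigenvalue \<open>0\<close> are closed under addition: if \<open>f + h\<close> were invertible, then
  the composite of \<open>f\<close> with its inverse would be singular and would still fix a kernel vector
  of \<open>h\<close>.
\<close>

lemma has_eigenvalue_add_0:
  assumes f: "endo f" "has_eigenvalue M f 0" and h: "endo h" "has_eigenvalue M h 0"
  shows "has_eigenvalue M (\<lambda>x. f x + h x) 0"
proof (rule ccontr)
  let ?u = "\<lambda>x. f x + h x"
  assume no: "\<not> has_eigenvalue M ?u 0"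
  have u: "endo ?u" by (rule comod_hom_self_add[OF pre f(1) h(1)])
  obtain \<kappa> where "has_eigenvalue M ?u \<kappa>" using endo_eigenvalue_exists[OF u] by blast
  then have "bij_betw ?u (vcarrier M) (vcarrier M)" using no bij_if_eigenvalue_nonzero[OF u] by metis
  then obtain k where k: "endo k" "\<And>x. x \<in> vcarrier M \<Longrightarrow> k (?u x) = x"
    using endo_inverse[OF u] by blast
  obtain v where v: "v \<in> vcarrier M" "v \<noteq> 0" "h v = 0"
    using h(2) by (auto simp: has_eigenvalue_def vspace_scale_simps[OF V])
  obtain w where w: "w \<in> vcarrier M" "w \<noteq> 0" "f w = 0"
    using f(2) by (auto simp: has_eigenvalue_def vspace_scale_simps[OF V])
  have "has_eigenvalue M (\<lambda>x. k (f x)) 0"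
    unfolding has_eigenvalue_def
    by (rule bexI[of _ w]) (use w linear_map_zero[OF V endo_linear[OF k(1)]] in \<open>auto simp: vspace_scale_simps[OF V]\<close>)
  moreover have "has_eigenvalue M (\<lambda>x. k (f x)) 1"
    unfolding has_eigenvalue_def
    by (rule bexI[of _ v]) (use v k(2)[OF v(1)] in \<open>auto simp: vspace_scale_simps[OF V]\<close>)
  ultimately have "(0::'k) = 1" using has_eigenvalue_unique[OF comod_hom_self_comp[OF pre f(1) k(1)]] by blast
  then show False by simp
qed

lemma has_eigenvalue_scale:
  assumes "has_eigenvalue M f \<kappa>"
  shows "has_eigenvalue M (\<lambda>x. vscale M r (f x)) (r * \<kappa>)"
  using assms unfolding has_eigenvalue_def by (auto simp: vspace_scale_simps[OF V])

lemma has_eigenvalue_cong: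
  "(\<And>x. x \<in> vcarrier M \<Longrightarrow> f x = h x) \<Longrightarrow> has_eigenvalue M f \<kappa> \<Longrightarrow> has_eigenvalue M h \<kappa>"
  unfolding has_eigenvalue_def by auto

lemma has_eigenvalue_add:
  assumes f: "endo f" "has_eigenvalue M f \<kappa>" and h: "endo h" "has_eigenvalue M h \<mu>"
  shows "has_eigenvalue M (\<lambda>x. f x + h x) (\<kappa> + \<mu>)"
proof -
  have "has_eigenvalue M (\<lambda>x. (f x + vscale M (- \<kappa>) x) + (h x + vscale M (- \<mu>) x)) 0"
    using has_eigenvalue_shift[OF f(2), of "- \<kappa>"] has_eigenvalue_shift[OF h(2), of "- \<mu>"]
    by (intro has_eigenvalue_add_0[OF endo_shift[OF f(1)] _ endo_shift[OF h(1)]]) simp_all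
  from has_eigenvalue_shift[OF this, of "\<kappa> + \<mu>"]
  have "has_eigenvalue M (\<lambda>x. (f x + vscale M (- \<kappa>) x) + (h x + vscale M (- \<mu>) x)
      + vscale M (\<kappa> + \<mu>) x) (\<kappa> + \<mu>)" by simp
  then show ?thesis by (rule has_eigenvalue_cong[rotated]) (simp add: vspace_scale_simps[OF V])
qed

text \<open>
  The endomorphism \<open>h (f x)\<close> is the sum of \<open>h (f x - \<kappa> x)\<close>, which is singular, and \<open>\<kappa> h(x)\<close>.
\<close>

lemma has_eigenvalue_comp:
  assumes f: "endo f" "has_eigenvalue M f \<kappa>" and h: "endo h" "has_eigenvalue M h \<mu>"
  shows "has_eigenvalue M (\<lambda>x. h (f x)) (\<kappa> * \<mu>)"
proof -
  let ?f = "\<lambda>x. f x + vscale M (- \<kappa>) x"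
  note lh = endo_linear[OF h(1)]
  have "has_eigenvalue M ?f 0" using has_eigenvalue_shift[OF f(2), of "- \<kappa>"] by simp
  then obtain v where "v \<in> vcarrier M" "v \<noteq> 0" "?f v = 0"
    by (auto simp: has_eigenvalue_def vspace_scale_simps[OF V])
  then have "has_eigenvalue M (\<lambda>x. h (?f x)) 0"
    unfolding has_eigenvalue_def
    by (intro bexI[of _ v]) (use linear_map_zero[OF V lh] in \<open>auto simp: vspace_scale_simps[OF V]\<close>)
  then have "has_eigenvalue M (\<lambda>x. h (?f x) + vscale M \<kappa> (h x)) (0 + \<kappa> * \<mu>)"
    by (rule has_eigenvalue_add[OF comod_hom_self_comp[OF pre endo_shift[OF f(1)] h(1)] _
          comod_hom_self_scale[OF pre h(1)] has_eigenvalue_scale[OF h(2)]])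
  moreover have "h (?f x) + vscale M \<kappa> (h x) = h (f x)" if x: "x \<in> vcarrier M" for x
    using linear_map_add[OF lh linear_map_closed[OF endo_linear[OF f(1)] x] vspace_scale[OF V x, of "- \<kappa>"]]
      linear_map_scale[OF lh x, of "- \<kappa>"]
    by (simp add: vspace_scale_simps[OF V])
  ultimately show ?thesis
    using has_eigenvalue_cong[of "\<lambda>x. h (?f x) + vscale M \<kappa> (h x)" "\<lambda>x. h (f x)" "\<kappa> * \<mu>"] by simp
qed

text \<open>
  The image of \<open>f\<close> in the residue field of the local algebra \<open>End(M)\<close>.
\<close>

definition residue :: "('m \<Rightarrow> 'm) \<Rightarrow> 'k" where
  "residue f = (THE \<kappa>. has_eigenvalue M f \<kappa>)"

lemma residue: "endo f \<Longrightarrow> has_eigenvalue M f (residue f)"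
  unfolding residue_def using endo_eigenvalue_exists has_eigenvalue_unique by (metis (full_types) theI)

lemma residue_eqI: "endo f \<Longrightarrow> has_eigenvalue M f \<kappa> \<Longrightarrow> residue f = \<kappa>"
  using residue has_eigenvalue_unique by blast

end

section \<open>The coalgebra dual to the endomorphism algebra\<close>

context fd_indecomposable_comodule
begin

abbreviation E :: "('m \<Rightarrow> 'm) set" where "E \<equiv> comod_end C M"

abbreviation A :: "('k, ('m \<Rightarrow> 'm) \<Rightarrow> 'k) coalg" where "A \<equiv> end_dual C M"

text \<open>
  The algebra \<open>End(M)\<close> as a vector space, whose functionals are the elements of \<open>A\<^sub>M\<close>.
\<close>

definition end_space :: "('k, 'm \<Rightarrow> 'm) vspc" where
  "end_space = \<lparr>vcarrier = E, vscale = (\<lambda>r f x. vscale M r (f x))\<rparr>"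

lemma end_space_simps [simp]:
  "vcarrier end_space = E" "vscale end_space r f = (\<lambda>x. vscale M r (f x))"
  by (simp_all add: end_space_def)

lemma E_iff: "f \<in> E \<longleftrightarrow> endo f \<and> (\<forall>x. x \<notin> vcarrier M \<longrightarrow> f x = 0)"
  by (simp add: comod_end_def)

lemma E_endo: "f \<in> E \<Longrightarrow> endo f" by (simp add: E_iff)

lemma E_linear: "f \<in> E \<Longrightarrow> linear_map M M f" by (simp add: E_iff comod_hom_def)

lemma E_outside: "f \<in> E \<Longrightarrow> x \<notin> vcarrier M \<Longrightarrow> f x = 0" by (simp add: E_iff)

lemma E_closed: "f \<in> E \<Longrightarrow> f x \<in> vcarrier M"
  using linear_map_closed[OF E_linear] E_outside vspace_zero[OF V] by metis

lemma E_restrict: "endo f \<Longrightarrow> (\<lambda>x. if x \<in> vcarrier M then f x else 0) \<in> E"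
  unfolding E_iff using comod_hom_self_cong[OF pre, of f] by auto

lemma E_one: "end_one M \<in> E"
  using E_restrict[OF comod_hom_self_id[OF pre]] by (simp add: end_one_def[abs_def])

lemma E_add: "f \<in> E \<Longrightarrow> h \<in> E \<Longrightarrow> (\<lambda>x. f x + h x) \<in> E"
  using comod_hom_self_add[OF pre] by (simp add: E_iff)

lemma E_scale: "f \<in> E \<Longrightarrow> (\<lambda>x. vscale M r (f x)) \<in> E"
  using comod_hom_self_scale[OF pre] by (simp add: E_iff vspace_scale_simps[OF V])

lemma E_comp: "f \<in> E \<Longrightarrow> h \<in> E \<Longrightarrow> h \<circ> f \<in> E"
  using comod_hom_self_comp[OF pre, of f h] linear_map_zero[OF V E_linear[of h]]
  by (simp add: E_iff comp_def)

lemma E_zero: "(\<lambda>x. 0) \<in> E"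
  using E_scale[OF E_one, of 0] by (simp add: vspace_scale_simps[OF V])

lemma vspace_end_space: "vspace end_space"
proof -
  have vs: "vector_space (vscale end_space)"
    by unfold_locales (auto simp: vspace_scale_simps[OF V] plus_fun_def)
  interpret vector_space "vscale end_space" by (rule vs)
  have "subspace E"
    unfolding subspace_def using E_add E_scale E_zero by (auto simp: plus_fun_def zero_fun_def)
  then show ?thesis by (simp add: vspace_def vs)
qed

lemma fin_dim_end_space: "fin_dim end_space"
proof -
  interpret vector_space "vscale end_space" by (rule vspace_vector_space[OF vspace_end_space])
  obtain J r where J: "finite J" "J \<subseteq> vcarrier M" and r: "\<And>b. functional M (\<lambda>v. r v b)"
    and sum: "\<And>v. v \<in> vcarrier M \<Longrightarrow> v = (\<Sum>b\<in>J. vscale M (r v b) b)"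
    using fin_spanned_coordinates[OF V fin] by blast
  define u where "u b b' = (\<lambda>x. if x \<in> vcarrier M then vscale M (r x b) b' else 0)" for b b'
  \<comment> \<open>The matrix units of \<open>M\<close> span a space that contains all endomorphisms.\<close>
  let ?U = "(\<lambda>(b, b'). u b b') ` (J \<times> J)"
  have "f \<in> span ?U" if f: "f \<in> E" for f
  proof -
    have ap: "(\<Sum>i\<in>I. h i) x = (\<Sum>i\<in>I. h i x)" for I :: "'m set" and h :: "'m \<Rightarrow> 'm \<Rightarrow> 'm" and x
      by (induction I rule: infinite_finite_induct) auto
    have "f = (\<Sum>b\<in>J. \<Sum>b'\<in>J. vscale end_space (r (f b) b') (u b b'))"
    proof
      fix x
      show "f x = (\<Sum>b\<in>J. \<Sum>b'\<in>J. vscale end_space (r (f b) b') (u b b')) x"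
      proof (cases "x \<in> vcarrier M")
        case True
        have fb: "(\<Sum>b'\<in>J. vscale M (r (f b) b') b') = f b" for b
          using sum[OF E_closed[OF f, of b]] by simp
        have "f x = f (\<Sum>b\<in>J. vscale M (r x b) b)" using sum[OF True] by simp
        also have "\<dots> = (\<Sum>b\<in>J. vscale M (r x b) (f b))"
          using J by (subst linear_map_sum[OF V E_linear[OF f]])
            (auto simp: vspace_scale[OF V] linear_map_scale[OF E_linear[OF f]] subset_iff intro!: sum.cong)
        also have "\<dots> = (\<Sum>b\<in>J. vscale M (r x b) (\<Sum>b'\<in>J. vscale M (r (f b) b') b'))"
          by (simp only: fb)
        also have "\<dots> = (\<Sum>b\<in>J. \<Sum>b'\<in>J. vscale M (r (f b) b') (vscale M (r x b) b'))"
          by (simp add: module.scale_sum_right[OF vspace_module[OF V]] vspace_scale_simps[OF V] mult.commute)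
        also have "\<dots> = (\<Sum>b\<in>J. \<Sum>b'\<in>J. vscale end_space (r (f b) b') (u b b')) x"
          using True by (simp add: ap u_def)
        finally show ?thesis .
      next
        case False
        then show ?thesis by (simp add: ap u_def E_outside[OF f] vspace_scale_simps[OF V])
      qed
    qed
    also have "\<dots> \<in> span ?U" by (intro span_sum span_scale span_base) auto
    finally show ?thesis .
  qed
  then have "fin_spanned end_space E" unfolding fin_spanned_def
    using J(1) by (intro exI[of _ ?U]) auto
  then show ?thesis by (simp add: fin_dim_iff[OF vspace_end_space])
qed

lemma A_simps [simp]:
  "vcarrier (end_dual_space C M) = vcarrier A"
  "vscale A r a = (\<lambda>f. r * a f)" "vscale (end_dual_space C M) = vscale A"
  "counit A a = a (end_one M)"
  by (simp_all add: end_dual_def end_dual_space_def)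

lemma A_iff: "a \<in> vcarrier A \<longleftrightarrow> functional end_space a \<and> (\<forall>f. f \<notin> E \<longrightarrow> a f = 0)"
proof -
  have 1: "(\<lambda>x. if x \<in> vcarrier M then vscale M r (f x) else 0) = vscale end_space r f" if "f \<in> E" for r f
    using E_outside[OF that] by (auto simp: vspace_scale_simps[OF V])
  have "vcarrier A = {a. (\<forall>f\<in>E. \<forall>f'\<in>E. a (\<lambda>x. f x + f' x) = a f + a f') \<and>
        (\<forall>r. \<forall>f\<in>E. a (\<lambda>x. if x \<in> vcarrier M then vscale M r (f x) else 0) = r * a f) \<and>
        (\<forall>f. f \<notin> E \<longrightarrow> a f = 0)}"
    by (simp add: end_dual_def end_dual_space_def)
  then show ?thesis using 1 by (auto simp: linear_map_def plus_fun_def)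
qed

lemma A_functional: "a \<in> vcarrier A \<Longrightarrow> functional end_space a" by (simp add: A_iff)

lemma A_outside: "a \<in> vcarrier A \<Longrightarrow> f \<notin> E \<Longrightarrow> a f = 0" by (simp add: A_iff)

lemma A_add: "a \<in> vcarrier A \<Longrightarrow> f \<in> E \<Longrightarrow> h \<in> E \<Longrightarrow> a (\<lambda>x. f x + h x) = a f + a h"
  using linear_map_add[OF A_functional, of a f h] by (simp add: plus_fun_def)

lemma A_scale: "a \<in> vcarrier A \<Longrightarrow> f \<in> E \<Longrightarrow> a (\<lambda>x. vscale M r (f x)) = r * a f"
  using functional_scale[OF A_functional, of a f r] by simp

lemma A_restrict:
  assumes "\<And>f h. f \<in> E \<Longrightarrow> h \<in> E \<Longrightarrow> \<phi> (\<lambda>x. f x + h x) = \<phi> f + \<phi> h"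
    and "\<And>r f. f \<in> E \<Longrightarrow> \<phi> (\<lambda>x. vscale M r (f x)) = r * \<phi> f"
  shows "(\<lambda>f. if f \<in> E then \<phi> f else 0) \<in> vcarrier A"
  using assms unfolding A_iff by (auto intro!: functionalI simp: E_add E_scale plus_fun_def)

lemma vspace_A: "vspace A"
proof -
  have vs: "vector_space (vscale A)"
    by unfold_locales (auto simp: algebra_simps)
  interpret vector_space "vscale A" by (rule vs)
  have "subspace (vcarrier A)"
    unfolding subspace_def by (auto simp: A_iff linear_map_def algebra_simps)
  then show ?thesis by (simp add: vspace_def vs)
qed

lemma functional_eval: "functional A (\<lambda>a. a f)"
  by (rule functionalI) auto

text \<open>
  The elements \<open>e b\<close> of \<open>A\<^sub>M\<close> are the coordinate functionals for a finite set \<open>J\<close> of endomorphisms.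
\<close>

lemma dual_basis:
  "\<exists>J e. finite J \<and> J \<subseteq> E \<and> (\<forall>b. e b \<in> vcarrier A) \<and>
    (\<forall>\<phi> f. functional end_space \<phi> \<longrightarrow> f \<in> E \<longrightarrow> \<phi> f = (\<Sum>b\<in>J. e b f * \<phi> b)) \<and>
    (\<forall>f x. f \<in> E \<longrightarrow> f x = (\<Sum>b\<in>J. vscale M (e b f) (b x)))"
proof -
  note vE = vspace_end_space
  obtain J r where J: "finite J" "J \<subseteq> vcarrier end_space" and r: "\<And>b. functional end_space (\<lambda>v. r v b)"
    and sum: "\<And>v. v \<in> vcarrier end_space \<Longrightarrow> v = (\<Sum>b\<in>J. vscale end_space (r v b) b)"
    using fin_spanned_coordinates[OF vE fin_dim_end_space] by blast
  define e where "e b f = (if f \<in> E then r f b else 0)" for b f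
  have "functional end_space (e b)" for b
    by (rule linear_map_cong[OF vE r[of b]]) (simp add: e_def)
  then have e: "e b \<in> vcarrier A" for b by (simp add: A_iff e_def)
  have exp: "f = (\<Sum>b\<in>J. vscale end_space (e b f) b)" if "f \<in> E" for f
    using sum[of f] that by (simp add: e_def)
  have \<phi>: "\<phi> f = (\<Sum>b\<in>J. e b f * \<phi> b)" if \<phi>: "functional end_space \<phi>" and f: "f \<in> E" for \<phi> f
  proof -
    have "\<phi> f = \<phi> (\<Sum>b\<in>J. vscale end_space (e b f) b)" using exp[OF f] by simp
    also have "\<dots> = (\<Sum>b\<in>J. \<phi> (vscale end_space (e b f) b))"
      by (rule linear_map_sum[OF vE \<phi>]) (use J E_scale in auto)
    also have "\<dots> = (\<Sum>b\<in>J. e b f * \<phi> b)"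
      by (rule sum.cong[OF refl]) (use J in \<open>auto simp: functional_scale[OF \<phi>] simp del: end_space_simps(2)\<close>)
    finally show ?thesis .
  qed
  have ap: "(\<Sum>i\<in>I. h i) x = (\<Sum>i\<in>I. h i x)" for I and h :: "('m \<Rightarrow> 'm) \<Rightarrow> 'm \<Rightarrow> 'm" and x
    by (induction I rule: infinite_finite_induct) auto
  have "f x = (\<Sum>b\<in>J. vscale M (e b f) (b x))" if f: "f \<in> E" for f x
    using fun_cong[OF exp[OF f], of x] by (simp add: ap)
  then show ?thesis using J e \<phi> by (intro exI[of _ J] exI[of _ e]) auto
qed

lemma functional_comp_left: "a \<in> vcarrier A \<Longrightarrow> h \<in> E \<Longrightarrow> functional end_space (\<lambda>f. a (h \<circ> f))"
proof (rule functionalI)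
  assume a: "a \<in> vcarrier A" and h: "h \<in> E"
  note l = E_linear[OF h]
  fix f f' r assume f: "f \<in> vcarrier end_space"
  have "h \<circ> vscale end_space r f = (\<lambda>x. vscale M r ((h \<circ> f) x))"
    using f by (auto simp: linear_map_scale[OF l] E_closed)
  then show "a (h \<circ> vscale end_space r f) = r * a (h \<circ> f)"
    using A_scale[OF a E_comp[OF _ h, of f]] f by simp
  assume f': "f' \<in> vcarrier end_space"
  have "h \<circ> (f + f') = (\<lambda>x. (h \<circ> f) x + (h \<circ> f') x)"
    using f f' by (auto simp: linear_map_add[OF l] E_closed)
  then show "a (h \<circ> (f + f')) = a (h \<circ> f) + a (h \<circ> f')"
    using A_add[OF a E_comp[OF _ h, of f] E_comp[OF _ h, of f']] f f' by simp
qed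

lemma functional_comp_right: "a \<in> vcarrier A \<Longrightarrow> f \<in> E \<Longrightarrow> functional end_space (\<lambda>h. a (h \<circ> f))"
proof (rule functionalI)
  assume a: "a \<in> vcarrier A" and f: "f \<in> E"
  fix h h' r assume h: "h \<in> vcarrier end_space"
  show "a (vscale end_space r h \<circ> f) = r * a (h \<circ> f)"
    using A_scale[OF a E_comp[OF f, of h]] h by (simp add: comp_def)
  assume h': "h' \<in> vcarrier end_space"
  show "a ((h + h') \<circ> f) = a (h \<circ> f) + a (h' \<circ> f)"
    using A_add[OF a E_comp[OF f, of h] E_comp[OF f, of h']] h h' by (simp add: comp_def plus_fun_def)
qed

text \<open>
  The tensor \<open>\<Sum> a (b' \<circ> b) e\<^sub>b \<otimes> e\<^sub>b'\<close> shows that the condition that defines the comultiplication can be satisfied.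
\<close>

lemma comult_A:
  assumes a: "a \<in> vcarrier A"
  shows "comult A a \<in> tensors A A"
    "\<And>f f'. f \<in> E \<Longrightarrow> f' \<in> E \<Longrightarrow> ev (\<lambda>a. a f) (\<lambda>a. a f') (comult A a) = a (f' \<circ> f)"
proof -
  obtain J e where J: "finite J" "J \<subseteq> E" and "\<forall>b. e b \<in> vcarrier A"
    "\<forall>\<phi> f. functional end_space \<phi> \<longrightarrow> f \<in> E \<longrightarrow> \<phi> f = (\<Sum>b\<in>J. e b f * \<phi> b)"
    "\<forall>f x. f \<in> E \<longrightarrow> f x = (\<Sum>b\<in>J. vscale M (e b f) (b x))"
    using dual_basis by (elim exE conjE)
  note e = this(3)[rule_format] and exp = this(4)[rule_format] and exp' = this(5)[rule_format]
  let ?P = "\<lambda>t. t \<in> tensors A A \<and>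
    (\<forall>f\<in>E. \<forall>f'\<in>E. ev (\<lambda>a. a f) (\<lambda>a. a f') t = a (f' \<circ> f))"
  define t where "t = (\<Sum>b\<in>J. \<Sum>b'\<in>J. fscale (a (b' \<circ> b)) (pure (e b, e b')))"
  have "Poly_Mapping.keys t \<subseteq> vcarrier A \<times> vcarrier A"
    unfolding t_def by (rule order_trans[OF keys_sum] UN_least)+ (use e in \<open>auto split: if_splits\<close>)
  moreover have "ev (\<lambda>a. a f) (\<lambda>a. a f') t = a (f' \<circ> f)" if f: "f \<in> E" "f' \<in> E" for f f'
  proof -
    have "a (f' \<circ> f) = (\<Sum>b\<in>J. e b f * a (f' \<circ> b))"
      by (rule exp[OF functional_comp_left[OF a f(2)] f(1)])
    also have "\<dots> = (\<Sum>b\<in>J. e b f * (\<Sum>b'\<in>J. e b' f' * a (b' \<circ> b)))"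
      by (rule sum.cong[OF refl], subst exp[OF functional_comp_right[OF a]]) (use J f in auto)
    finally show ?thesis by (simp add: t_def sum_distrib_left mult_ac)
  qed
  ultimately have "?P t" by (simp add: tensors_def)
  then have "?P (SOME t. ?P t)" by (rule someI)
  moreover have "tensors (end_dual_space C M) (end_dual_space C M) = tensors A A"
    by (simp add: tensors_def)
  then have "comult A a = (SOME t. ?P t)"
    unfolding end_dual_def ev_def by simp
  ultimately have "?P (comult A a)" by simp
  then show "comult A a \<in> tensors A A"
    "\<And>f f'. f \<in> E \<Longrightarrow> f' \<in> E \<Longrightarrow> ev (\<lambda>a. a f) (\<lambda>a. a f') (comult A a) = a (f' \<circ> f)" by auto
qed

text \<open>
  The defining condition of the left coaction is satisfied by \<open>\<Sum> e\<^sub>b \<otimes> b(m)\<close>.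
\<close>

lemma end_coact_A:
  assumes m: "m \<in> vcarrier M"
  shows "end_coact C M m \<in> tensors A M"
    "\<And>f \<psi>. f \<in> E \<Longrightarrow> functional M \<psi> \<Longrightarrow> ev (\<lambda>a. a f) \<psi> (end_coact C M m) = \<psi> (f m)"
proof -
  obtain J e where J: "finite J" "J \<subseteq> E" and "\<forall>b. e b \<in> vcarrier A"
    "\<forall>\<phi> f. functional end_space \<phi> \<longrightarrow> f \<in> E \<longrightarrow> \<phi> f = (\<Sum>b\<in>J. e b f * \<phi> b)"
    "\<forall>f x. f \<in> E \<longrightarrow> f x = (\<Sum>b\<in>J. vscale M (e b f) (b x))"
    using dual_basis by (elim exE conjE)
  note e = this(3)[rule_format] and exp = this(4)[rule_format] and exp' = this(5)[rule_format]
  interpret vector_space "vscale M" by (rule vspace_vector_space[OF V])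
  let ?P = "\<lambda>t. t \<in> tensors A M \<and>
    (\<forall>f\<in>E. lin_ext (vscale M) (\<lambda>(a, m0). vscale M (a f) m0) t = f m)"
  define t where "t = (\<Sum>b\<in>J. pure (e b, b m) :: _ \<Rightarrow>\<^sub>0 'k)"
  have "Poly_Mapping.keys t \<subseteq> vcarrier A \<times> vcarrier M"
    unfolding t_def by (rule order_trans[OF keys_sum_pure[OF J(1)]]) (use e J E_closed in auto)
  moreover have "lin_ext (vscale M) (\<lambda>(a, m0). vscale M (a f) m0) t = f m" if "f \<in> E" for f
    unfolding t_def lin_ext_sum using exp'[OF that, of m] by simp
  ultimately have "?P t" by (simp add: tensors_def)
  then have "?P (SOME t. ?P t)" by (rule someI)
  then have P: "?P (end_coact C M m)" by (simp add: end_coact_def)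
  then show "end_coact C M m \<in> tensors A M" by blast
  show "ev (\<lambda>a. a f) \<psi> (end_coact C M m) = \<psi> (f m)" if "f \<in> E" "functional M \<psi>" for f \<psi>
  proof -
    have "f m = lslice (vscale M) (\<lambda>a. a f) (end_coact C M m)"
      using P that by (simp add: lslice_def)
    moreover have "\<psi> (lslice (vscale M) (\<lambda>a. a f) (end_coact C M m)) = ev (\<lambda>a. a f) \<psi> (end_coact C M m)"
      by (rule functional_lslice[OF V that(2)]) (use P in \<open>auto simp: tensors_def\<close>)
    ultimately show ?thesis by simp
  qed
qed

text \<open>
  Finite-dimensional biduality, with \<open>f = \<Sum> \<Phi>(e\<^sub>b) b\<close>.
\<close>

lemma functional_A_is_evaluation:
  assumes \<Phi>: "functional A \<Phi>"
  obtains f where "f \<in> E" "\<And>a. a \<in> vcarrier A \<Longrightarrow> \<Phi> a = a f"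
proof -
  note vE = vspace_end_space
  obtain J e where J: "finite J" "J \<subseteq> E" and "\<forall>b. e b \<in> vcarrier A"
    "\<forall>\<phi> f. functional end_space \<phi> \<longrightarrow> f \<in> E \<longrightarrow> \<phi> f = (\<Sum>b\<in>J. e b f * \<phi> b)"
    "\<forall>f x. f \<in> E \<longrightarrow> f x = (\<Sum>b\<in>J. vscale M (e b f) (b x))"
    using dual_basis by (elim exE conjE)
  note e = this(3)[rule_format] and exp = this(4)[rule_format] and exp' = this(5)[rule_format]
  define f where "f = (\<Sum>b\<in>J. vscale end_space (\<Phi> (e b)) b)"
  have "f \<in> vcarrier end_space"
    unfolding f_def by (intro vspace_sum[OF vE] vspace_scale[OF vE]) (use J in auto)
  moreover have "\<Phi> a = a f" if a: "a \<in> vcarrier A" for a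
  proof -
    have ap: "(\<Sum>i\<in>I. h i) x = (\<Sum>i\<in>I. h i x)" for I :: "('m \<Rightarrow> 'm) set" and h :: "_ \<Rightarrow> ('m \<Rightarrow> 'm) \<Rightarrow> 'k" and x
      by (induction I rule: infinite_finite_induct) auto
    have "a h = (\<Sum>b\<in>J. vscale A (a b) (e b)) h" for h
    proof (cases "h \<in> E")
      case True
      then show ?thesis using exp[OF A_functional[OF a] True] by (simp add: ap mult.commute)
    next
      case False
      then show ?thesis using A_outside[OF a] A_outside[OF e] by (simp add: ap)
    qed
    then have "\<Phi> a = \<Phi> (\<Sum>b\<in>J. vscale A (a b) (e b))" by (metis ext)
    also have "\<dots> = (\<Sum>b\<in>J. \<Phi> (vscale A (a b) (e b)))"
      by (rule linear_map_sum[OF vspace_A \<Phi>]) (rule vspace_scale[OF vspace_A e])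
    also have "\<dots> = (\<Sum>b\<in>J. a b * \<Phi> (e b))" by (simp only: functional_scale[OF \<Phi> e])
    also have "\<dots> = (\<Sum>b\<in>J. a (vscale end_space (\<Phi> (e b)) b))"
      by (rule sum.cong[OF refl]) (use J A_scale[OF a] in auto)
    also have "\<dots> = a f"
      unfolding f_def
      by (rule linear_map_sum[OF vE A_functional[OF a], symmetric]) (use J E_scale in auto)
    finally show ?thesis .
  qed
  ultimately show thesis using that by simp
qed

text \<open>
  The grouplike element \<open>g\<^sub>M\<close> of \<open>A\<^sub>M\<close>.
\<close>

definition character :: "('m \<Rightarrow> 'm) \<Rightarrow> 'k" where
  "character f = (if f \<in> E then residue f else 0)"

lemma character_A: "character \<in> vcarrier A"
proof -
  have "(\<lambda>f. if f \<in> E then residue f else 0) \<in> vcarrier A"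
  proof (rule A_restrict)
    fix f h r assume f: "f \<in> E"
    show "residue (\<lambda>x. vscale M r (f x)) = r * residue f"
      using f by (intro residue_eqI has_eigenvalue_scale residue comod_hom_self_scale[OF pre] E_endo)
    assume h: "h \<in> E"
    show "residue (\<lambda>x. f x + h x) = residue f + residue h"
      using f h by (intro residue_eqI has_eigenvalue_add residue comod_hom_self_add[OF pre] E_endo)
  qed
  then show ?thesis by (simp add: character_def[abs_def])
qed

lemma residue_one: "residue (end_one M) = 1"
proof (rule residue_eqI[OF E_endo[OF E_one]])
  obtain v where "v \<in> vcarrier M" "v \<noteq> 0" using nonzero vspace_zero[OF V] by blast
  then show "has_eigenvalue M (end_one M) 1"
    by (auto simp: has_eigenvalue_def end_one_def vspace_scale_simps[OF V])
qed

lemma residue_comp: "f \<in> E \<Longrightarrow> h \<in> E \<Longrightarrow> residue (h \<circ> f) = residue f * residue h"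
  by (rule residue_eqI[OF E_endo[OF E_comp]])
     (use has_eigenvalue_comp[OF E_endo residue[OF E_endo] E_endo residue[OF E_endo], of f h] in \<open>auto simp: comp_def\<close>)

lemma grouplike_character: "grouplike A character"
proof (rule grouplikeI[OF vspace_A comult_A(1)[OF character_A] character_A])
  show "counit A character = 1" using E_one residue_one by (simp add: character_def)
  fix \<Phi> \<Psi> assume \<Phi>: "functional A \<Phi>" and \<Psi>: "functional A \<Psi>"
  obtain f where f: "f \<in> E" "\<And>a. a \<in> vcarrier A \<Longrightarrow> \<Phi> a = a f" using functional_A_is_evaluation[OF \<Phi>] by blast
  obtain h where h: "h \<in> E" "\<And>a. a \<in> vcarrier A \<Longrightarrow> \<Psi> a = a h" using functional_A_is_evaluation[OF \<Psi>] by blast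
  have "ev \<Phi> \<Psi> (comult A character) = ev (\<lambda>a. a f) (\<lambda>a. a h) (comult A character)"
    by (rule ev_cong) (use f h comult_A(1)[OF character_A] in \<open>auto simp: tensors_def\<close>)
  also have "\<dots> = residue f * residue h"
    using comult_A(2)[OF character_A f(1) h(1)] E_comp[OF f(1) h(1)] residue_comp[OF f(1) h(1)]
    by (simp add: character_def)
  finally show "ev \<Phi> \<Psi> (comult A character) = \<Phi> character * \<Psi> character"
    using f h character_A by (simp add: character_def)
qed

text \<open>
  The decomposition of \<open>End(M)\<close> into its radical and the scalars.
\<close>

lemma endo_decompose:
  assumes f: "f \<in> E"
  obtains n where "n \<in> E" "residue n = 0" "f = (\<lambda>x. n x + vscale M (residue f) (end_one M x))"
proof -
  let ?n = "\<lambda>x. f x + vscale M (- residue f) (end_one M x)"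
  have n: "?n \<in> E" by (rule E_add[OF f E_scale[OF E_one]])
  have "has_eigenvalue M ?n 0"
    using has_eigenvalue_add[OF E_endo[OF f] residue[OF E_endo[OF f]] E_endo[OF E_scale[OF E_one]]
        has_eigenvalue_scale[OF residue[OF E_endo[OF E_one]]], of "- residue f"]
    by (simp add: residue_one)
  then have "residue ?n = 0" by (rule residue_eqI[OF E_endo[OF n]])
  then show thesis using that[OF n] by (simp add: vspace_scale_simps[OF V])
qed

lemma A_apply_decompose:
  assumes "a \<in> vcarrier A" "n \<in> E" "f = (\<lambda>x. n x + vscale M r (end_one M x))"
  shows "a f = a n + r * a (end_one M)"
  unfolding assms(3)
  using A_add[OF assms(1,2) E_scale[OF E_one], of r] A_scale[OF assms(1) E_one, of r] by simp

text \<open>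
  A grouplike element is a multiplicative functional; it kills nilpotent endomorphisms and is
  therefore the character.
\<close>

lemma the_grouplike_A: "the_grouplike A = character"
proof -
  have "a = character" if gl: "grouplike A a" for a
  proof -
    have a: "a \<in> vcarrier A" and a1: "a (end_one M) = 1"
using gl by (auto simp: grouplike_def)
    have mult: "a (h \<circ> f) = a f * a h" if "f \<in> E" "h \<in> E" for f h
      using ev_grouplike[OF gl functional_eval functional_eval, of f h] comult_A(2)[OF a that] by simp
    have nil: "a n = 0" if n: "n \<in> E" "residue n = 0" for n
    proof -
      obtain N where N: "\<forall>x\<in>vcarrier M. (n ^^ N) x = 0"
        using eigenvalue_0_nilpotent[OF E_endo[OF n(1)]] residue[OF E_endo[OF n(1)]] n(2) by auto
      \<comment> \<open>The powers of \<open>n\<close> in \<open>End(M)\<close>, including the identity as power \<open>0\<close>.\<close>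
      let ?p = "\<lambda>i x. if x \<in> vcarrier M then (n ^^ i) x else 0"
      have p: "?p i \<in> E" for i by (rule E_restrict[OF comod_hom_self_funpow[OF pre E_endo[OF n(1)]]])
      have "a (?p i) = a n ^ i" for i
      proof (induction i)
        case 0
        have "?p 0 = end_one M" by (auto simp: end_one_def)
        then show ?case using a1 by simp
      next
        case (Suc i)
        have "?p (Suc i) = n \<circ> ?p i"
          using linear_map_zero[OF V E_linear[OF n(1)]] by auto
        then have "a (?p (Suc i)) = a (?p i) * a n" using mult[OF p[of i] n(1)] by metis
        then show ?case using Suc by simp
      qed
      then have "a (?p N) = a n ^ N" .
      moreover have "?p N = (\<lambda>x. vscale M 0 (end_one M x))" using N by (auto simp: vspace_scale_simps[OF V])
      then have "a (?p N) = 0" using A_scale[OF a E_one, of 0] by simp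
      ultimately have "a n ^ N = 0" by simp
      then show ?thesis by simp
    qed
    show ?thesis
    proof
      fix f
      show "a f = character f"
      proof (cases "f \<in> E")
        case True
        obtain n where n: "n \<in> E" "residue n = 0" "f = (\<lambda>x. n x + vscale M (residue f) (end_one M x))"
          using endo_decompose[OF True] .
        show ?thesis using A_apply_decompose[OF a n(1,3)] nil[OF n(1,2)] a1 True by (simp add: character_def)
      qed (simp add: A_outside[OF a] character_def)
    qed
  qed
  then show ?thesis using grouplike_character unfolding the_grouplike_def by blast
qed

text \<open>
  The right slice of the comultiplication of \<open>a\<close> with the evaluation at \<open>h\<close>.
\<close>

definition twist :: "('m \<Rightarrow> 'm) \<Rightarrow> (('m \<Rightarrow> 'm) \<Rightarrow> 'k) \<Rightarrow> ('m \<Rightarrow> 'm) \<Rightarrow> 'k" where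
  "twist h a f = (if f \<in> E then a (h \<circ> f) else 0)"

lemma twist_A:
  assumes "a \<in> vcarrier A" "h \<in> E" shows "twist h a \<in> vcarrier A"
proof -
  have "functional end_space (\<lambda>f. a (h \<circ> f))" by (rule functional_comp_left[OF assms])
  then have "functional end_space (twist h a)"
    by (rule linear_map_cong[OF vspace_end_space]) (simp add: twist_def)
  then show ?thesis by (simp add: A_iff twist_def)
qed

text \<open>
  Otherwise, by biduality, there is an endomorphism \<open>f\<close> with residue \<open>1\<close> at which all elements of \<open>W\<close> vanish.
  Such an \<open>f\<close> is invertible, so stability under twisting makes the elements of \<open>W\<close> vanish at every
  endomorphism.
\<close>

lemma character_in_twist_stable:
  assumes W: "module.subspace (vscale A) W" "W \<subseteq> vcarrier A" "W \<noteq> {0}"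
    and stable: "\<And>a h. a \<in> W \<Longrightarrow> h \<in> E \<Longrightarrow> twist h a \<in> W"
  shows "character \<in> W"
proof (rule ccontr)
  assume "character \<notin> W"
  then obtain \<Phi> where \<Phi>: "functional A \<Phi>" "\<forall>a\<in>W. \<Phi> a = 0" "\<Phi> character = 1"
    using functional_separates[OF vspace_A W(1)] by blast
  obtain f where f: "f \<in> E" "\<And>a. a \<in> vcarrier A \<Longrightarrow> \<Phi> a = a f"
    using functional_A_is_evaluation[OF \<Phi>(1)] by blast
  have "residue f = 1" using f \<Phi>(3) character_A by (simp add: character_def)
  then have "bij_betw f (vcarrier M) (vcarrier M)"
    using bij_if_eigenvalue_nonzero[OF E_endo[OF f(1)] residue[OF E_endo[OF f(1)]]] by simp
  then obtain k where k: "endo k" "\<And>x. x \<in> vcarrier M \<Longrightarrow> k (f x) = x"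
    using endo_inverse[OF E_endo[OF f(1)]] by blast
  \<comment> \<open>The inverse of \<open>f\<close>, extended by \<open>0\<close> as the elements of \<open>End(M)\<close> are.\<close>
  define k' where "k' x = (if x \<in> vcarrier M then k x else 0)" for x
  have k': "k' \<in> E" unfolding k'_def[abs_def] by (rule E_restrict[OF k(1)])
  have "a = 0" if a: "a \<in> W" for a
  proof
    fix h
    show "a h = 0 h"
    proof (cases "h \<in> E")
      case True
      have hk: "h \<circ> k' \<in> E" by (rule E_comp[OF k' True])
      have "(h \<circ> k') \<circ> f = h"
      proof
        fix x
        show "((h \<circ> k') \<circ> f) x = h x"
        proof (cases "x \<in> vcarrier M")
          case True
          then show ?thesis using E_closed[OF f(1), of x] k(2) by (simp add: k'_def)
        next
          case False
          then show ?thesis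
            using E_outside[OF f(1)] E_outside[OF True] linear_map_zero[OF V E_linear[OF k']] linear_map_zero[OF V E_linear[OF True]]
            by simp
        qed
      qed
      moreover have "twist (h \<circ> k') a f = 0"
        using \<Phi>(2) f(2) stable[OF a hk] W(2) by (metis subsetD)
      ultimately show ?thesis using f(1) by (simp add: twist_def)
    next
      case False
      then show ?thesis using A_outside a W(2) by auto
    qed
  qed
  moreover have "0 \<in> W" using module.subspace_0[OF vspace_module[OF vspace_A] W(1)] .
  ultimately show False using W(3) by blast
qed

lemma ev_comult_twist:
  assumes a: "a \<in> vcarrier A" and n: "n \<in> E" and \<Phi>: "functional A \<Phi>"
  shows "ev \<Phi> (\<lambda>b. b n) (comult A a) = \<Phi> (twist n a)"
proof -
  obtain f where f: "f \<in> E" "\<And>a. a \<in> vcarrier A \<Longrightarrow> \<Phi> a = a f"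
    using functional_A_is_evaluation[OF \<Phi>] by blast
  have "ev \<Phi> (\<lambda>b. b n) (comult A a) = ev (\<lambda>b. b f) (\<lambda>b. b n) (comult A a)"
    by (rule ev_cong) (use f comult_A(1)[OF a] in \<open>auto simp: tensors_def\<close>)
  also have "\<dots> = twist n a f" using comult_A(2)[OF a f(1) n] f(1) by (simp add: twist_def)
  finally show ?thesis using f(2)[OF twist_A[OF a n]] by simp
qed

text \<open>
  The slice of the left coaction of \<open>m\<close> with \<open>\<psi>\<close>.
\<close>

definition coefficient :: "('m \<Rightarrow> 'k) \<Rightarrow> 'm \<Rightarrow> ('m \<Rightarrow> 'm) \<Rightarrow> 'k" where
  "coefficient \<psi> m f = (if f \<in> E then \<psi> (f m) else 0)"

lemma coefficient_A:
  assumes \<psi>: "functional M \<psi>"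
  shows "coefficient \<psi> m \<in> vcarrier A"
proof -
  have "(\<lambda>f. if f \<in> E then \<psi> (f m) else 0) \<in> vcarrier A"
    by (rule A_restrict) (auto simp: linear_map_add[OF \<psi>] functional_scale[OF \<psi>] E_closed)
  then show ?thesis by (simp add: coefficient_def[abs_def])
qed

lemma ev_end_coact_coefficient:
  assumes m: "m \<in> vcarrier M" and \<psi>: "functional M \<psi>" and \<Phi>: "functional A \<Phi>"
  shows "ev \<Phi> \<psi> (end_coact C M m) = \<Phi> (coefficient \<psi> m)"
proof -
  obtain f where f: "f \<in> E" "\<And>a. a \<in> vcarrier A \<Longrightarrow> \<Phi> a = a f"
    using functional_A_is_evaluation[OF \<Phi>] by blast
  have "ev \<Phi> \<psi> (end_coact C M m) = ev (\<lambda>b. b f) \<psi> (end_coact C M m)"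
    by (rule ev_cong) (use f end_coact_A(1)[OF m] in \<open>auto simp: tensors_def\<close>)
  also have "\<dots> = coefficient \<psi> m f" using end_coact_A(2)[OF m f(1) \<psi>] f(1) by (simp add: coefficient_def)
  finally show ?thesis using f(2)[OF coefficient_A[OF \<psi>]] by simp
qed

lemma A_multiple_of_character:
  assumes a: "a \<in> vcarrier A" and 0: "\<And>n. n \<in> E \<Longrightarrow> residue n = 0 \<Longrightarrow> a n = 0"
  shows "a = vscale A (a (end_one M)) character"
proof
  fix f
  show "a f = vscale A (a (end_one M)) character f"
  proof (cases "f \<in> E")
    case True
    obtain n where n: "n \<in> E" "residue n = 0" "f = (\<lambda>x. n x + vscale M (residue f) (end_one M x))"
      using endo_decompose[OF True] .
    show ?thesis using A_apply_decompose[OF a n(1,3)] 0[OF n(1,2)] True by (simp add: character_def)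
  qed (simp add: A_outside[OF a] character_def)
qed

lemma twist_decompose:
  assumes a: "a \<in> vcarrier A" and h: "h \<in> E" and n: "n \<in> E" "h = (\<lambda>x. n x + vscale M r (end_one M x))"
  shows "twist h a = twist n a + vscale A r a"
proof
  fix f
  show "twist h a f = (twist n a + vscale A r a) f"
  proof (cases "f \<in> E")
    case True
    have "h \<circ> f = (\<lambda>x. (n \<circ> f) x + vscale M r (f x))"
      using E_closed[OF True] by (simp add: n(2) comp_def end_one_def)
    then show ?thesis
      using A_add[OF a E_comp[OF True n(1)] E_scale[OF True]] A_scale[OF a True] True
      by (simp add: twist_def)
  qed (simp add: A_outside[OF a] twist_def)
qed

lemma twist_one_neq_0: "n \<in> E \<Longrightarrow> a n \<noteq> 0 \<Longrightarrow> twist n a \<noteq> 0"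
proof
  assume n: "n \<in> E" "a n \<noteq> 0" "twist n a = 0"
  have "n \<circ> end_one M = n"
    using E_outside[OF n(1)] linear_map_zero[OF V E_linear[OF n(1)]] by (auto simp: end_one_def)
  then have "twist n a (end_one M) = a n" using E_one by (simp add: twist_def)
  then show False using n by simp
qed

end

section \<open>Subcoalgebras as coalgebras in their own right\<close>

text \<open>
  The comultiplications of \<open>C\<close> and \<open>D\<close> choose representatives independently of each other, so they are
  compared as tensors over \<open>D\<close>.
\<close>

definition coalgebra_extension ::
  "('k::field, 'c::ab_group_add) coalg \<Rightarrow> ('k, 'c) coalg \<Rightarrow> bool" where
  "coalgebra_extension C D \<longleftrightarrow> coalgebra C \<and> coalgebra D \<and> vcarrier C \<subseteq> vcarrier D \<and> vscale C = vscale D \<and>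
    (\<forall>c\<in>vcarrier C. tensor_eq D D (comult D c) (comult C c) \<and> counit D c = counit C c)"

context
  fixes C D :: "('k::field, 'c::ab_group_add) coalg"
  assumes ext: "coalgebra_extension C D"
begin

lemma extension_coalgebras: "coalgebra C" "coalgebra D"
  and extension_subset: "vcarrier C \<subseteq> vcarrier D"
  and extension_scale: "vscale C = vscale D"
  using ext by (auto simp: coalgebra_extension_def)

lemma extension_functional: "functional D \<phi> \<Longrightarrow> functional C \<phi>"
  by (rule functional_mono[OF _ extension_subset extension_scale])

lemma extension_functional_extend:
  assumes "functional C \<psi>"
  obtains \<psi>' where "functional D \<psi>'" "\<And>c. c \<in> vcarrier C \<Longrightarrow> \<psi>' c = \<psi> c"
proof -
  obtain \<psi>' where "functional (C\<lparr>vcarrier := UNIV\<rparr>) \<psi>'" "\<forall>c\<in>vcarrier C. \<psi>' c = \<psi> c"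
    using functional_extend[OF coalgebra_vspace[OF extension_coalgebras(1)] assms] by blast
  then show thesis
    using that functional_mono[of "C\<lparr>vcarrier := UNIV\<rparr>" \<psi>' D] extension_scale by simp
qed

lemma extension_ev:
  assumes "functional D \<phi>" "functional D \<psi>" "c \<in> vcarrier C"
  shows "ev \<phi> \<psi> (comult D c) = ev \<phi> \<psi> (comult C c)"
  using ext assms tensor_eq_imp_ev[of D D "comult D c" "comult C c"] by (auto simp: coalgebra_extension_def)

text \<open>
  A slice in \<open>D\<close> of an element of \<open>C\<close> depends only on the values of the functional on \<open>C\<close>, where the
  comultiplication has a representative.
\<close>

lemma extension_act:
  assumes \<psi>: "functional D \<psi>" and c: "c \<in> vcarrier C" and eq: "\<And>c. c \<in> vcarrier C \<Longrightarrow> \<psi> c = \<chi> c"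
  shows "act (regular_comod D) \<psi> c = act (regular_comod C) \<chi> c" "lact D \<psi> c = lact C \<chi> c"
proof -
  note CD = extension_coalgebras
  have cD: "c \<in> vcarrier D" using c extension_subset by blast
  have k: "Poly_Mapping.keys (comult C c) \<subseteq> vcarrier C \<times> vcarrier C"
    using comult_tensors[OF CD(1) c] by (simp add: tensors_def)
  show "act (regular_comod D) \<psi> c = act (regular_comod C) \<chi> c"
  proof (rule functional_eqI[OF coalgebra_vspace[OF CD(2)]])
    show "act (regular_comod D) \<psi> c \<in> vcarrier D" "act (regular_comod C) \<chi> c \<in> vcarrier D"
      using act_closed[OF precomodule_regular[OF CD(2)], of c \<psi>] act_closed[OF precomodule_regular[OF CD(1)], of c \<chi>]
        c cD extension_subset by auto
    fix \<phi> assume \<phi>: "functional D \<phi>"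
    have "ev \<phi> \<psi> (comult C c) = ev \<phi> \<chi> (comult C c)" by (rule ev_cong) (use k eq in auto)
    then show "\<phi> (act (regular_comod D) \<psi> c) = \<phi> (act (regular_comod C) \<chi> c)"
      using extension_ev[OF \<phi> \<psi> c] c cD extension_functional[OF \<phi>] \<phi>
      by (simp add: functional_act_regular CD)
  qed
  show "lact D \<psi> c = lact C \<chi> c"
  proof (rule functional_eqI[OF coalgebra_vspace[OF CD(2)]])
    show "lact D \<psi> c \<in> vcarrier D" "lact C \<chi> c \<in> vcarrier D"
      using lact_closed[OF CD(2) cD] lact_closed[OF CD(1) c] extension_subset by auto
    fix \<phi> assume \<phi>: "functional D \<phi>"
    have "ev \<psi> \<phi> (comult C c) = ev \<chi> \<phi> (comult C c)" by (rule ev_cong) (use k eq in auto)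
    then show "\<phi> (lact D \<psi> c) = \<phi> (lact C \<chi> c)"
      using extension_ev[OF \<psi> \<phi> c] c cD extension_functional[OF \<phi>] \<phi>
      by (simp add: functional_lact CD)
  qed
qed

lemma extension_subcoalgebra_Int:
  assumes E: "subcoalgebra D E"
  shows "subcoalgebra C (E \<inter> vcarrier C)"
proof -
  note CD = extension_coalgebras
  have sub: "module.subspace (vscale D) E"
    and st: "\<And>\<psi> e. functional D \<psi> \<Longrightarrow> e \<in> E \<Longrightarrow> act (regular_comod D) \<psi> e \<in> E"
      "\<And>\<psi> e. functional D \<psi> \<Longrightarrow> e \<in> E \<Longrightarrow> lact D \<psi> e \<in> E"
    using E unfolding subcoalgebra_iff[OF CD(2)] by auto
  have "act (regular_comod C) \<psi> e \<in> E \<inter> vcarrier C \<and> lact C \<psi> e \<in> E \<inter> vcarrier C"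
    if \<psi>: "functional C \<psi>" and e: "e \<in> E" "e \<in> vcarrier C" for \<psi> e
  proof -
    obtain \<psi>' where \<psi>': "functional D \<psi>'" "\<And>c. c \<in> vcarrier C \<Longrightarrow> \<psi>' c = \<psi> c"
      using extension_functional_extend[OF \<psi>] by blast
    show ?thesis
      using extension_act[OF \<psi>'(1) e(2), of \<psi>] \<psi>'(2) st[OF \<psi>'(1) e(1)] act_closed[OF precomodule_regular[OF CD(1)], of e \<psi>]
        lact_closed[OF CD(1) e(2), of \<psi>] e(2) by simp
  qed
  moreover have "module.subspace (vscale C) (E \<inter> vcarrier C)"
    using module.subspace_inter[OF vspace_module[OF coalgebra_vspace[OF CD(1)]] _ vspace_subspace[OF coalgebra_vspace[OF CD(1)]]]
      sub extension_scale by simp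
  ultimately show ?thesis unfolding subcoalgebra_iff[OF CD(1)] by auto
qed

lemma extension_grouplike:
  assumes g: "grouplike C g"
  shows "grouplike D g"
proof (rule grouplikeI)
  note CD = extension_coalgebras
  have gC: "g \<in> vcarrier C" using g by (simp add: grouplike_def)
  show gD: "g \<in> vcarrier D" using gC extension_subset by blast
  show "vspace D" "comult D g \<in> tensors D D"
    by (rule coalgebra_vspace[OF CD(2)] comult_tensors[OF CD(2) gD])+
  show "counit D g = 1" using ext g by (simp add: coalgebra_extension_def grouplike_def)
  show "ev \<phi> \<psi> (comult D g) = \<phi> g * \<psi> g" if "functional D \<phi>" "functional D \<psi>" for \<phi> \<psi>
    using extension_ev[OF that gC] ev_grouplike[OF g extension_functional[OF that(1)] extension_functional[OF that(2)]] by simp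
qed

end

section \<open>The coalgebra \<open>C\<^sup>\<or>\<close>\<close>

lemma lookup_map_zero:
  "f 0 = 0 \<Longrightarrow> Poly_Mapping.lookup (Poly_Mapping.map f p) x = f (Poly_Mapping.lookup p x)"
  by (simp add: Poly_Mapping.map.rep_eq when_def)

locale vee =
  fixes C D :: "('k::alg_closed_field, 'c::ab_group_add) coalg" and L :: "('k, 'c) fdcomod set"
    and \<pi> :: "('k, 'c) tilde \<Rightarrow> 'c" and g :: 'c
  assumes conn: "connected_at C g" and D: "coalgebra D" and scale: "vscale D = vscale C"
    and L: "is_representative_set C L" and hom: "coalg_hom (tilde C L) D \<pi>"
    and surj: "\<pi> ` vcarrier (tilde C L) = vcarrier D"
    and ker: "{x \<in> vcarrier (tilde C L). \<pi> x = 0} = tilde_coideal C L"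
    and \<pi>_C: "\<And>c. c \<in> vcarrier C \<Longrightarrow> \<pi> (in_C c) = c"
begin

abbreviation T :: "('k, ('k, 'c) tilde) coalg" where "T \<equiv> tilde C L"
abbreviation A :: "('k, 'c) fdcomod \<Rightarrow> ('k, ((nat \<Rightarrow>\<^sub>0 'k) \<Rightarrow> (nat \<Rightarrow>\<^sub>0 'k)) \<Rightarrow> 'k) coalg" where
  "A M \<equiv> end_dual C M"
abbreviation chi :: "('k, 'c) fdcomod \<Rightarrow> ((nat \<Rightarrow>\<^sub>0 'k) \<Rightarrow> (nat \<Rightarrow>\<^sub>0 'k)) \<Rightarrow> 'k" where
  "chi M \<equiv> fd_indecomposable_comodule.character C M"

lemma C: "coalgebra C" using conn by (simp add: connected_at_def)
lemma VC: "vspace C" by (rule coalgebra_vspace[OF C])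
lemma VD: "vspace D" by (rule coalgebra_vspace[OF D])
lemma g: "grouplike C g" "g \<in> vcarrier C" using conn by (auto simp: connected_at_def grouplike_def)

lemma L_indecomposable: "M \<in> L \<Longrightarrow> fd_indecomposable_comodule C M"
  using L C unfolding is_representative_set_def fd_indecomposable_def fd_indecomposable_comodule_def by auto

lemma L_scale: "M \<in> L \<Longrightarrow> vscale M = fscale"
  using L unfolding is_representative_set_def fd_indecomposable_def by auto

lemma VM: "M \<in> L \<Longrightarrow> vspace M"
  by (rule fd_indecomposable_comodule.V[OF L_indecomposable])

lemma VA: "M \<in> L \<Longrightarrow> vspace (A M)"
  by (rule fd_indecomposable_comodule.vspace_A[OF L_indecomposable])

lemma scale_A: "vscale (A M) = (\<lambda>r a f. r * a f)"
  by (simp add: end_dual_def end_dual_space_def)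

lemma chi_A: "M \<in> L \<Longrightarrow> chi M \<in> vcarrier (A M)"
  by (rule fd_indecomposable_comodule.character_A[OF L_indecomposable])

lemma T_carrier: "(\<alpha>, \<mu>, c) \<in> vcarrier T \<longleftrightarrow>
    Poly_Mapping.keys \<alpha> \<subseteq> L \<and> (\<forall>M\<in>L. Poly_Mapping.lookup \<alpha> M \<in> vcarrier (A M)) \<and>
    Poly_Mapping.keys \<mu> \<subseteq> L \<and> (\<forall>M\<in>L. Poly_Mapping.lookup \<mu> M \<in> vcarrier M) \<and> c \<in> vcarrier C"
  by (simp add: tilde_def)

lemma T_scale: "vscale T r (\<alpha>, \<mu>, c) =
    (Poly_Mapping.map (\<lambda>a f. r * a f) \<alpha>, Poly_Mapping.map (fscale r) \<mu>, vscale C r c)"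
  by (simp add: tilde_def)

lemma lookup_scale [simp]:
  "Poly_Mapping.lookup (Poly_Mapping.map (\<lambda>a f. r * a f) \<alpha>) M = (\<lambda>f. r * Poly_Mapping.lookup \<alpha> M f)"
  "Poly_Mapping.lookup (Poly_Mapping.map (fscale r) \<mu>) M = fscale r (Poly_Mapping.lookup \<mu> M)"
  for \<alpha> :: "'i \<Rightarrow>\<^sub>0 ('j \<Rightarrow> 'k)" and \<mu> :: "'i \<Rightarrow>\<^sub>0 (nat \<Rightarrow>\<^sub>0 'k)"
  by (subst lookup_map_zero; simp add: zero_fun_def fun_eq_iff)+

lemma VT: "vspace T"
proof -
  have "vector_space (vscale T)"
  proof
    fix r s x y
    show "vscale T r (x + y) = vscale T r x + vscale T r y"
      by (cases x; cases y) (auto simp: T_scale vspace_scale_simps[OF VC] intro!: poly_mapping_eqI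
          simp: lookup_add lookup_map_zero fun_eq_iff free.scale_right_distrib distrib_left)
    show "vscale T (r + s) x = vscale T r x + vscale T s x"
      by (cases x) (auto simp: T_scale vspace_scale_simps[OF VC] intro!: poly_mapping_eqI
          simp: lookup_add lookup_map_zero fun_eq_iff free.scale_left_distrib distrib_right)
    show "vscale T r (vscale T s x) = vscale T (r * s) x"
      by (cases x) (auto simp: T_scale vspace_scale_simps[OF VC] intro!: poly_mapping_eqI
          simp: lookup_add lookup_map_zero fun_eq_iff mult.assoc)
    show "vscale T 1 x = x"
      by (cases x) (auto simp: T_scale vspace_scale_simps[OF VC] lookup_map_zero intro!: poly_mapping_eqI)
  qed
  then interpret vector_space "vscale T" .
  have "subspace (vcarrier T)"
    unfolding subspace_def
  proof (intro conjI ballI allI)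
    show "0 \<in> vcarrier T"
      by (auto simp: zero_prod_def T_carrier vspace_zero VC VM VA)
    fix x y r assume x: "x \<in> vcarrier T"
    obtain \<alpha> \<mu> c where x': "x = (\<alpha>, \<mu>, c)" by (cases x)
    have "Poly_Mapping.keys (Poly_Mapping.map (\<lambda>a f. r * a f) \<alpha>) \<subseteq> Poly_Mapping.keys \<alpha>"
      "Poly_Mapping.keys (Poly_Mapping.map (fscale r) \<mu>) \<subseteq> Poly_Mapping.keys \<mu>"
      by (auto simp: in_keys_iff fun_eq_iff)
    then show "vscale T r x \<in> vcarrier T"
      using x vspace_scale[OF VA, of _ _ r] vspace_scale[OF VM, of _ _ r]
      by (auto simp: x' T_carrier T_scale vspace_scale[OF VC] scale_A L_scale)
    assume y: "y \<in> vcarrier T"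
    obtain \<alpha>' \<mu>' c' where y': "y = (\<alpha>', \<mu>', c')" by (cases y)
    show "x + y \<in> vcarrier T"
      using x y Poly_Mapping.keys_add[of \<alpha> \<alpha>'] Poly_Mapping.keys_add[of \<mu> \<mu>']
      by (auto simp: x' y' T_carrier vspace_add VC VA VM lookup_add)
  qed
  then show ?thesis by (simp add: vspace_def vector_space_axioms)
qed

lemma linear_in_A: "M \<in> L \<Longrightarrow> linear_map (A M) T (in_A M)"
  by (rule linear_mapI)
    (auto simp: in_A_def T_carrier T_scale scale_A lookup_single when_def single_add vspace_zero VA VM VC
      vspace_scale_simps[OF VC] split: if_splits intro!: poly_mapping_eqI)

lemma linear_in_M: "M \<in> L \<Longrightarrow> linear_map M T (in_M M)"
  by (rule linear_mapI)
    (auto simp: in_M_def T_carrier T_scale L_scale lookup_single when_def single_add vspace_zero VA VM VC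
      vspace_scale_simps[OF VC] split: if_splits intro!: poly_mapping_eqI)

lemma linear_in_C: "linear_map C T in_C"
  by (rule linear_mapI)
    (auto simp: in_C_def T_carrier T_scale vspace_zero VA VM VC intro!: poly_mapping_eqI)

lemma linear_\<pi>: "linear_map T D \<pi>" using hom by (simp add: coalg_hom_def)

lemma generator_in_T:
  "M \<in> L \<Longrightarrow> in_C g - in_A M (chi M) \<in> vcarrier T"
  by (intro vspace_diff[OF VT] linear_map_closed[OF linear_in_C] linear_map_closed[OF linear_in_A] g chi_A)

lemma coideal: "tilde_coideal C L = module.span (vscale T) {in_C g - in_A M (chi M) | M. M \<in> L}"
proof -
  have "the_grouplike (end_dual C M) = chi M" if "M \<in> L" for M
    by (rule fd_indecomposable_comodule.the_grouplike_A[OF L_indecomposable[OF that]])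
  then have "{in_C (the_grouplike C) - in_A M (the_grouplike (end_dual C M)) | M. M \<in> L}
      = {in_C g - in_A M (chi M) | M. M \<in> L}"
    by (simp add: the_grouplike_eq[OF conn] cong: rev_conj_cong)
  then show ?thesis by (simp add: tilde_coideal_def)
qed

lemma \<pi>_chi: "M \<in> L \<Longrightarrow> \<pi> (in_A M (chi M)) = g"
proof -
  assume M: "M \<in> L"
  have "in_C g - in_A M (chi M) \<in> tilde_coideal C L"
    unfolding coideal by (rule module.span_base[OF vspace_module[OF VT]]) (use M in blast)
  then have "\<pi> (in_C g - in_A M (chi M)) = 0" using ker by blast
  then show ?thesis
    using linear_map_diff[OF VT linear_\<pi> linear_map_closed[OF linear_in_C g(2)] linear_map_closed[OF linear_in_A[OF M] chi_A[OF M]]]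
      \<pi>_C[OF g(2)] by simp
qed

text \<open>
  The kernel of \<open>\<pi>\<close> is spanned by the differences \<open>g - g\<^sub>M\<close>, so a linear map on \<open>C\<^sup>\<sim>\<close> descends to \<open>C\<^sup>\<or>\<close> as soon as it
  has the same value at all grouplike elements.
\<close>

lemma factor_through_\<pi>:
  assumes Y: "vspace Y" and F: "linear_map T Y F"
    and gen: "\<And>M. M \<in> L \<Longrightarrow> F (in_A M (chi M)) = F (in_C g)"
  obtains F' where "linear_map D Y F'" "\<And>x. x \<in> vcarrier T \<Longrightarrow> F' (\<pi> x) = F x"
proof -
  have "{in_C g - in_A M (chi M) | M. M \<in> L} \<subseteq> {x \<in> vcarrier T. F x = 0}"
    using gen generator_in_T
      linear_map_diff[OF VT F linear_map_closed[OF linear_in_C g(2)] linear_map_closed[OF linear_in_A chi_A]]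
    by auto
  from module.span_minimal[OF vspace_module[OF VT] this subspace_kernel[OF VT F Y]]
  have F0: "F x = 0" if "x \<in> vcarrier T" "\<pi> x = 0" for x
    using that ker coideal by blast
  have F_eq: "F x = F y" if "x \<in> vcarrier T" "y \<in> vcarrier T" "\<pi> x = \<pi> y" for x y
    using F0[of "x - y"] that linear_map_diff[OF VT F, of x y] linear_map_diff[OF VT linear_\<pi>, of x y]
    by (simp add: vspace_diff[OF VT])
  \<comment> \<open>The value does not depend on the chosen preimage, because \<open>F\<close> vanishes on the kernel of \<open>\<pi>\<close>.\<close>
  define F' where "F' d = F (SOME x. x \<in> vcarrier T \<and> \<pi> x = d)" for d
  have F': "F' (\<pi> x) = F x" if "x \<in> vcarrier T" for x
  proof -
    have "(SOME y. y \<in> vcarrier T \<and> \<pi> y = \<pi> x) \<in> vcarrier T \<and> \<pi> (SOME y. y \<in> vcarrier T \<and> \<pi> y = \<pi> x) = \<pi> x"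
      by (rule someI[of _ x]) (use that in simp)
    then show ?thesis unfolding F'_def using F_eq that by blast
  qed
  have "linear_map D Y F'"
  proof (rule linear_mapI)
    fix a b r assume "a \<in> vcarrier D"
    then obtain x where x: "x \<in> vcarrier T" "a = \<pi> x" using surj by blast
    show "F' a \<in> vcarrier Y" using x F' linear_map_closed[OF F] by simp
    show "F' (vscale D r a) = vscale Y r (F' a)"
      using F'[OF vspace_scale[OF VT x(1)], of r] x F'
      by (simp add: linear_map_scale[OF linear_\<pi>] linear_map_scale[OF F])
    assume "b \<in> vcarrier D"
    then obtain y where y: "y \<in> vcarrier T" "b = \<pi> y" using surj by blast
    show "F' (a + b) = F' a + F' b"
      using F'[OF vspace_add[OF VT x(1) y(1)]] x y F'
      by (simp add: linear_map_add[OF linear_\<pi>] linear_map_add[OF F])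
  qed
  then show thesis using that F' by blast
qed

lemma ev_comult_T:
  "ev \<Phi> \<Psi> (comult T (\<alpha>, \<mu>, c)) =
    (\<Sum>M\<in>Poly_Mapping.keys \<alpha>. ev (\<lambda>a. \<Phi> (in_A M a)) (\<lambda>a. \<Psi> (in_A M a)) (comult (A M) (Poly_Mapping.lookup \<alpha> M))) +
    (\<Sum>M\<in>Poly_Mapping.keys \<mu>.
      ev (\<lambda>a. \<Phi> (in_A M a)) (\<lambda>m. \<Psi> (in_M M m)) (end_coact C M (Poly_Mapping.lookup \<mu> M)) +
      ev (\<lambda>m. \<Phi> (in_M M m)) (\<lambda>c. \<Psi> (in_C c)) (coact M (Poly_Mapping.lookup \<mu> M))) +
    ev (\<lambda>c. \<Phi> (in_C c)) (\<lambda>c. \<Psi> (in_C c)) (comult C c)"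
  by (simp add: tilde_def ev_tmap)

lemma keys_coact_M: "M \<in> L \<Longrightarrow> m \<in> vcarrier M \<Longrightarrow> Poly_Mapping.keys (coact M m) \<subseteq> vcarrier M \<times> vcarrier C"
  using coact_tensors[OF fd_indecomposable_comodule.pre[OF L_indecomposable]] by (auto simp: tensors_def)

lemma keys_comult_C: "c \<in> vcarrier C \<Longrightarrow> Poly_Mapping.keys (comult C c) \<subseteq> vcarrier C \<times> vcarrier C"
  using comult_tensors[OF C] by (simp add: tensors_def)

lemma keys_comult_A: "M \<in> L \<Longrightarrow> a \<in> vcarrier (A M) \<Longrightarrow> Poly_Mapping.keys (comult (A M) a) \<subseteq> vcarrier (A M) \<times> vcarrier (A M)"
  using fd_indecomposable_comodule.comult_A(1)[OF L_indecomposable] by (auto simp: tensors_def)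

lemma keys_end_coact_M: "M \<in> L \<Longrightarrow> m \<in> vcarrier M \<Longrightarrow> Poly_Mapping.keys (end_coact C M m) \<subseteq> vcarrier (A M) \<times> vcarrier M"
  using fd_indecomposable_comodule.end_coact_A(1)[OF L_indecomposable] by (auto simp: tensors_def)

lemma keys_comult_T:
  assumes x: "x \<in> vcarrier T"
  shows "Poly_Mapping.keys (comult T x) \<subseteq> vcarrier T \<times> vcarrier T"
proof -
  obtain \<alpha> \<mu> c where x': "x = (\<alpha>, \<mu>, c)" by (cases x)
  have \<alpha>: "M \<in> L \<and> Poly_Mapping.lookup \<alpha> M \<in> vcarrier (A M)" if "M \<in> Poly_Mapping.keys \<alpha>" for M
    using x that by (auto simp: x' T_carrier)
  have \<mu>: "M \<in> L \<and> Poly_Mapping.lookup \<mu> M \<in> vcarrier M" if "M \<in> Poly_Mapping.keys \<mu>" for M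
    using x that by (auto simp: x' T_carrier)
  have c: "c \<in> vcarrier C" using x by (simp add: x' T_carrier)
  have tm: "Poly_Mapping.keys (tmap f h t) \<subseteq> vcarrier T \<times> vcarrier T"
    if "Poly_Mapping.keys t \<subseteq> P \<times> Q" "\<And>p. p \<in> P \<Longrightarrow> f p \<in> vcarrier T" "\<And>q. q \<in> Q \<Longrightarrow> h q \<in> vcarrier T"
    for f h and t :: "'p \<times> 'q \<Rightarrow>\<^sub>0 'k" and P Q
    using keys_tmap[of f h t] that by fastforce
  have add: "Poly_Mapping.keys (s + t) \<subseteq> S" if "Poly_Mapping.keys s \<subseteq> S" "Poly_Mapping.keys t \<subseteq> S"
    for s t :: "'i \<Rightarrow>\<^sub>0 'k" and S
    using Poly_Mapping.keys_add[of s t] that by blast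
  have "comult T x = (\<Sum>M\<in>Poly_Mapping.keys \<alpha>.
           tmap (in_A M) (in_A M) (comult (end_dual C M) (Poly_Mapping.lookup \<alpha> M))) +
        (\<Sum>M\<in>Poly_Mapping.keys \<mu>.
           tmap (in_A M) (in_M M) (end_coact C M (Poly_Mapping.lookup \<mu> M)) +
           tmap (in_M M) in_C (coact M (Poly_Mapping.lookup \<mu> M))) +
        tmap in_C in_C (comult C c)"
    by (simp add: x' tilde_def)
  also have "Poly_Mapping.keys \<dots> \<subseteq> vcarrier T \<times> vcarrier T"
  proof (intro add keys_sum_subset)
    fix M assume "M \<in> Poly_Mapping.keys \<alpha>"
    with \<alpha> have M: "M \<in> L" "Poly_Mapping.lookup \<alpha> M \<in> vcarrier (A M)" by auto
    show "Poly_Mapping.keys (tmap (in_A M) (in_A M) (comult (end_dual C M) (Poly_Mapping.lookup \<alpha> M))) \<subseteq> vcarrier T \<times> vcarrier T"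
      by (rule tm[OF keys_comult_A[OF M]]) (rule linear_map_closed[OF linear_in_A[OF M(1)]], assumption)+
  next
    fix M assume "M \<in> Poly_Mapping.keys \<mu>"
    with \<mu> have M: "M \<in> L" "Poly_Mapping.lookup \<mu> M \<in> vcarrier M" by auto
    show "Poly_Mapping.keys (tmap (in_A M) (in_M M) (end_coact C M (Poly_Mapping.lookup \<mu> M))) \<subseteq> vcarrier T \<times> vcarrier T"
      by (rule tm[OF keys_end_coact_M[OF M]])
        (rule linear_map_closed[OF linear_in_A[OF M(1)]] linear_map_closed[OF linear_in_M[OF M(1)]], assumption)+
    show "Poly_Mapping.keys (tmap (in_M M) in_C (coact M (Poly_Mapping.lookup \<mu> M))) \<subseteq> vcarrier T \<times> vcarrier T"
      by (rule tm[OF keys_coact_M[OF M]])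
        (rule linear_map_closed[OF linear_in_C] linear_map_closed[OF linear_in_M[OF M(1)]], assumption)+
  next
    show "Poly_Mapping.keys (tmap in_C in_C (comult C c)) \<subseteq> vcarrier T \<times> vcarrier T"
      by (rule tm[OF keys_comult_C[OF c]]) (rule linear_map_closed[OF linear_in_C], assumption)+
  qed
  finally show ?thesis .
qed

text \<open>
  All computations in \<open>C\<^sup>\<or>\<close> are carried out in \<open>C\<^sup>\<sim>\<close>, where the components are available.
\<close>

lemma ev_comult_D:
  assumes x: "x \<in> vcarrier T" and \<phi>: "functional D \<phi>" and \<psi>: "functional D \<psi>"
    and \<Phi>: "\<And>y. y \<in> vcarrier T \<Longrightarrow> \<phi> (\<pi> y) = \<Phi> y" and \<Psi>: "\<And>y. y \<in> vcarrier T \<Longrightarrow> \<psi> (\<pi> y) = \<Psi> y"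
  shows "ev \<phi> \<psi> (comult D (\<pi> x)) = ev \<Phi> \<Psi> (comult T x)"
proof -
  have "tensor_eq D D (comult D (\<pi> x)) (tmap \<pi> \<pi> (comult T x))" using hom x by (simp add: coalg_hom_def)
  from tensor_eq_imp_ev[OF this \<phi> \<psi>]
  have "ev \<phi> \<psi> (comult D (\<pi> x)) = ev (\<lambda>y. \<phi> (\<pi> y)) (\<lambda>y. \<psi> (\<pi> y)) (comult T x)" by (simp add: ev_tmap)
  also have "\<dots> = ev \<Phi> \<Psi> (comult T x)"
    by (rule ev_cong) (use keys_comult_T[OF x] \<Phi> \<Psi> in auto)
  finally show ?thesis .
qed

lemma extension: "coalgebra_extension C D"
proof -
  have 1: "c \<in> vcarrier D" if "c \<in> vcarrier C" for c
    using linear_map_closed[OF linear_\<pi> linear_map_closed[OF linear_in_C that]] \<pi>_C[OF that] by simp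
  have 2: "tensor_eq D D (comult D c) (comult C c)" if c: "c \<in> vcarrier C" for c
  proof -
    have k: "comult C c \<in> tensors D D" using keys_comult_C[OF c] 1 by (auto simp: tensors_def)
    have "ev \<phi> \<psi> (comult D c) = ev \<phi> \<psi> (comult C c)" if "functional D \<phi>" "functional D \<psi>" for \<phi> \<psi>
    proof -
      have "ev \<phi> \<psi> (comult D (\<pi> (in_C c))) = ev (\<lambda>y. \<phi> (\<pi> y)) (\<lambda>y. \<psi> (\<pi> y)) (comult T (in_C c))"
        by (rule ev_comult_D[OF linear_map_closed[OF linear_in_C c] that]) simp_all
      also have "\<dots> = ev (\<lambda>c. \<phi> (\<pi> (in_C c))) (\<lambda>c. \<psi> (\<pi> (in_C c))) (comult C c)"
        by (simp add: in_C_def[of c] ev_comult_T)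
      also have "\<dots> = ev \<phi> \<psi> (comult C c)"
        by (rule ev_cong) (use keys_comult_C[OF c] \<pi>_C in auto)
      finally show ?thesis using \<pi>_C[OF c] by simp
    qed
    then show ?thesis by (simp add: tensor_eq_iff[OF VD VD comult_tensors[OF D 1[OF c]] k])
  qed
  have "counit D c = counit C c" if c: "c \<in> vcarrier C" for c
  proof -
    have "counit D (\<pi> (in_C c)) = counit T (in_C c)"
      using hom linear_map_closed[OF linear_in_C c] by (simp add: coalg_hom_def)
    then show ?thesis using \<pi>_C[OF c] by (simp add: tilde_def in_C_def)
  qed
  then show ?thesis using 1 2 C D scale by (auto simp: coalgebra_extension_def)
qed

end

context vee
begin

abbreviation RD :: "('k, 'c, 'c) comod" where "RD \<equiv> regular_comod D"

lemma \<pi>_in_D: "x \<in> vcarrier T \<Longrightarrow> \<pi> x \<in> vcarrier D"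
  by (rule linear_map_closed[OF linear_\<pi>])

lemma D_cases:
  assumes "d \<in> vcarrier D"
  obtains \<alpha> \<mu> c where "(\<alpha>, \<mu>, c) \<in> vcarrier T" "\<pi> (\<alpha>, \<mu>, c) = d"
proof -
  have "d \<in> \<pi> ` vcarrier T" using assms surj by simp
  then obtain x where "x \<in> vcarrier T" "\<pi> x = d" by blast
  then show thesis using that by (cases x) auto
qed

lemma act_D_eqI:
  assumes "x \<in> vcarrier T" "y \<in> vcarrier D" "\<And>\<phi>. functional D \<phi> \<Longrightarrow> ev \<phi> \<psi> (comult D (\<pi> x)) = \<phi> y"
  shows "act RD \<psi> (\<pi> x) = y"
  using act_eqI[OF precomodule_regular[OF D], of "\<pi> x" y \<psi>] assms \<pi>_in_D by simp

lemma in_A_D: "M \<in> L \<Longrightarrow> linear_map (A M) D (\<lambda>a. \<pi> (in_A M a))"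
  by (rule linear_map_comp[OF linear_in_A linear_\<pi>])

text \<open>
  Evaluation at an endomorphism \<open>n\<close> of \<open>M\<close> descends to \<open>C\<^sup>\<or>\<close> if its residue is \<open>0\<close>; slicing
  with it twists the component in \<open>A\<^sub>M\<close> and discards all others.
\<close>

lemma twist_slice:
  assumes x: "(\<alpha>, \<mu>, c) \<in> vcarrier T" and M: "M \<in> L" and n: "n \<in> comod_end C M"
    "fd_indecomposable_comodule.residue M n = 0"
  obtains \<psi> where "functional D \<psi>"
    "act RD \<psi> (\<pi> (\<alpha>, \<mu>, c)) = \<pi> (in_A M (fd_indecomposable_comodule.twist C M n (Poly_Mapping.lookup \<alpha> M)))"
proof -
  interpret I: fd_indecomposable_comodule C M by (rule L_indecomposable[OF M])
  \<comment> \<open>This functional vanishes at all grouplike elements because \<open>n\<close> has residue \<open>0\<close>.\<close>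
  define \<Psi> :: "('k, 'c) tilde \<Rightarrow> 'k" where "\<Psi> = (\<lambda>(\<alpha>, \<mu>, c). Poly_Mapping.lookup \<alpha> M n)"
  have "functional T \<Psi>"
    by (rule functionalI) (auto simp: \<Psi>_def T_scale lookup_add)
  moreover have "\<Psi> (in_A N (chi N)) = \<Psi> (in_C g)" for N
    using n by (auto simp: \<Psi>_def in_A_def in_C_def lookup_single when_def I.character_def)
  ultimately obtain \<psi> where \<psi>: "functional D \<psi>" "\<And>x. x \<in> vcarrier T \<Longrightarrow> \<psi> (\<pi> x) = \<Psi> x"
    using factor_through_\<pi>[OF vspace_fld] by metis
  let ?a = "Poly_Mapping.lookup \<alpha> M"
  have a: "?a \<in> vcarrier (A M)" using x M by (simp add: T_carrier)
  have tw: "I.twist n ?a \<in> vcarrier (A M)" by (rule I.twist_A[OF a n(1)])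
  have "act RD \<psi> (\<pi> (\<alpha>, \<mu>, c)) = \<pi> (in_A M (I.twist n ?a))"
  proof (rule act_D_eqI[OF x linear_map_closed[OF in_A_D[OF M] tw]])
    fix \<phi> assume \<phi>: "functional D \<phi>"
    let ?\<Phi> = "\<lambda>a. \<phi> (\<pi> (in_A M a))"
    have \<Phi>: "functional (A M) ?\<Phi>" by (rule linear_map_comp[OF in_A_D[OF M] \<phi>])
    have *: "\<Psi> (in_M N m) = 0" "\<Psi> (in_C d) = 0" "\<Psi> (in_A N b) = (if N = M then b n else 0)" for N m d b
      by (auto simp: \<Psi>_def in_A_def in_M_def in_C_def lookup_single when_def)
    have "ev \<phi> \<psi> (comult D (\<pi> (\<alpha>, \<mu>, c))) = ev (\<lambda>y. \<phi> (\<pi> y)) \<Psi> (comult T (\<alpha>, \<mu>, c))"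
      by (rule ev_comult_D[OF x \<phi> \<psi>(1) refl \<psi>(2)])
    also have "\<dots> = (\<Sum>N\<in>Poly_Mapping.keys \<alpha>. ev (\<lambda>a. \<phi> (\<pi> (in_A N a))) (\<lambda>b. if N = M then b n else 0)
        (comult (A N) (Poly_Mapping.lookup \<alpha> N)))"
      by (simp add: ev_comult_T *)
    also have "\<dots> = (\<Sum>N\<in>Poly_Mapping.keys \<alpha>. if N = M then ev ?\<Phi> (\<lambda>b. b n) (comult (A M) ?a) else 0)"
      by (rule sum.cong) auto
    also have "\<dots> = (if M \<in> Poly_Mapping.keys \<alpha> then ?\<Phi> (I.twist n ?a) else 0)"
      using I.ev_comult_twist[OF a n(1) \<Phi>] by simp
    also have "\<dots> = ?\<Phi> (I.twist n ?a)"
    proof (cases "M \<in> Poly_Mapping.keys \<alpha>")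
      case False
      then have "I.twist n ?a = 0" by (intro ext) (auto simp: in_keys_iff I.twist_def)
      then show ?thesis using linear_map_zero[OF VA[OF M] \<Phi>] by simp
    qed simp
    finally show "ev \<phi> \<psi> (comult D (\<pi> (\<alpha>, \<mu>, c))) = ?\<Phi> (I.twist n ?a)" .
  qed
  then show thesis using that \<psi>(1) by blast
qed

text \<open>
  A functional on \<open>M\<close>, extended by \<open>0\<close>, pairs nontrivially only with the second factor of \<open>r\<^sub>M\<close>. So slicing
  with it moves the component in \<open>M\<close> into \<open>A\<^sub>M\<close> and discards all others.
\<close>

lemma coefficient_slice:
  assumes x: "(\<alpha>, \<mu>, c) \<in> vcarrier T" and M: "M \<in> L" and \<psi>0: "functional M \<psi>0"
  obtains \<psi> where "functional D \<psi>"
    "act RD \<psi> (\<pi> (\<alpha>, \<mu>, c)) = \<pi> (in_A M (fd_indecomposable_comodule.coefficient C M \<psi>0 (Poly_Mapping.lookup \<mu> M)))"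
proof -
  interpret I: fd_indecomposable_comodule C M by (rule L_indecomposable[OF M])
  let ?m = "Poly_Mapping.lookup \<mu> M"
  have m: "?m \<in> vcarrier M" using x M by (simp add: T_carrier)
  have \<psi>00: "\<psi>0 0 = 0" by (rule linear_map_zero[OF VM[OF M] \<psi>0])
  define \<Psi> :: "('k, 'c) tilde \<Rightarrow> 'k" where "\<Psi> = (\<lambda>(\<alpha>, \<mu>, c). \<psi>0 (Poly_Mapping.lookup \<mu> M))"
  have "functional T \<Psi>"
    by (rule functionalI) (use M functional_scale[OF \<psi>0] in
      \<open>auto simp: \<Psi>_def T_scale T_carrier lookup_add linear_map_add[OF \<psi>0] L_scale\<close>)
  moreover have "\<Psi> (in_A N (chi N)) = \<Psi> (in_C g)" for N
    by (auto simp: \<Psi>_def in_A_def in_C_def)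
  ultimately obtain \<psi> where \<psi>: "functional D \<psi>" "\<And>x. x \<in> vcarrier T \<Longrightarrow> \<psi> (\<pi> x) = \<Psi> x"
    using factor_through_\<pi>[OF vspace_fld] by metis
  have co: "I.coefficient \<psi>0 ?m \<in> vcarrier (A M)" by (rule I.coefficient_A[OF \<psi>0])
  have "act RD \<psi> (\<pi> (\<alpha>, \<mu>, c)) = \<pi> (in_A M (I.coefficient \<psi>0 ?m))"
  proof (rule act_D_eqI[OF x linear_map_closed[OF in_A_D[OF M] co]])
    fix \<phi> assume \<phi>: "functional D \<phi>"
    let ?\<Phi> = "\<lambda>a. \<phi> (\<pi> (in_A M a))"
    have \<Phi>: "functional (A M) ?\<Phi>" by (rule linear_map_comp[OF in_A_D[OF M] \<phi>])
    have *: "\<Psi> (in_A N a) = 0" "\<Psi> (in_C d) = 0" "\<Psi> (in_M N m) = (if N = M then \<psi>0 m else 0)" for N m d a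
      using \<psi>00 by (auto simp: \<Psi>_def in_A_def in_M_def in_C_def lookup_single when_def)
    have "ev \<phi> \<psi> (comult D (\<pi> (\<alpha>, \<mu>, c))) = ev (\<lambda>y. \<phi> (\<pi> y)) \<Psi> (comult T (\<alpha>, \<mu>, c))"
      by (rule ev_comult_D[OF x \<phi> \<psi>(1) refl \<psi>(2)])
    also have "\<dots> = (\<Sum>N\<in>Poly_Mapping.keys \<mu>. ev (\<lambda>a. \<phi> (\<pi> (in_A N a))) (\<lambda>m. if N = M then \<psi>0 m else 0)
        (end_coact C N (Poly_Mapping.lookup \<mu> N)))"
      by (simp add: ev_comult_T *)
    also have "\<dots> = (\<Sum>N\<in>Poly_Mapping.keys \<mu>. if N = M then ev ?\<Phi> \<psi>0 (end_coact C M ?m) else 0)"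
      by (rule sum.cong) auto
    also have "\<dots> = (if M \<in> Poly_Mapping.keys \<mu> then ?\<Phi> (I.coefficient \<psi>0 ?m) else 0)"
      using I.ev_end_coact_coefficient[OF m \<psi>0 \<Phi>] by simp
    also have "\<dots> = ?\<Phi> (I.coefficient \<psi>0 ?m)"
    proof (cases "M \<in> Poly_Mapping.keys \<mu>")
      case False
      have "I.coefficient \<psi>0 ?m f = 0" for f
        using False \<psi>00 linear_map_zero[OF VM[OF M] I.E_linear[of f]]
        by (auto simp: in_keys_iff I.coefficient_def)
      then have "I.coefficient \<psi>0 ?m = 0" by (simp add: fun_eq_iff)
      then show ?thesis using linear_map_zero[OF VA[OF M] \<Phi>] by simp
    qed simp
    finally show "ev \<phi> \<psi> (comult D (\<pi> (\<alpha>, \<mu>, c))) = ?\<Phi> (I.coefficient \<psi>0 ?m)" .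
  qed
  then show thesis using that \<psi>(1) by blast
qed

text \<open>
  An arbitrary endomorphism differs by a scalar from one with residue \<open>0\<close>, so stability under the
  twists of \<open>twist_slice\<close> implies stability under all twists.
\<close>

lemma subcoalgebra_meets_A:
  assumes E: "subcoalgebra D E" and M: "M \<in> L" and a: "a \<in> vcarrier (A M)" "a \<noteq> 0" "\<pi> (in_A M a) \<in> E"
  shows "g \<in> E"
proof -
  interpret I: fd_indecomposable_comodule C M by (rule L_indecomposable[OF M])
  let ?W = "{a \<in> vcarrier (A M). \<pi> (in_A M a) \<in> E}"
  have sub: "module.subspace (vscale D) E"
    and st: "\<And>\<psi> e. functional D \<psi> \<Longrightarrow> e \<in> E \<Longrightarrow> act RD \<psi> e \<in> E"
    using E unfolding subcoalgebra_iff[OF D] by auto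
  have W: "module.subspace (vscale (A M)) ?W"
    by (rule subspace_preimage[OF VA[OF M] in_A_D[OF M] VD sub])
  have "I.character \<in> ?W"
  proof (rule I.character_in_twist_stable[OF W])
    show "?W \<noteq> {0}" using a by blast
    fix b h assume b: "b \<in> ?W" and h: "h \<in> comod_end C M"
    obtain n where n: "n \<in> comod_end C M" "I.residue n = 0"
      "h = (\<lambda>x. n x + vscale M (I.residue h) (end_one M x))" using I.endo_decompose[OF h] .
    have T: "in_A M b \<in> vcarrier T" using linear_map_closed[OF linear_in_A[OF M]] b by simp
    obtain \<psi> where "functional D \<psi>"
      "act RD \<psi> (\<pi> (in_A M b)) = \<pi> (in_A M (I.twist n b))"
      using twist_slice[OF T[unfolded in_A_def] M n(1,2)] unfolding in_A_def by auto
    then have "\<pi> (in_A M (I.twist n b)) \<in> E" using st[of \<psi> "\<pi> (in_A M b)"] b by simp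
    then have "I.twist n b \<in> ?W" using b I.twist_A[OF _ n(1)] by simp
    moreover have "vscale (A M) (I.residue h) b \<in> ?W"
      using module.subspace_scale[OF vspace_module[OF VA[OF M]] W b] .
    ultimately have "I.twist n b + vscale (A M) (I.residue h) b \<in> ?W"
      by (rule module.subspace_add[OF vspace_module[OF VA[OF M]] W])
    moreover have "I.twist h b = I.twist n b + vscale (A M) (I.residue h) b"
      using b by (intro I.twist_decompose[OF _ h n(1,3)]) simp
    ultimately show "I.twist h b \<in> ?W" by metis
  qed blast
  then show ?thesis using \<pi>_chi[OF M] by simp
qed

lemma T_eq_sum:
  assumes x: "(\<alpha>, 0, c) \<in> vcarrier T"
  shows "(\<alpha>, 0, c) = (\<Sum>M\<in>Poly_Mapping.keys \<alpha>. in_A M (Poly_Mapping.lookup \<alpha> M)) + in_C c"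
proof -
  have "(\<Sum>M\<in>K. in_A M (Poly_Mapping.lookup \<alpha> M) :: ('k, 'c) tilde)
      = (\<Sum>M\<in>K. Poly_Mapping.single M (Poly_Mapping.lookup \<alpha> M), 0, 0)" for K
    by (induction K rule: infinite_finite_induct) (auto simp: in_A_def zero_prod_def)
  moreover have "(\<Sum>M\<in>Poly_Mapping.keys \<alpha>. Poly_Mapping.single M (Poly_Mapping.lookup \<alpha> M)) = \<alpha>"
    by (rule poly_mapping_eqI) (simp add: lookup_sum lookup_single when_def in_keys_iff)
  ultimately show ?thesis by (simp add: in_C_def)
qed

text \<open>
  Either some component of an element of \<open>E\<close> can be moved into a nonzero element of some \<open>A\<^sub>M\<close>, or all components
  in the modules \<open>M\<close> are zero and those in the \<open>A\<^sub>M\<close> are multiples of \<open>g\<^sub>M = g\<close>. In the second case the element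
  lies in \<open>C\<close>.
\<close>

theorem connected_D: "connected_at D g"
proof -
  have "g \<in> E" if E: "subcoalgebra D E" "E \<noteq> {0}" for E
  proof -
    have sub: "module.subspace (vscale D) E" "E \<subseteq> vcarrier D"
      and st: "\<And>\<psi> e. functional D \<psi> \<Longrightarrow> e \<in> E \<Longrightarrow> act RD \<psi> e \<in> E"
      using E(1) unfolding subcoalgebra_iff[OF D] by auto
    have "0 \<in> E" by (rule module.subspace_0[OF vspace_module[OF VD] sub(1)])
    then obtain d where d: "d \<in> E" "d \<noteq> 0" using E(2) by blast
    then have "d \<in> vcarrier D" using sub(2) by blast
    then obtain \<alpha> \<mu> c where x: "(\<alpha>, \<mu>, c) \<in> vcarrier T" "\<pi> (\<alpha>, \<mu>, c) = d"
      by (rule D_cases)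
    consider (M) M where "M \<in> L" "Poly_Mapping.lookup \<mu> M \<noteq> 0"
      | (A) M n where "M \<in> L" "n \<in> comod_end C M" "fd_indecomposable_comodule.residue M n = 0"
          "Poly_Mapping.lookup \<alpha> M n \<noteq> 0"
      | (C) "\<And>M. M \<in> L \<Longrightarrow> Poly_Mapping.lookup \<mu> M = 0"
          "\<And>M n. M \<in> L \<Longrightarrow> n \<in> comod_end C M \<Longrightarrow> fd_indecomposable_comodule.residue M n = 0 \<Longrightarrow>
            Poly_Mapping.lookup \<alpha> M n = 0"
      by blast
    then show ?thesis
    proof cases
      case M
      interpret I: fd_indecomposable_comodule C M by (rule L_indecomposable[OF M(1)])
      let ?m = "Poly_Mapping.lookup \<mu> M"
      have m: "?m \<in> vcarrier M" using x(1) M(1) by (simp add: T_carrier)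
      obtain \<psi>0 where \<psi>0: "functional M \<psi>0" "\<psi>0 ?m = 1"
        using functional_separates[OF VM[OF M(1)], of "{0}" ?m] M(2)
          module.subspace_single_0[OF vspace_module[OF VM[OF M(1)]]] by auto
      obtain \<psi> where "functional D \<psi>" "act RD \<psi> d = \<pi> (in_A M (I.coefficient \<psi>0 ?m))"
        using coefficient_slice[OF x(1) M(1) \<psi>0(1)] x(2) by auto
      then have "\<pi> (in_A M (I.coefficient \<psi>0 ?m)) \<in> E" using st[of \<psi> d] d by simp
      moreover have "I.coefficient \<psi>0 ?m (end_one M) = 1"
        using I.E_one \<psi>0(2) m by (simp add: I.coefficient_def end_one_def)
      then have "I.coefficient \<psi>0 ?m \<noteq> 0" by auto
      ultimately show ?thesis using subcoalgebra_meets_A[OF E(1) M(1) I.coefficient_A[OF \<psi>0(1)]] by blast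
    next
      case A
      interpret I: fd_indecomposable_comodule C M by (rule L_indecomposable[OF A(1)])
      let ?a = "Poly_Mapping.lookup \<alpha> M"
      have a: "?a \<in> vcarrier (A M)" using x(1) A(1) by (simp add: T_carrier)
      obtain \<psi> where "functional D \<psi>" "act RD \<psi> d = \<pi> (in_A M (I.twist n ?a))"
        using twist_slice[OF x(1) A(1-3)] x(2) by auto
      then have "\<pi> (in_A M (I.twist n ?a)) \<in> E" using st[of \<psi> d] d by simp
      then show ?thesis
        using subcoalgebra_meets_A[OF E(1) A(1) I.twist_A[OF a A(2)]] I.twist_one_neq_0[OF A(2), of ?a] A(4)
        by blast
    next
      case C
      have "M \<notin> Poly_Mapping.keys \<mu>" for M
      proof
        assume M: "M \<in> Poly_Mapping.keys \<mu>"
        then have "M \<in> L" using x(1) unfolding T_carrier by blast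
        then show False using C(1) M unfolding in_keys_iff by blast
      qed
      then have "Poly_Mapping.keys \<mu> = {}" by blast
      then have "\<mu> = 0" by simp
      have key: "\<pi> (in_A M (Poly_Mapping.lookup \<alpha> M)) \<in> vcarrier C" "in_A M (Poly_Mapping.lookup \<alpha> M) \<in> vcarrier T"
        if "M \<in> Poly_Mapping.keys \<alpha>" for M
      proof -
        have M: "M \<in> L" using that x(1) by (auto simp: T_carrier)
        interpret I: fd_indecomposable_comodule C M by (rule L_indecomposable[OF M])
        let ?a = "Poly_Mapping.lookup \<alpha> M"
        have a: "?a \<in> vcarrier (A M)" using x(1) M by (simp add: T_carrier)
        show "in_A M ?a \<in> vcarrier T" by (rule linear_map_closed[OF linear_in_A[OF M] a])
        have "?a = vscale (A M) (?a (end_one M)) (chi M)"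
          by (rule I.A_multiple_of_character[OF a C(2)[OF M]])
        then have "\<pi> (in_A M ?a) = vscale D (?a (end_one M)) (\<pi> (in_A M (chi M)))"
          using linear_map_scale[OF in_A_D[OF M] chi_A[OF M], of "?a (end_one M)"] by metis
        then show "\<pi> (in_A M ?a) \<in> vcarrier C" using \<pi>_chi[OF M] vspace_scale[OF VC g(2)] scale by simp
      qed
      have c: "c \<in> vcarrier C" using x(1) by (simp add: T_carrier)
      have "d = \<pi> ((\<Sum>M\<in>Poly_Mapping.keys \<alpha>. in_A M (Poly_Mapping.lookup \<alpha> M)) + in_C c)"
        using x T_eq_sum \<open>\<mu> = 0\<close> by simp
      also have "\<dots> = (\<Sum>M\<in>Poly_Mapping.keys \<alpha>. \<pi> (in_A M (Poly_Mapping.lookup \<alpha> M))) + c"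
      proof -
        have "(\<Sum>M\<in>Poly_Mapping.keys \<alpha>. in_A M (Poly_Mapping.lookup \<alpha> M)) \<in> vcarrier T"
          by (rule vspace_sum[OF VT key(2)])
        moreover have "\<pi> (\<Sum>M\<in>Poly_Mapping.keys \<alpha>. in_A M (Poly_Mapping.lookup \<alpha> M))
            = (\<Sum>M\<in>Poly_Mapping.keys \<alpha>. \<pi> (in_A M (Poly_Mapping.lookup \<alpha> M)))"
          by (rule linear_map_sum[OF VT linear_\<pi> key(2)])
        ultimately show ?thesis
          using linear_map_add[OF linear_\<pi> _ linear_map_closed[OF linear_in_C c]] \<pi>_C[OF c] by simp
      qed
      also have "\<dots> \<in> vcarrier C" by (intro vspace_add[OF VC] vspace_sum[OF VC] key c)
      finally have "d \<in> E \<inter> vcarrier C" using d(1) by blast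
      then have "E \<inter> vcarrier C \<noteq> {0}" using d(2) by blast
      then have "g \<in> E \<inter> vcarrier C"
        using conn extension_subcoalgebra_Int[OF extension E(1)] unfolding connected_at_def by blast
      then show ?thesis by blast
    qed
  qed
  then show ?thesis using extension_grouplike[OF extension g(1)] D by (auto simp: connected_at_def)
qed

text \<open>
  Of the comultiplication of \<open>m \<in> M\<close>, the projection to \<open>M\<close> in the first factor kills \<open>r\<^sub>M(m)\<close>, which lies in
  \<open>A\<^sub>M \<otimes> M\<close>, and leaves \<open>\<rho>\<^sub>M(m)\<close>. The other summands and the identified grouplike elements are sent to \<open>0\<close>.
\<close>

theorem projection_onto_representative:
  assumes M: "M \<in> L"
  obtains F where "linear_map D M F" "F g = 0" "F ` vcarrier D = vcarrier M"
    "\<And>\<psi> x. functional D \<psi> \<Longrightarrow> x \<in> vcarrier D \<Longrightarrow> act M \<psi> (F x) = F (act RD \<psi> x)"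
proof -
  interpret I: fd_indecomposable_comodule C M by (rule L_indecomposable[OF M])
  define P :: "('k, 'c) tilde \<Rightarrow> (nat \<Rightarrow>\<^sub>0 'k)" where "P = (\<lambda>(\<alpha>, \<mu>, c). Poly_Mapping.lookup \<mu> M)"
  have "linear_map T M P"
    by (rule linear_mapI) (use M in \<open>auto simp: P_def T_carrier T_scale lookup_add L_scale\<close>)
  moreover have "P (in_A N (chi N)) = P (in_C g)" for N by (simp add: P_def in_A_def in_C_def)
  ultimately obtain F where F: "linear_map D M F" "\<And>x. x \<in> vcarrier T \<Longrightarrow> F (\<pi> x) = P x"
    using factor_through_\<pi>[OF VM[OF M]] by metis
  have "F g = 0" using F(2)[OF linear_map_closed[OF linear_in_C g(2)]] \<pi>_C[OF g(2)] by (simp add: P_def in_C_def)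
  moreover have "F ` vcarrier D = vcarrier M"
  proof
    show "F ` vcarrier D \<subseteq> vcarrier M" using linear_map_closed[OF F(1)] by blast
    show "vcarrier M \<subseteq> F ` vcarrier D"
    proof
      fix m assume "m \<in> vcarrier M"
      then have "in_M M m \<in> vcarrier T" by (rule linear_map_closed[OF linear_in_M[OF M]])
      from F(2)[OF this] \<pi>_in_D[OF this] show "m \<in> F ` vcarrier D"
        by (intro image_eqI[of _ _ "\<pi> (in_M M m)"]) (simp_all add: P_def in_M_def)
    qed
  qed
  moreover have "act M \<psi> (F d) = F (act RD \<psi> d)" if \<psi>: "functional D \<psi>" and d: "d \<in> vcarrier D" for \<psi> d
  proof (rule act_eqI[OF I.pre])
    show "F d \<in> vcarrier M" by (rule linear_map_closed[OF F(1) d])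
    have aD: "act RD \<psi> d \<in> vcarrier D"
      using act_closed[OF precomodule_regular[OF D], of d \<psi>] d by simp
    then show "F (act RD \<psi> d) \<in> vcarrier M" by (rule linear_map_closed[OF F(1)])
    fix \<phi> assume \<phi>: "functional M \<phi>"
    obtain \<alpha> \<mu> c where x: "(\<alpha>, \<mu>, c) \<in> vcarrier T" "\<pi> (\<alpha>, \<mu>, c) = d"
      by (rule D_cases[OF d])
    let ?m = "Poly_Mapping.lookup \<mu> M"
    have m: "?m \<in> vcarrier M" using x(1) M by (simp add: T_carrier)
    have \<phi>0: "\<phi> 0 = 0" by (rule linear_map_zero[OF VM[OF M] \<phi>])
    have *: "\<phi> (P (in_A N a)) = 0" "\<phi> (P (in_C c)) = 0" "\<phi> (P (in_M N y)) = (if N = M then \<phi> y else 0)" for N a c y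
      using \<phi>0 by (auto simp: P_def in_A_def in_M_def in_C_def lookup_single when_def)
    have co: "ev \<phi> (\<lambda>c. \<psi> (\<pi> (in_C c))) (coact M ?m) = ev \<phi> \<psi> (coact M ?m)"
      by (rule ev_cong) (use keys_coact_M[OF M m] \<pi>_C in auto)
    have "\<phi> (F (act RD \<psi> d)) = ev (\<lambda>d. \<phi> (F d)) \<psi> (comult D (\<pi> (\<alpha>, \<mu>, c)))"
      using functional_act_regular[OF D linear_map_comp[OF F(1) \<phi>] d] x(2) by simp
    also have "\<dots> = ev (\<lambda>y. \<phi> (P y)) (\<lambda>y. \<psi> (\<pi> y)) (comult T (\<alpha>, \<mu>, c))"
      by (rule ev_comult_D[OF x(1) linear_map_comp[OF F(1) \<phi>] \<psi>]) (simp_all add: F(2))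
    also have "\<dots> = (\<Sum>N\<in>Poly_Mapping.keys \<mu>. ev (\<lambda>y. if N = M then \<phi> y else 0) (\<lambda>c. \<psi> (\<pi> (in_C c)))
        (coact N (Poly_Mapping.lookup \<mu> N)))"
      by (simp add: ev_comult_T *)
    also have "\<dots> = (\<Sum>N\<in>Poly_Mapping.keys \<mu>. if N = M then ev \<phi> \<psi> (coact M ?m) else 0)"
      by (rule sum.cong) (auto simp: co)
    also have "\<dots> = ev \<phi> \<psi> (coact M ?m)"
    proof (cases "M \<in> Poly_Mapping.keys \<mu>")
      case False
      have "functional M (\<lambda>m. ev \<phi> \<psi> (coact M m))"
        by (rule functional_coact[OF I.pre \<phi> extension_functional[OF extension \<psi>]])
      from linear_map_zero[OF VM[OF M] this] show ?thesis using False by (simp add: in_keys_iff)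
    qed simp
    also have "?m = F d" using F(2)[OF x(1)] x(2) by (simp add: P_def)
    finally show "ev \<phi> \<psi> (coact M (F d)) = \<phi> (F (act RD \<psi> d))" by simp
  qed
  ultimately show thesis using that F(1) by blast
qed

text \<open>
  The map is extended by \<open>0\<close> on all new summands. This is compatible with the identification of \<open>g\<close> and \<open>g\<^sub>M\<close>
  because \<open>f g = 0\<close>, and it is colinear because the first factors of the comultiplication of an element of
  \<open>A\<^sub>M\<close> or \<open>M\<close> lie in \<open>A\<^sub>M\<close> or \<open>M\<close> again. The set \<open>\<Psi>\<close> is a parameter because the coaction of \<open>Y\<close> may involve elements
  of later levels, on which a functional on \<open>D\<close> need not be linear.
\<close>

theorem extend_colinear:
  fixes Y :: "('k, 'c, 'y::ab_group_add) comod"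
  assumes Y: "vspace Y" and f: "linear_map C Y f" "f g = 0"
    and \<Psi>: "\<And>\<psi>. \<psi> \<in> \<Psi> \<Longrightarrow> functional D \<psi>"
    and act_f: "\<And>\<psi> c. \<psi> \<in> \<Psi> \<Longrightarrow> c \<in> vcarrier C \<Longrightarrow> act Y \<psi> (f c) = f (act (regular_comod C) \<psi> c)"
  obtains F where "linear_map D Y F" "\<And>c. c \<in> vcarrier C \<Longrightarrow> F c = f c"
    "\<And>\<psi> x. \<psi> \<in> \<Psi> \<Longrightarrow> x \<in> vcarrier D \<Longrightarrow> act Y \<psi> (F x) = F (act RD \<psi> x)"
proof -
  define P :: "('k, 'c) tilde \<Rightarrow> 'y" where "P = (\<lambda>(\<alpha>, \<mu>, c). f c)"
  have f0: "f 0 = 0" by (rule linear_map_zero[OF VC f(1)])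
  have "linear_map T Y P"
    by (rule linear_mapI) (auto simp: P_def T_carrier T_scale linear_map_closed[OF f(1)]
        linear_map_add[OF f(1)] linear_map_scale[OF f(1)])
  moreover have "P (in_A N (chi N)) = P (in_C g)" for N by (simp add: P_def in_A_def in_C_def f0 f(2))
  ultimately obtain F where F: "linear_map D Y F" "\<And>x. x \<in> vcarrier T \<Longrightarrow> F (\<pi> x) = P x"
    using factor_through_\<pi>[OF Y] by metis
  have "F c = f c" if c: "c \<in> vcarrier C" for c
    using F(2)[OF linear_map_closed[OF linear_in_C c]] \<pi>_C[OF c] by (simp add: P_def in_C_def)
  moreover have "act Y \<psi> (F d) = F (act RD \<psi> d)" if \<psi>\<Psi>: "\<psi> \<in> \<Psi>" and d: "d \<in> vcarrier D" for \<psi> d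
  proof -
    note \<psi> = \<Psi>[OF \<psi>\<Psi>]
    have aD: "act RD \<psi> d \<in> vcarrier D"
      using act_closed[OF precomodule_regular[OF D], of d \<psi>] d by simp
    obtain \<alpha> \<mu> c where x: "(\<alpha>, \<mu>, c) \<in> vcarrier T" "\<pi> (\<alpha>, \<mu>, c) = d"
      by (rule D_cases[OF d])
    have c: "c \<in> vcarrier C" using x(1) by (simp add: T_carrier)
    have Fd: "F d = f c" using F(2)[OF x(1)] x(2) by (simp add: P_def)
    have aC: "act (regular_comod C) \<psi> c \<in> vcarrier C"
      using act_closed[OF precomodule_regular[OF C], of c \<psi>] c by simp
    have "F (act RD \<psi> d) = f (act (regular_comod C) \<psi> c)"
    proof (rule functional_eqI[OF Y])
      show "F (act RD \<psi> d) \<in> vcarrier Y" by (rule linear_map_closed[OF F(1) aD])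
      show "f (act (regular_comod C) \<psi> c) \<in> vcarrier Y" by (rule linear_map_closed[OF f(1) aC])
      fix \<phi> assume \<phi>: "functional Y \<phi>"
      have \<phi>0: "\<phi> 0 = 0" by (rule linear_map_zero[OF Y \<phi>])
      have *: "\<phi> (P (in_A N a)) = 0" "\<phi> (P (in_C c)) = \<phi> (f c)" "\<phi> (P (in_M N y)) = 0" for N a c y
        using \<phi>0 f0 by (auto simp: P_def in_A_def in_M_def in_C_def)
      have "\<phi> (F (act RD \<psi> d)) = ev (\<lambda>d. \<phi> (F d)) \<psi> (comult D (\<pi> (\<alpha>, \<mu>, c)))"
        using functional_act_regular[OF D linear_map_comp[OF F(1) \<phi>] d] x(2) by simp
      also have "\<dots> = ev (\<lambda>y. \<phi> (P y)) (\<lambda>y. \<psi> (\<pi> y)) (comult T (\<alpha>, \<mu>, c))"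
        by (rule ev_comult_D[OF x(1) linear_map_comp[OF F(1) \<phi>] \<psi>]) (simp_all add: F(2))
      also have "\<dots> = ev (\<lambda>c. \<phi> (f c)) (\<lambda>c. \<psi> (\<pi> (in_C c))) (comult C c)"
        by (simp add: ev_comult_T *)
      also have "\<dots> = ev (\<lambda>c. \<phi> (f c)) \<psi> (comult C c)"
        by (rule ev_cong) (use keys_comult_C[OF c] \<pi>_C in auto)
      also have "\<dots> = \<phi> (f (act (regular_comod C) \<psi> c))"
        using functional_act_regular[OF C linear_map_comp[OF f(1) \<phi>] c] by simp
      finally show "\<phi> (F (act RD \<psi> d)) = \<phi> (f (act (regular_comod C) \<psi> c))" .
    qed
    then show ?thesis using act_f[OF \<psi>\<Psi> c] Fd by simp
  qed
  ultimately show thesis using that F(1) by blast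
qed

end

lemma vee_of_is_vee:
  assumes "connected_at C g" "is_vee C D"
  obtains L \<pi> where "vee C D L \<pi> g"
  using assms unfolding is_vee_def vee_def by blast

lemma coalg_hom_ev:
  assumes "coalg_hom C D f" "c \<in> vcarrier C" "functional D \<phi>" "functional D \<psi>"
  shows "ev \<phi> \<psi> (comult D (f c)) = ev (\<lambda>c. \<phi> (f c)) (\<lambda>c. \<psi> (f c)) (comult C c)"
  using assms tensor_eq_imp_ev[of D D "comult D (f c)" "tmap f f (comult C c)"]
  by (simp add: coalg_hom_def ev_tmap)

text \<open>
  Stability under slices can be transported along the isomorphism in both directions.
\<close>

lemma connected_at_iso:
  assumes conn: "connected_at C g" and D: "coalgebra D" and iso: "coalg_iso C D"
  obtains g' where "connected_at D g'"
proof -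
  obtain f where hom: "coalg_hom C D f" and bij: "bij_betw f (vcarrier C) (vcarrier D)"
    using iso by (auto simp: coalg_iso_def)
  have C: "coalgebra C" and gl: "grouplike C g" and min: "\<And>E. subcoalgebra C E \<Longrightarrow> E \<noteq> {0} \<Longrightarrow> g \<in> E"
    using conn by (auto simp: connected_at_def)
  note VC = coalgebra_vspace[OF C] and VD = coalgebra_vspace[OF D]
  have f: "linear_map C D f" using hom by (simp add: coalg_hom_def)
  let ?h = "inv_into (vcarrier C) f"
  note h = linear_map_inv_into[OF VC f bij]
  have gC: "g \<in> vcarrier C" "counit C g = 1" using gl by (auto simp: grouplike_def)
  have fg: "f g \<in> vcarrier D" by (rule linear_map_closed[OF f gC(1)])
  have grp: "grouplike D (f g)"
  proof (rule grouplikeI[OF VD comult_tensors[OF D fg] fg])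
    show "counit D (f g) = 1" using hom gC by (simp add: coalg_hom_def)
    show "ev \<phi> \<psi> (comult D (f g)) = \<phi> (f g) * \<psi> (f g)" if "functional D \<phi>" "functional D \<psi>" for \<phi> \<psi>
      using coalg_hom_ev[OF hom gC(1) that] ev_grouplike[OF gl linear_map_comp[OF f that(1)] linear_map_comp[OF f that(2)]]
      by simp
  qed
  have "f g \<in> E" if E: "subcoalgebra D E" "E \<noteq> {0}" for E
  proof -
    have sub: "module.subspace (vscale D) E" "E \<subseteq> vcarrier D"
      and st: "\<And>\<psi> e. functional D \<psi> \<Longrightarrow> e \<in> E \<Longrightarrow> act (regular_comod D) \<psi> e \<in> E \<and> lact D \<psi> e \<in> E"
      using E(1) unfolding subcoalgebra_iff[OF D] by auto
    let ?E = "{c \<in> vcarrier C. f c \<in> E}"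
    have "act (regular_comod C) \<chi> c \<in> ?E \<and> lact C \<chi> c \<in> ?E" if \<chi>: "functional C \<chi>" and c: "c \<in> ?E" for \<chi> c
    proof -
      have cC: "c \<in> vcarrier C" "f c \<in> E" using c by auto
      have k: "Poly_Mapping.keys (comult C c) \<subseteq> vcarrier C \<times> vcarrier C"
        using comult_tensors[OF C cC(1)] by (simp add: tensors_def)
      have \<chi>': "functional D (\<lambda>d. \<chi> (?h d))" by (rule linear_map_comp[OF h(1) \<chi>])
      have cl: "act (regular_comod C) \<chi> c \<in> vcarrier C" "lact C \<chi> c \<in> vcarrier C"
        using act_closed[OF precomodule_regular[OF C], of c \<chi>] lact_closed[OF C cC(1)] cC by auto
      have st': "act (regular_comod D) (\<lambda>d. \<chi> (?h d)) (f c) \<in> E" "lact D (\<lambda>d. \<chi> (?h d)) (f c) \<in> E"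
        using st[OF \<chi>' cC(2)] by auto
      have "f (act (regular_comod C) \<chi> c) = act (regular_comod D) (\<lambda>d. \<chi> (?h d)) (f c)"
      proof (rule functional_eqI[OF VD _ linear_map_closed[OF f cl(1)] subsetD[OF sub(2) st'(1)]])
        fix \<phi> assume \<phi>: "functional D \<phi>"
        have "ev (\<lambda>c. \<phi> (f c)) (\<lambda>c. \<chi> (?h (f c))) (comult C c) = ev (\<lambda>c. \<phi> (f c)) \<chi> (comult C c)"
          by (rule ev_cong) (use k h(2) in auto)
        then show "\<phi> (f (act (regular_comod C) \<chi> c)) = \<phi> (act (regular_comod D) (\<lambda>d. \<chi> (?h d)) (f c))"
          using functional_act_regular[OF C linear_map_comp[OF f \<phi>] cC(1)]
            functional_act_regular[OF D \<phi> linear_map_closed[OF f cC(1)]] coalg_hom_ev[OF hom cC(1) \<phi> \<chi>']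
          by simp
      qed
      moreover have "f (lact C \<chi> c) = lact D (\<lambda>d. \<chi> (?h d)) (f c)"
      proof (rule functional_eqI[OF VD _ linear_map_closed[OF f cl(2)] subsetD[OF sub(2) st'(2)]])
        fix \<phi> assume \<phi>: "functional D \<phi>"
        have "ev (\<lambda>c. \<chi> (?h (f c))) (\<lambda>c. \<phi> (f c)) (comult C c) = ev \<chi> (\<lambda>c. \<phi> (f c)) (comult C c)"
          by (rule ev_cong) (use k h(2) in auto)
        then show "\<phi> (f (lact C \<chi> c)) = \<phi> (lact D (\<lambda>d. \<chi> (?h d)) (f c))"
          using functional_lact[OF C linear_map_comp[OF f \<phi>] cC(1)]
            functional_lact[OF D \<phi> linear_map_closed[OF f cC(1)]] coalg_hom_ev[OF hom cC(1) \<chi>' \<phi>]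
          by simp
      qed
      ultimately show ?thesis using st' cl by simp
    qed
    then have "subcoalgebra C ?E"
      unfolding subcoalgebra_iff[OF C] using subspace_preimage[OF VC f VD sub(1)] by blast
    moreover have "?E \<noteq> {0}"
    proof -
      have "0 \<in> E" by (rule module.subspace_0[OF vspace_module[OF VD] sub(1)])
      then obtain e where e: "e \<in> E" "e \<noteq> 0" using E(2) by blast
      have eD: "e \<in> vcarrier D" using e(1) sub(2) by blast
      then have "?h e \<in> ?E" using h(3)[OF eD] e(1) linear_map_closed[OF h(1) eD] by simp
      moreover have "?h e \<noteq> 0" using h(3)[OF eD] e(2) linear_map_zero[OF VC f] by auto
      ultimately show ?thesis by blast
    qed
    ultimately show ?thesis using min by blast
  qed
  then show thesis using that[of "f g"] grp D by (auto simp: connected_at_def)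
qed

lemma coalgebra_extension_refl: "coalgebra C \<Longrightarrow> coalgebra_extension C C"
  by (simp add: coalgebra_extension_def tensor_eq_def free.span_zero)

lemma coalgebra_extension_trans:
  assumes CD: "coalgebra_extension C D" and DE: "coalgebra_extension D E"
  shows "coalgebra_extension C E"
proof -
  note C = extension_coalgebras(1)[OF CD] and E = extension_coalgebras(2)[OF DE]
  note V = coalgebra_vspace[OF E]
  have sub: "vcarrier C \<subseteq> vcarrier D" "vcarrier D \<subseteq> vcarrier E"
    using extension_subset[OF CD] extension_subset[OF DE] .
  have "tensor_eq E E (comult E c) (comult C c)" if c: "c \<in> vcarrier C" for c
  proof -
    have cE: "c \<in> vcarrier D" "c \<in> vcarrier E" using c sub by auto
    have k: "comult C c \<in> tensors E E" using comult_tensors[OF C c] sub by (auto simp: tensors_def)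
    have "ev \<phi> \<psi> (comult E c) = ev \<phi> \<psi> (comult C c)" if "functional E \<phi>" "functional E \<psi>" for \<phi> \<psi>
      using extension_ev[OF DE that cE(1)]
        extension_ev[OF CD extension_functional[OF DE that(1)] extension_functional[OF DE that(2)] c] by simp
    then show ?thesis by (simp add: tensor_eq_iff[OF V V comult_tensors[OF E cE(2)] k])
  qed
  then show ?thesis using CD DE sub unfolding coalgebra_extension_def by auto
qed

section \<open>The union of the tower\<close>

locale tower =
  fixes X :: "nat \<Rightarrow> ('k::alg_closed_field, 'd::ab_group_add) coalg" and g :: 'd
  assumes base: "connected_at (X 0) g" and step: "\<And>n. is_vee (X n) (X (Suc n))"
begin

abbreviation U :: "('k, 'd) coalg" where "U \<equiv> coalg_union X"

lemma connected: "connected_at (X n) g"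
proof (induction n)
  case (Suc n)
  obtain L \<pi> where "vee (X n) (X (Suc n)) L \<pi> g" using vee_of_is_vee[OF Suc step] .
  then show ?case by (rule vee.connected_D)
qed (rule base)

lemma X_coalgebra: "coalgebra (X n)" using connected by (simp add: connected_at_def)

lemma X_extension: "m \<le> n \<Longrightarrow> coalgebra_extension (X m) (X n)"
proof (induction n rule: dec_induct)
  case base
  show ?case by (rule coalgebra_extension_refl[OF X_coalgebra])
next
  case (step n)
  obtain L \<pi> where "vee (X n) (X (Suc n)) L \<pi> g" using vee_of_is_vee[OF connected tower.step[OF tower_axioms]] .
  then have "coalgebra_extension (X n) (X (Suc n))" by (rule vee.extension)
  then show ?case using coalgebra_extension_trans step.IH by blast
qed

lemma X_mono: "m \<le> n \<Longrightarrow> vcarrier (X m) \<subseteq> vcarrier (X n)"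
  by (rule extension_subset[OF X_extension])

lemma X_scale: "vscale (X n) = vscale (X 0)"
  using extension_scale[OF X_extension[of 0 n]] by simp

lemma U_simps: "vcarrier U = (\<Union>n. vcarrier (X n))" "vscale U = vscale (X n)"
  by (simp_all add: coalg_union_def X_scale[of n])

lemma U_mem: "c \<in> vcarrier (X n) \<Longrightarrow> c \<in> vcarrier U"
  by (auto simp: U_simps(1))

lemma U_level:
  assumes "c \<in> vcarrier U"
  obtains m where "c \<in> vcarrier (X m)" "comult U c = comult (X m) c" "counit U c = counit (X m) c"
    "\<And>n. c \<in> vcarrier (X n) \<Longrightarrow> m \<le> n"
proof (rule that)
  let ?m = "LEAST n. c \<in> vcarrier (X n)"
  obtain n where "c \<in> vcarrier (X n)" using assms by (auto simp: U_simps(1))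
  then show "c \<in> vcarrier (X ?m)" by (rule LeastI)
qed (auto simp: coalg_union_def intro: Least_le)

lemma U_functional: "functional U \<phi> \<Longrightarrow> functional (X n) \<phi>"
  by (rule functional_mono[OF _ _ U_simps(2)[of n, symmetric]]) (auto simp: U_simps(1))

lemma U_ev:
  assumes c: "c \<in> vcarrier (X n)" and \<phi>: "functional U \<phi>" and \<psi>: "functional U \<psi>"
  shows "ev \<phi> \<psi> (comult U c) = ev \<phi> \<psi> (comult (X n) c)"
proof -
  obtain m where m: "c \<in> vcarrier (X m)" "comult U c = comult (X m) c" "m \<le> n"
    using U_level[OF U_mem[OF c]] c by metis
  show ?thesis
    using extension_ev[OF X_extension[OF m(3)] U_functional[OF \<phi>] U_functional[OF \<psi>] m(1)] m(2) by simp
qed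

lemma U_counit: "c \<in> vcarrier (X n) \<Longrightarrow> counit U c = counit (X n) c"
proof -
  assume c: "c \<in> vcarrier (X n)"
  obtain m where m: "c \<in> vcarrier (X m)" "counit U c = counit (X m) c" "m \<le> n"
    using U_level[OF U_mem[OF c]] c by metis
  then show ?thesis using X_extension[OF m(3)] by (auto simp: coalgebra_extension_def)
qed

lemma X_join:
  assumes "c \<in> vcarrier U" "d \<in> vcarrier U"
  obtains n where "c \<in> vcarrier (X n)" "d \<in> vcarrier (X n)"
proof -
  obtain i j where "c \<in> vcarrier (X i)" "d \<in> vcarrier (X j)" using assms by (auto simp: U_simps(1))
  then have "c \<in> vcarrier (X (max i j))" "d \<in> vcarrier (X (max i j))"
    using X_mono[of i "max i j"] X_mono[of j "max i j"] by auto
  then show thesis by (rule that)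
qed

lemma finite_subset_level:
  assumes "finite S" "S \<subseteq> vcarrier U"
  obtains n where "S \<subseteq> vcarrier (X n)"
proof -
  have "\<exists>n. S \<subseteq> vcarrier (X n)" using assms
  proof (induction S rule: finite_induct)
    case (insert c S)
    then obtain i j where "S \<subseteq> vcarrier (X i)" "c \<in> vcarrier (X j)" by (auto simp: U_simps(1))
    then have "insert c S \<subseteq> vcarrier (X (max i j))"
      using X_mono[of i "max i j"] X_mono[of j "max i j"] by auto
    then show ?case by blast
  qed simp
  then show thesis using that by blast
qed

lemma VX: "vspace (X n)" by (rule coalgebra_vspace[OF X_coalgebra])

lemma VU: "vspace U"
proof -
  have vs: "vector_space (vscale U)"
    using vspace_vector_space[OF VX[of 0]] by (simp add: U_simps(2)[of 0])
  interpret vector_space "vscale U" by (rule vs)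
  have "subspace (vcarrier U)" unfolding subspace_def
  proof (intro conjI ballI allI)
    show "0 \<in> vcarrier U" using U_mem[OF vspace_zero[OF VX[of 0]]] .
    fix x y r assume x: "x \<in> vcarrier U"
    then obtain n where "x \<in> vcarrier (X n)" by (auto simp: U_simps(1))
    then show "vscale U r x \<in> vcarrier U" using U_mem[OF vspace_scale[OF VX]] by (simp add: U_simps(2)[of n])
    assume "y \<in> vcarrier U"
    with x obtain n where "x \<in> vcarrier (X n)" "y \<in> vcarrier (X n)" by (rule X_join)
    then show "x + y \<in> vcarrier U" using U_mem[OF vspace_add[OF VX]] by blast
  qed
  then show ?thesis by (simp add: vspace_def vs)
qed

lemma keys_comult_U:
  assumes "c \<in> vcarrier U"
  shows "Poly_Mapping.keys (comult U c) \<subseteq> vcarrier U \<times> vcarrier U"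
proof -
  obtain m where m: "c \<in> vcarrier (X m)" "comult U c = comult (X m) c" by (rule U_level[OF assms])
  then show ?thesis using comult_tensors[OF X_coalgebra m(1)] U_mem by (fastforce simp: tensors_def)
qed

text \<open>
  By \<open>U_ev\<close> the level at which the comultiplication is taken does not matter as long as it contains the
  element, so each axiom can be checked in a common level of the elements involved.
\<close>

lemma U_coalgebra: "coalgebra U"
  unfolding coalgebra_def
proof (intro conjI ballI allI)
  have tens: "comult U c \<in> tensors U U" if "c \<in> vcarrier U" for c
    using keys_comult_U[OF that] by (simp add: tensors_def)
  have fnc: "functional (X n) (\<lambda>c. ev \<phi> \<psi> (comult (X n) c))" if "functional U \<phi>" "functional U \<psi>" for \<phi> \<psi> n
    using functional_conv[OF X_coalgebra U_functional[OF that(1)] U_functional[OF that(2)]] by (simp add: conv_def[abs_def])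
  show "vspace U" by (rule VU)
  show "linear_to_tensor U U U (comult U)"
  proof (rule linear_to_tensorI[OF VU VU VU tens])
    fix \<phi> \<psi> assume f: "functional U \<phi>" "functional U \<psi>"
    show "functional U (\<lambda>c. ev \<phi> \<psi> (comult U c))"
    proof (rule functionalI)
      fix x y r assume x: "x \<in> vcarrier U"
      then obtain n where n: "x \<in> vcarrier (X n)" by (auto simp: U_simps(1))
      show "ev \<phi> \<psi> (comult U (vscale U r x)) = r * ev \<phi> \<psi> (comult U x)"
        using functional_scale[OF fnc[OF f] n, of r] U_ev[OF n f] U_ev[OF vspace_scale[OF VX n] f, of r]
        by (simp add: U_simps(2)[of n])
      assume y: "y \<in> vcarrier U"
      obtain n where n: "x \<in> vcarrier (X n)" "y \<in> vcarrier (X n)" by (rule X_join[OF x y])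
      show "ev \<phi> \<psi> (comult U (x + y)) = ev \<phi> \<psi> (comult U x) + ev \<phi> \<psi> (comult U y)"
        using linear_map_add[OF fnc[OF f] n] U_ev[OF n(1) f] U_ev[OF n(2) f] U_ev[OF vspace_add[OF VX n] f]
        by simp
    qed
  qed
  fix c r assume c: "c \<in> vcarrier U"
  obtain m where m: "c \<in> vcarrier (X m)" "comult U c = comult (X m) c" by (rule U_level[OF c])
  have km: "Poly_Mapping.keys (comult (X m) c) \<subseteq> vcarrier (X m) \<times> vcarrier (X m)"
    using comult_tensors[OF X_coalgebra m(1)] by (simp add: tensors_def)
  have kU: "Poly_Mapping.keys (comult U d) \<subseteq> vcarrier U \<times> vcarrier U" if "d \<in> vcarrier U" for d
    using keys_comult_U[OF that] .
  show "counit U (vscale U r c) = r * counit U c"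
    using U_counit[OF m(1)] U_counit[OF vspace_scale[OF VX m(1)], of r] functional_scale[OF functional_counit[OF X_coalgebra] m(1), of r]
    by (simp add: U_simps(2)[of m])
  have kl: "Poly_Mapping.keys (expand_left (comult U) (comult U c)) \<subseteq> vcarrier U \<times> vcarrier U \<times> vcarrier U"
    by (rule keys_expand_left[OF kU[OF c] kU])
  have kr: "Poly_Mapping.keys (expand_right (comult U) (comult U c)) \<subseteq> vcarrier U \<times> vcarrier U \<times> vcarrier U"
    by (rule keys_expand_right[OF kU[OF c] kU])
  have "ev3 \<phi> \<psi> \<chi> (expand_left (comult U) (comult U c)) = ev3 \<phi> \<psi> \<chi> (expand_right (comult U) (comult U c))"
    if f: "functional U \<phi>" "functional U \<psi>" "functional U \<chi>" for \<phi> \<psi> \<chi>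
  proof -
    have "ev (\<lambda>x. ev \<phi> \<psi> (comult U x)) \<chi> (comult (X m) c) = ev (conv (X m) \<phi> \<psi>) \<chi> (comult (X m) c)"
      by (rule ev_cong) (use km U_ev[OF _ f(1,2)] in \<open>auto simp: conv_def\<close>)
    also have "\<dots> = ev \<phi> (conv (X m) \<psi> \<chi>) (comult (X m) c)"
      by (rule coassoc_ev[OF X_coalgebra U_functional[OF f(1)] U_functional[OF f(2)] U_functional[OF f(3)] m(1)])
    also have "\<dots> = ev \<phi> (\<lambda>x. ev \<psi> \<chi> (comult U x)) (comult (X m) c)"
      by (rule ev_cong) (use km U_ev[OF _ f(2,3)] in \<open>auto simp: conv_def\<close>)
    finally show ?thesis by (simp add: ev3_expand_left ev3_expand_right m(2))
  qed
  then show "tensor3_eq U U U (expand_left (comult U) (comult U c)) (expand_right (comult U) (comult U c))"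
    unfolding tensor3_eq_iff[OF VU VU VU kl kr] by blast
  have "lin_ext (vscale U) (\<lambda>(a, b). vscale U (counit U a) b) (comult U c) = lact (X m) (counit (X m)) c"
    unfolding lact_def lslice_def m(2) U_simps(2)[of m]
    by (rule lin_ext_cong) (use km U_counit in auto)
  then show "lin_ext (vscale U) (\<lambda>(a, b). vscale U (counit U a) b) (comult U c) = c"
    using lact_counit[OF X_coalgebra m(1)] by simp
  have "lin_ext (vscale U) (\<lambda>(a, b). vscale U (counit U b) a) (comult U c)
      = act (regular_comod (X m)) (counit (X m)) c"
    unfolding act_def rslice_def regular_comod_simps m(2) U_simps(2)[of m]
    by (rule lin_ext_cong) (use km U_counit in auto)
  then show "lin_ext (vscale U) (\<lambda>(a, b). vscale U (counit U b) a) (comult U c) = c"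
    using act_counit_regular[OF X_coalgebra m(1)] by simp
  fix d assume d: "d \<in> vcarrier U"
  obtain n where n: "c \<in> vcarrier (X n)" "d \<in> vcarrier (X n)" by (rule X_join[OF c d])
  show "counit U (c + d) = counit U c + counit U d"
    using U_counit[OF n(1)] U_counit[OF n(2)] U_counit[OF vspace_add[OF VX n]]
      linear_map_add[OF functional_counit[OF X_coalgebra] n] by simp
qed

lemma U_extension: "coalgebra_extension (X n) U"
proof -
  have "tensor_eq U U (comult U c) (comult (X n) c)" if c: "c \<in> vcarrier (X n)" for c
  proof -
    have k: "comult (X n) c \<in> tensors U U"
      using comult_tensors[OF X_coalgebra c] U_mem by (fastforce simp: tensors_def)
    show ?thesis
      using U_ev[OF c] by (simp add: tensor_eq_iff[OF VU VU comult_tensors[OF U_coalgebra U_mem[OF c]] k])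
  qed
  then show ?thesis
    using X_coalgebra U_coalgebra U_mem U_counit U_simps(2)[of n] by (auto simp: coalgebra_extension_def)
qed

lemma U_connected: "connected_at U g"
proof -
  have "g \<in> E" if E: "subcoalgebra U E" "E \<noteq> {0}" for E
  proof -
    have sub: "module.subspace (vscale U) E" "E \<subseteq> vcarrier U" using E(1) by (auto simp: subcoalgebra_def)
    have "0 \<in> E" by (rule module.subspace_0[OF vspace_module[OF VU] sub(1)])
    then obtain e where e: "e \<in> E" "e \<noteq> 0" using E(2) by blast
    then obtain n where "e \<in> vcarrier (X n)" using sub(2) by (auto simp: U_simps(1))
    then have "E \<inter> vcarrier (X n) \<noteq> {0}" using e by blast
    then have "g \<in> E \<inter> vcarrier (X n)"
      using connected[of n] extension_subcoalgebra_Int[OF U_extension E(1), of n] unfolding connected_at_def by blast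
    then show ?thesis by blast
  qed
  moreover have "grouplike U g"
    using extension_grouplike[OF U_extension[of 0]] base by (simp add: connected_at_def)
  ultimately show ?thesis using U_coalgebra by (auto simp: connected_at_def)
qed

lemma X_act: "functional U \<psi> \<Longrightarrow> c \<in> vcarrier (X n) \<Longrightarrow> act (regular_comod U) \<psi> c = act (regular_comod (X n)) \<psi> c"
  by (rule extension_act(1)[OF U_extension]) auto

text \<open>
  Each step of the extension above level \<open>n\<close> is only known to exist, so a compatible sequence of extensions is
  obtained by dependent choice.
\<close>

lemma extend_to_union:
  fixes Y :: "('k, 'd, 'y::ab_group_add) comod"
  assumes Y: "vspace Y" and f: "linear_map (X n) Y f" "f g = 0"
    and act_f: "\<And>\<psi> c. functional U \<psi> \<Longrightarrow> c \<in> vcarrier (X n) \<Longrightarrow> act Y \<psi> (f c) = f (act (regular_comod (X n)) \<psi> c)"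
  obtains F where "linear_map U Y F" "\<And>c. c \<in> vcarrier (X n) \<Longrightarrow> F c = f c"
    "\<And>\<psi> c. functional U \<psi> \<Longrightarrow> c \<in> vcarrier U \<Longrightarrow> act Y \<psi> (F c) = F (act (regular_comod U) \<psi> c)"
proof -
  define Q where "Q k f \<longleftrightarrow> linear_map (X (n + k)) Y f \<and> f g = 0 \<and>
    (\<forall>\<psi> c. functional U \<psi> \<longrightarrow> c \<in> vcarrier (X (n + k)) \<longrightarrow> act Y \<psi> (f c) = f (act (regular_comod (X (n + k))) \<psi> c))"
    for k f
  have g_mem: "g \<in> vcarrier (X k)" for k using connected[of k] by (simp add: connected_at_def grouplike_def)
  have "\<exists>F. F 0 = f \<and> (\<forall>k. Q k (F k) \<and> (\<forall>c\<in>vcarrier (X (n + k)). F (Suc k) c = F k c))"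
  proof -
    have "\<exists>F. \<forall>k. (Q k (F k) \<and> (k = 0 \<longrightarrow> F k = f)) \<and> (\<forall>c\<in>vcarrier (X (n + k)). F (Suc k) c = F k c)"
    proof (rule dependent_nat_choice[where P = "\<lambda>k F. Q k F \<and> (k = 0 \<longrightarrow> F = f)"
          and Q = "\<lambda>k F F'. \<forall>c\<in>vcarrier (X (n + k)). F' c = F c"])
      have "Q 0 f" using f act_f by (auto simp: Q_def)
      then show "\<exists>x. Q 0 x \<and> (0 = (0::nat) \<longrightarrow> x = f)" by blast
      fix h k assume h: "Q k h \<and> (k = 0 \<longrightarrow> h = f)"
      obtain L \<pi> where "vee (X (n + k)) (X (Suc (n + k))) L \<pi> g" using vee_of_is_vee[OF connected step] .
      then interpret v: vee "X (n + k)" "X (Suc (n + k))" L \<pi> g .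
      obtain F where F: "linear_map (X (Suc (n + k))) Y F" "\<And>c. c \<in> vcarrier (X (n + k)) \<Longrightarrow> F c = h c"
        "\<And>\<psi> x. \<psi> \<in> {\<psi>. functional U \<psi>} \<Longrightarrow> x \<in> vcarrier (X (Suc (n + k))) \<Longrightarrow>
            act Y \<psi> (F x) = F (act (regular_comod (X (Suc (n + k)))) \<psi> x)"
      proof (rule v.extend_colinear[OF Y, of h "{\<psi>. functional U \<psi>}"])
        show "linear_map (X (n + k)) Y h" "h g = 0" using h by (auto simp: Q_def)
        show "functional (X (Suc (n + k))) \<psi>" if "\<psi> \<in> {\<psi>. functional U \<psi>}" for \<psi>
          using U_functional that by simp
        show "act Y \<psi> (h c) = h (act (regular_comod (X (n + k))) \<psi> c)"
          if "\<psi> \<in> {\<psi>. functional U \<psi>}" "c \<in> vcarrier (X (n + k))" for \<psi> c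
          using h that by (auto simp: Q_def)
      qed blast
      have "Q (Suc k) F" using F h g_mem[of "n + k"] by (auto simp: Q_def)
      then show "\<exists>F. (Q (Suc k) F \<and> (Suc k = 0 \<longrightarrow> F = f)) \<and> (\<forall>c\<in>vcarrier (X (n + k)). F c = h c)"
        using F(2) by blast
    qed
    then show ?thesis by blast
  qed
  then obtain F where F0: "F 0 = f" and Q: "\<And>k. Q k (F k)"
    and ext: "\<And>k c. c \<in> vcarrier (X (n + k)) \<Longrightarrow> F (Suc k) c = F k c" by blast
  have F_eq: "F j c = F i c" if "i \<le> j" "c \<in> vcarrier (X (n + i))" for i j c
    using that
  proof (induction j rule: dec_induct)
    case (step j)
    then have "c \<in> vcarrier (X (n + j))" using X_mono[of "n + i" "n + j"] by auto
    then show ?case using ext[of c j] step by simp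
  qed simp
  have level: "\<exists>k. c \<in> vcarrier (X (n + k))" if c: "c \<in> vcarrier U" for c
  proof -
    obtain i where "c \<in> vcarrier (X i)" using c by (auto simp: U_simps(1))
    then have "c \<in> vcarrier (X (n + i))" using X_mono[of i "n + i"] by auto
    then show ?thesis by blast
  qed
  define G where "G c = F (LEAST k. c \<in> vcarrier (X (n + k))) c" for c
  have G: "G c = F k c" if "c \<in> vcarrier (X (n + k))" for c k
    unfolding G_def
    by (rule F_eq[OF Least_le[of "\<lambda>k. c \<in> vcarrier (X (n + k))", OF that]
          LeastI[of "\<lambda>k. c \<in> vcarrier (X (n + k))", OF that], symmetric])
  have lin: "linear_map (X (n + k)) Y (F k)" for k using Q[of k] by (simp add: Q_def)
  have "linear_map U Y G"
  proof (rule linear_mapI)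
    fix c d r assume c: "c \<in> vcarrier U"
    obtain k where k: "c \<in> vcarrier (X (n + k))" using level[OF c] by blast
    show "G c \<in> vcarrier Y" using G[OF k] linear_map_closed[OF lin k] by simp
    show "G (vscale U r c) = vscale Y r (G c)"
      using G[OF k] G[OF vspace_scale[OF VX k], of r] linear_map_scale[OF lin k, of r] by (simp add: U_simps(2)[of "n + k"])
    assume d: "d \<in> vcarrier U"
    obtain j where j: "d \<in> vcarrier (X (n + j))" using level[OF d] by blast
    have m: "c \<in> vcarrier (X (n + max k j))" "d \<in> vcarrier (X (n + max k j))"
      using k j X_mono[of "n + k" "n + max k j"] X_mono[of "n + j" "n + max k j"] by auto
    show "G (c + d) = G c + G d"
      using G[OF m(1)] G[OF m(2)] G[OF vspace_add[OF VX m]] linear_map_add[OF lin m] by simp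
  qed
  moreover have "G c = f c" if "c \<in> vcarrier (X n)" for c using G[of c 0] that F0 by simp
  moreover have "act Y \<psi> (G c) = G (act (regular_comod U) \<psi> c)" if \<psi>: "functional U \<psi>" and c: "c \<in> vcarrier U" for \<psi> c
  proof -
    obtain k where k: "c \<in> vcarrier (X (n + k))" using level[OF c] by blast
    have "act (regular_comod (X (n + k))) \<psi> c \<in> vcarrier (X (n + k))"
      using act_closed[OF precomodule_regular[OF X_coalgebra], of c "n + k" \<psi>] k by simp
    then show ?thesis using G G[OF k] X_act[OF \<psi> k] Q[of k] \<psi> k by (simp add: Q_def)
  qed
  ultimately show thesis by (rule that)
qed

end

section \<open>Finite-dimensional comodules over the union\<close>

text \<open>
  The coordinates of a vector are stored at numbers assigned to the basis elements.
\<close>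

lemma embed_in_poly_mapping:
  assumes V: "vspace V" and fin: "fin_dim V"
  obtains T :: "'v::ab_group_add \<Rightarrow> (nat \<Rightarrow>\<^sub>0 'k::field)"
  where "linear_map V \<lparr>vcarrier = UNIV, vscale = fscale\<rparr> T" "inj_on T (vcarrier V)"
proof -
  obtain J r where J: "finite J" "J \<subseteq> vcarrier V" and r: "\<And>b. functional V (\<lambda>v. r v b)"
    and sum: "\<And>v. v \<in> vcarrier V \<Longrightarrow> v = (\<Sum>b\<in>J. vscale V (r v b) b)"
    using fin_spanned_coordinates[OF V fin] by blast
  obtain i :: "'v \<Rightarrow> nat" where i: "inj_on i J"
    using finite_imp_inj_to_nat_seg[OF J(1)] by blast
  define T where "T v = (\<Sum>b\<in>J. Poly_Mapping.single (i b) (r v b))" for v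
  have look: "Poly_Mapping.lookup (T v) (i b) = r v b" if b: "b \<in> J" for v b
  proof -
    have "Poly_Mapping.lookup (T v) (i b) = (\<Sum>b'\<in>J. if b' = b then r v b else 0)"
      unfolding T_def lookup_sum
      by (rule sum.cong) (use i b in \<open>auto simp: lookup_single when_def inj_on_def\<close>)
    then show ?thesis using b J(1) by simp
  qed
  have "linear_map V \<lparr>vcarrier = UNIV, vscale = fscale\<rparr> T"
    by (rule linear_mapI)
      (simp_all add: T_def linear_map_add[OF r] functional_scale[OF r] single_add sum.distrib free.scale_sum_right)
  moreover have "inj_on T (vcarrier V)"
  proof (rule inj_onI)
    fix v w assume v: "v \<in> vcarrier V" and w: "w \<in> vcarrier V" and eq: "T v = T w"
    have "(\<Sum>b\<in>J. vscale V (r v b) b) = (\<Sum>b\<in>J. vscale V (r w b) b)"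
      by (rule sum.cong[OF refl]) (metis look eq)
    then show "v = w" using sum[OF v] sum[OF w] by simp
  qed
  ultimately show thesis by (rule that)
qed

context tower
begin

lemma conv_extends:
  assumes "functional U \<psi>" "functional U \<chi>" "c \<in> vcarrier (X n)"
    and "\<And>c. c \<in> vcarrier (X n) \<Longrightarrow> \<psi> c = \<psi>' c" "\<And>c. c \<in> vcarrier (X n) \<Longrightarrow> \<chi> c = \<chi>' c"
  shows "conv U \<psi> \<chi> c = conv (X n) \<psi>' \<chi>' c"
proof -
  have "conv U \<psi> \<chi> c = ev \<psi> \<chi> (comult (X n) c)" using U_ev[OF assms(3,1,2)] by (simp add: conv_def)
  also have "\<dots> = conv (X n) \<psi>' \<chi>' c" unfolding conv_def
    by (rule ev_cong) (use comult_tensors[OF X_coalgebra assms(3)] assms(4,5) in \<open>auto simp: tensors_def\<close>)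
  finally show ?thesis .
qed

text \<open>
  The coefficients of a basis of \<open>M\<close> involve only finitely many elements of the union, so
  that \<open>M\<close> is defined over one level of the tower.
\<close>

lemma descend_to_level:
  fixes M :: "('k, 'd, 'm::ab_group_add) comod"
  assumes M: "right_comodule U M" and fin: "fin_dim M" and ind: "indecomposable U M"
  obtains n and M0 :: "('k, 'd) fdcomod" and T where "fd_indecomposable (X n) M0" "linear_map M M0 T"
    "bij_betw T (vcarrier M) (vcarrier M0)"
    "\<And>\<psi> m. functional U \<psi> \<Longrightarrow> m \<in> vcarrier M \<Longrightarrow> act M0 \<psi> (T m) = T (act M \<psi> m)"
proof -
  note pre = right_comodule_precomodule[OF U_coalgebra M]
  note V = precomodule_vspace[OF pre]
  obtain J r where J: "finite J" "J \<subseteq> vcarrier M" and r: "\<And>b. functional M (\<lambda>v. r v b)"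
    and sum: "\<And>v. v \<in> vcarrier M \<Longrightarrow> v = (\<Sum>b\<in>J. vscale M (r v b) b)"
    using fin_spanned_coordinates[OF V fin] by blast
  have km: "Poly_Mapping.keys (coact M m) \<subseteq> vcarrier M \<times> vcarrier U" if "m \<in> vcarrier M" for m
    using coact_tensors[OF pre that] by (simp add: tensors_def)
  have "finite (\<Union>b\<in>J. snd ` Poly_Mapping.keys (coact M b))" using J(1) by simp
  moreover have "(\<Union>b\<in>J. snd ` Poly_Mapping.keys (coact M b)) \<subseteq> vcarrier U" using km J(2) by fastforce
  ultimately obtain n where n: "(\<Union>b\<in>J. snd ` Poly_Mapping.keys (coact M b)) \<subseteq> vcarrier (X n)"
    by (rule finite_subset_level)
  have kb: "Poly_Mapping.keys (coact M b) \<subseteq> vcarrier M \<times> vcarrier (X n)" if "b \<in> J" for b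
  proof
    fix x assume x: "x \<in> Poly_Mapping.keys (coact M b)"
    then have "snd x \<in> (\<Union>b\<in>J. snd ` Poly_Mapping.keys (coact M b))" using that by blast
    moreover have "x \<in> vcarrier M \<times> vcarrier U" using km[of b] that J(2) x by blast
    ultimately show "x \<in> vcarrier M \<times> vcarrier (X n)" using n by (auto simp: mem_Times_iff)
  qed
  let ?W = "\<lparr>vcarrier = UNIV, vscale = fscale\<rparr> :: ('k, nat \<Rightarrow>\<^sub>0 'k) vspc"
  obtain T :: "'m \<Rightarrow> (nat \<Rightarrow>\<^sub>0 'k)" where TW: "linear_map M ?W T" and inj: "inj_on T (vcarrier M)"
    using embed_in_poly_mapping[OF V fin] by blast
  define S where "S = inv_into (vcarrier M) T"
  have ST: "S (T m) = m" if "m \<in> vcarrier M" for m using inj that by (simp add: S_def)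
  define M0 :: "('k, 'd) fdcomod" where
    "M0 = \<lparr>vcarrier = T ` vcarrier M, vscale = fscale,
      coact = (\<lambda>x. \<Sum>b\<in>J. fscale (r (S x) b) (tmap T id (coact M b)))\<rparr>"
  have M0: "vcarrier M0 = T ` vcarrier M" "vscale M0 = fscale"
    "coact M0 x = (\<Sum>b\<in>J. fscale (r (S x) b) (tmap T id (coact M b)))" for x
    by (simp_all add: M0_def)
  have VW: "vspace ?W" by (simp add: vspace_def vector_space_fscale free.subspace_UNIV)
  have V0: "vspace M0"
    using subspace_image[OF V TW VW] by (simp add: vspace_def M0 vector_space_fscale)
  have T: "linear_map M M0 T" using TW by (auto simp: linear_map_def M0)
  have bij: "bij_betw T (vcarrier M) (vcarrier M0)" using inj by (simp add: bij_betw_def M0)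
  have k0: "coact M0 x \<in> tensors M0 (X n)" for x
  proof -
    have "Poly_Mapping.keys (fscale (r (S x) b) (tmap T id (coact M b))) \<subseteq> vcarrier M0 \<times> vcarrier (X n)"
      if "b \<in> J" for b
      using keys_fscale[of "r (S x) b" "tmap T id (coact M b)"] keys_tmap[of T id "coact M b"] kb[OF that]
      by (fastforce simp: M0)
    then show ?thesis unfolding M0(3) tensors_def mem_Collect_eq by (rule keys_sum_subset)
  qed
  \<comment> \<open>Slicing with a functional on level \<open>n\<close> agrees with slicing with any extension of it to the union.\<close>
  have key: "ev \<phi> \<psi> (coact M0 (T m)) = \<phi> (T (act M \<psi>' m))"
    if \<phi>: "functional M0 \<phi>" and \<psi>': "functional U \<psi>'" "\<And>c. c \<in> vcarrier (X n) \<Longrightarrow> \<psi>' c = \<psi> c"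
      and m: "m \<in> vcarrier M" for \<phi> \<psi> \<psi>' m
  proof -
    note \<phi>T = linear_map_comp[OF T \<phi>]
    note fc = functional_coact[OF pre \<phi>T \<psi>'(1)]
    have "ev \<phi> \<psi> (coact M0 (T m)) = (\<Sum>b\<in>J. r m b * ev (\<lambda>x. \<phi> (T x)) \<psi> (coact M b))"
      by (simp add: M0 ST[OF m] ev_tmap)
    also have "\<dots> = (\<Sum>b\<in>J. r m b * ev (\<lambda>x. \<phi> (T x)) \<psi>' (coact M b))"
    proof (rule sum.cong[OF refl])
      fix b assume "b \<in> J"
      have "ev (\<lambda>x. \<phi> (T x)) \<psi> (coact M b) = ev (\<lambda>x. \<phi> (T x)) \<psi>' (coact M b)"
        by (rule ev_cong) (use kb[OF \<open>b \<in> J\<close>] \<psi>'(2) in auto)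
      then show "r m b * ev (\<lambda>x. \<phi> (T x)) \<psi> (coact M b) = r m b * ev (\<lambda>x. \<phi> (T x)) \<psi>' (coact M b)" by simp
    qed
    also have "\<dots> = (\<Sum>b\<in>J. ev (\<lambda>x. \<phi> (T x)) \<psi>' (coact M (vscale M (r m b) b)))"
      by (rule sum.cong[OF refl]) (use J functional_scale[OF fc] in auto)
    also have "\<dots> = ev (\<lambda>x. \<phi> (T x)) \<psi>' (coact M (\<Sum>b\<in>J. vscale M (r m b) b))"
      by (rule linear_map_sum[OF V fc, symmetric]) (use J in \<open>auto intro: vspace_scale[OF V]\<close>)
    also have "\<dots> = ev (\<lambda>x. \<phi> (T x)) \<psi>' (coact M m)" using sum[OF m] by simp
    also have "\<dots> = \<phi> (T (act M \<psi>' m))" using functional_act[OF pre \<phi>T m] by simp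
    finally show ?thesis .
  qed
  have ext: "\<exists>\<psi>'. functional U \<psi>' \<and> (\<forall>c\<in>vcarrier (X n). \<psi>' c = \<psi> c)" if "functional (X n) \<psi>" for \<psi>
    using extension_functional_extend[OF U_extension that] by metis
  have linS: "linear_map M0 M S" and TS: "\<And>x. x \<in> vcarrier M0 \<Longrightarrow> T (S x) = x"
    unfolding S_def by (rule linear_map_inv_into[OF V T bij], rule linear_map_inv_into(3)[OF V T bij])
  have "linear_to_tensor M0 M0 (X n) (coact M0)"
  proof (rule linear_to_tensorI[OF V0 V0 VX k0])
    fix \<phi> \<psi> assume \<phi>: "functional M0 \<phi>" and \<psi>: "functional (X n) \<psi>"
    obtain \<psi>' where \<psi>': "functional U \<psi>'" "\<forall>c\<in>vcarrier (X n). \<psi>' c = \<psi> c" using ext[OF \<psi>] by blast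
    have "functional M0 (\<lambda>x. \<phi> (T (act M \<psi>' (S x))))"
      by (rule linear_map_comp[OF linear_map_comp[OF linear_map_comp[OF linS linear_map_act[OF pre \<psi>'(1)]] T] \<phi>])
    then show "functional M0 (\<lambda>x. ev \<phi> \<psi> (coact M0 x))"
    proof (rule linear_map_cong[OF V0])
      fix x assume x: "x \<in> vcarrier M0"
      show "\<phi> (T (act M \<psi>' (S x))) = ev \<phi> \<psi> (coact M0 x)"
        using key[OF \<phi> \<psi>'(1) _ linear_map_closed[OF linS x], of \<psi>] \<psi>'(2) TS[OF x] by simp
    qed
  qed
  then have pre0: "precomodule (X n) M0" using VX V0 by (simp add: precomodule_def)
  have act0: "act M0 \<psi> (T m) = T (act M \<psi>' m)"
    if \<psi>': "functional U \<psi>'" "\<And>c. c \<in> vcarrier (X n) \<Longrightarrow> \<psi>' c = \<psi> c" and m: "m \<in> vcarrier M" for \<psi> \<psi>' m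
    by (rule act_eqI[OF pre0 linear_map_closed[OF T m] linear_map_closed[OF T act_closed[OF pre m]] key[OF _ \<psi>' m]])
  have "right_comodule (X n) M0"
    unfolding right_comodule_iff[OF X_coalgebra]
  proof (intro conjI allI impI ballI)
    show "precomodule (X n) M0" by (rule pre0)
    fix x assume "x \<in> vcarrier M0"
    then obtain m where m: "m \<in> vcarrier M" "x = T m" by (auto simp: M0)
    show "act M0 (counit (X n)) x = x"
      using act0[OF functional_counit[OF U_coalgebra] U_counit m(1)] act_counit[OF U_coalgebra M m(1)] m(2) by simp
  next
    fix \<psi> \<chi> x assume \<psi>: "functional (X n) \<psi>" and \<chi>: "functional (X n) \<chi>" and "x \<in> vcarrier M0"
    then obtain m where m: "m \<in> vcarrier M" "x = T m" by (auto simp: M0)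
    obtain \<psi>' where \<psi>': "functional U \<psi>'" "\<forall>c\<in>vcarrier (X n). \<psi>' c = \<psi> c" using ext[OF \<psi>] by blast
    obtain \<chi>' where \<chi>': "functional U \<chi>'" "\<forall>c\<in>vcarrier (X n). \<chi>' c = \<chi> c" using ext[OF \<chi>] by blast
    have "act M0 \<psi> (act M0 \<chi> x) = T (act M \<psi>' (act M \<chi>' m))"
      using act0[OF \<chi>'(1) _ m(1), of \<chi>] act0[OF \<psi>'(1) _ act_closed[OF pre m(1)], of \<psi> \<chi>'] \<psi>'(2) \<chi>'(2) m(2) by simp
    also have "\<dots> = T (act M (conv U \<psi>' \<chi>') m)" using act_act[OF U_coalgebra M \<psi>'(1) \<chi>'(1) m(1)] by simp
    also have "\<dots> = act M0 (conv (X n) \<psi> \<chi>) x"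
      unfolding m(2)
      by (rule act0[symmetric, OF functional_conv[OF U_coalgebra \<psi>'(1) \<chi>'(1)] _ m(1)])
        (rule conv_extends[OF \<psi>'(1) \<chi>'(1)], use \<psi>'(2) \<chi>'(2) in auto)
    finally show "act M0 \<psi> (act M0 \<chi> x) = act M0 (conv (X n) \<psi> \<chi>) x" .
  qed
  moreover have "fin_dim M0"
    using fin_spanned_image[OF V T V0 fin] by (simp add: fin_dim_iff[OF V0] M0)
  moreover have "indecomposable (X n) M0"
    unfolding indecomposable_def
  proof (intro conjI allI impI)
    have z: "T 0 = 0" by (rule linear_map_zero[OF V T])
    have T0: "m = 0" if "m \<in> vcarrier M" "T m = 0" for m
      using inj_onD[OF inj, of m 0] that z vspace_zero[OF V] by simp
    show "vcarrier M0 \<noteq> {0}"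
    proof
      assume "vcarrier M0 = {0}"
      then have "vcarrier M \<subseteq> {0}" using T0 by (auto simp: M0)
      then show False using ind vspace_zero[OF V] by (auto simp: indecomposable_def)
    qed
    fix N P
    assume "subcomodule (X n) M0 N \<and> subcomodule (X n) M0 P \<and> N \<inter> P = {0} \<and> {n + p |n p. n \<in> N \<and> p \<in> P} = vcarrier M0"
    then have N: "subcomodule (X n) M0 N" and P: "subcomodule (X n) M0 P" and NP: "N \<inter> P = {0}"
      and s: "{n + p |n p. n \<in> N \<and> p \<in> P} = vcarrier M0" by auto
    define L where "L K = {m \<in> vcarrier M. T m \<in> K}" for K
    have L: "subcomodule U M (L K)" if K: "subcomodule (X n) M0 K" for K
    proof -
      have K': "module.subspace (vscale M0) K" "\<And>\<psi> x. functional (X n) \<psi> \<Longrightarrow> x \<in> K \<Longrightarrow> act M0 \<psi> x \<in> K"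
        using K unfolding subcomodule_iff[OF pre0] by auto
      have "act M \<psi> m \<in> L K" if "functional U \<psi>" "m \<in> L K" for \<psi> m
        using K'(2)[OF U_functional[OF that(1)], of "T m"] act0[OF that(1) refl, of m] that(2) act_closed[OF pre]
        by (simp add: L_def)
      then show ?thesis
        unfolding subcomodule_iff[OF pre] using subspace_preimage[OF V T V0 K'(1)] by (auto simp: L_def)
    qed
    have img: "K = T ` L K" if "subcomodule (X n) M0 K" for K
      using that by (auto simp: L_def subcomodule_def M0)
    have "L N \<inter> L P = {0}"
    proof
      show "L N \<inter> L P \<subseteq> {0}" using NP T0 by (auto simp: L_def)
      have "0 \<in> N" "0 \<in> P" using NP by auto
      then show "{0} \<subseteq> L N \<inter> L P" using z vspace_zero[OF V] by (auto simp: L_def)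
    qed
    moreover have "{n + p |n p. n \<in> L N \<and> p \<in> L P} = vcarrier M"
    proof
      show "{n + p |n p. n \<in> L N \<and> p \<in> L P} \<subseteq> vcarrier M" using vspace_add[OF V] by (auto simp: L_def)
      show "vcarrier M \<subseteq> {n + p |n p. n \<in> L N \<and> p \<in> L P}"
      proof
        fix m assume m: "m \<in> vcarrier M"
        then have "T m \<in> {n + p |n p. n \<in> N \<and> p \<in> P}" using s by (simp add: M0)
        then obtain a b where ab: "a \<in> N" "b \<in> P" "T m = a + b" by blast
        obtain a' where a': "a' \<in> L N" "a = T a'" using img[OF N] ab(1) by blast
        obtain b' where b': "b' \<in> L P" "b = T b'" using img[OF P] ab(2) by blast
        have c: "a' \<in> vcarrier M" "b' \<in> vcarrier M" using a'(1) b'(1) by (auto simp: L_def)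
        have "T m = T (a' + b')" using ab(3) a'(2) b'(2) linear_map_add[OF T c] by simp
        then have "m = a' + b'" using inj_onD[OF inj _ m vspace_add[OF V c]] by blast
        then show "m \<in> {n + p |n p. n \<in> L N \<and> p \<in> L P}" using a'(1) b'(1) by blast
      qed
    qed
    ultimately have "L N = {0} \<or> L P = {0}" using ind L[OF N] L[OF P] unfolding indecomposable_def by blast
    then show "N = {0} \<or> P = {0}" using img[OF N] img[OF P] z by auto
  qed
  ultimately have "fd_indecomposable (X n) M0" by (simp add: fd_indecomposable_def M0)
  then show thesis by (rule that[OF _ T bij]) (rule act0, auto)
qed

text \<open>
  A representative of the isomorphism type of \<open>M\<close> over level \<open>n\<close> is a summand of level \<open>n + 1\<close>, and the projection onto
  it extends to the union.
\<close>

lemma surjection_onto_indecomposable: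
  fixes M :: "('k, 'd, 'm::ab_group_add) comod"
  assumes M: "right_comodule U M" and fin: "fin_dim M" and ind: "indecomposable U M"
  obtains F where "linear_map U M F" "F ` vcarrier U = vcarrier M"
    "\<And>\<psi> c. functional U \<psi> \<Longrightarrow> c \<in> vcarrier U \<Longrightarrow> act M \<psi> (F c) = F (act (regular_comod U) \<psi> c)"
proof -
  note pre = right_comodule_precomodule[OF U_coalgebra M]
  note V = precomodule_vspace[OF pre]
  obtain n and M0 :: "('k, 'd) fdcomod" and T where M0: "fd_indecomposable (X n) M0" and T: "linear_map M M0 T"
    "bij_betw T (vcarrier M) (vcarrier M0)"
    and act_T: "\<And>\<psi> m. functional U \<psi> \<Longrightarrow> m \<in> vcarrier M \<Longrightarrow> act M0 \<psi> (T m) = T (act M \<psi> m)"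
    using descend_to_level[OF assms] by blast
  obtain L \<pi> where "vee (X n) (X (Suc n)) L \<pi> g" using vee_of_is_vee[OF connected step] .
  then interpret v: vee "X n" "X (Suc n)" L \<pi> g .
  obtain N i where N: "N \<in> L" and i: "comod_hom (X n) M0 N i" "bij_betw i (vcarrier M0) (vcarrier N)"
    using v.L M0 unfolding is_representative_set_def comod_iso_def by blast
  have pre0: "precomodule (X n) M0"
    by (rule right_comodule_precomodule[OF X_coalgebra]) (use M0 in \<open>simp add: fd_indecomposable_def\<close>)
  interpret I: fd_indecomposable_comodule "X n" N by (rule v.L_indecomposable[OF N])
  have lin_i: "linear_map M0 N i" using i(1) by (simp add: comod_hom_def)
  have act_i: "act N \<psi> (i x) = i (act M0 \<psi> x)" if "functional (X n) \<psi>" "x \<in> vcarrier M0" for \<psi> x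
    using i(1) that comod_hom_iff[OF pre0 I.V coact_tensors[OF I.pre], of i] by blast
  define K where "K m = i (T m)" for m
  have K: "linear_map M N K" unfolding K_def[abs_def] by (rule linear_map_comp[OF T(1) lin_i])
  have bijK: "bij_betw K (vcarrier M) (vcarrier N)"
    using bij_betw_trans[OF T(2) i(2)] by (simp add: K_def[abs_def] comp_def)
  have act_K: "act N \<psi> (K m) = K (act M \<psi> m)" if "functional U \<psi>" "m \<in> vcarrier M" for \<psi> m
    using act_i[OF U_functional[OF that(1)] linear_map_closed[OF T(1) that(2)]] act_T[OF that] by (simp add: K_def)
  let ?h = "inv_into (vcarrier M) K"
  note h = linear_map_inv_into[OF V K bijK]
  obtain P where P: "linear_map (X (Suc n)) N P" "P g = 0" "P ` vcarrier (X (Suc n)) = vcarrier N"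
    "\<And>\<psi> x. functional (X (Suc n)) \<psi> \<Longrightarrow> x \<in> vcarrier (X (Suc n)) \<Longrightarrow>
        act N \<psi> (P x) = P (act (regular_comod (X (Suc n))) \<psi> x)"
    using v.projection_onto_representative[OF N] by blast
  have lin: "linear_map (X (Suc n)) M (\<lambda>x. ?h (P x))" by (rule linear_map_comp[OF P(1) h(1)])
  have "?h (P g) = 0" using linear_map_zero[OF I.V h(1)] P(2) by simp
  moreover have "act M \<psi> (?h (P x)) = ?h (P (act (regular_comod (X (Suc n))) \<psi> x))"
    if \<psi>: "functional U \<psi>" and x: "x \<in> vcarrier (X (Suc n))" for \<psi> x
  proof -
    have hx: "?h (P x) \<in> vcarrier M" by (rule linear_map_closed[OF lin x])
    have "K (act M \<psi> (?h (P x))) = P (act (regular_comod (X (Suc n))) \<psi> x)"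
      using act_K[OF \<psi> hx] h(3)[OF linear_map_closed[OF P(1) x]] P(4)[OF U_functional[OF \<psi>] x] by simp
    then show ?thesis using h(2)[OF act_closed[OF pre hx, of \<psi>]] by simp
  qed
  ultimately obtain F where F: "linear_map U M F" "\<And>c. c \<in> vcarrier (X (Suc n)) \<Longrightarrow> F c = ?h (P c)"
    "\<And>\<psi> c. functional U \<psi> \<Longrightarrow> c \<in> vcarrier U \<Longrightarrow> act M \<psi> (F c) = F (act (regular_comod U) \<psi> c)"
    using extend_to_union[OF V lin] by blast
  have "F ` vcarrier U = vcarrier M"
  proof
    show "F ` vcarrier U \<subseteq> vcarrier M" using linear_map_closed[OF F(1)] by blast
    show "vcarrier M \<subseteq> F ` vcarrier U"
    proof
      fix m assume m: "m \<in> vcarrier M"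
      then obtain x where x: "x \<in> vcarrier (X (Suc n))" "K m = P x"
        using P(3) linear_map_closed[OF K m] by blast
      then have "F x = m" using F(2)[OF x(1)] h(2)[OF m] by simp
      then show "m \<in> F ` vcarrier U" using U_mem[OF x(1)] by blast
    qed
  qed
  then show thesis using that F(1,3) by blast
qed

end

section \<open>Arbitrary comodules\<close>

text \<open>
  The coaction of \<open>M\<close> need not have representatives in \<open>S \<otimes> C\<close>, so new ones are chosen.
\<close>

definition restrict_comod ::
  "('k::field, 'c::ab_group_add) coalg \<Rightarrow> ('k, 'c, 'm::ab_group_add) comod \<Rightarrow> 'm set \<Rightarrow> ('k, 'c, 'm) comod" where
  "restrict_comod C M S = \<lparr>vcarrier = S, vscale = vscale M,
     coact = (\<lambda>m. SOME t. Poly_Mapping.keys t \<subseteq> S \<times> vcarrier C \<and> tensor_eq M C (coact M m) t)\<rparr>"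

lemma restrict_comod_simps [simp]:
  "vcarrier (restrict_comod C M S) = S" "vscale (restrict_comod C M S) = vscale M"
  by (simp_all add: restrict_comod_def)

context
  fixes C :: "('k::field, 'c::ab_group_add) coalg" and M :: "('k, 'c, 'm::ab_group_add) comod" and S
  assumes C: "coalgebra C" and M: "right_comodule C M" and S: "subcomodule C M S"
begin

lemma restrict_coact:
  assumes "m \<in> S"
  shows "Poly_Mapping.keys (coact (restrict_comod C M S) m) \<subseteq> S \<times> vcarrier C"
    "tensor_eq M C (coact M m) (coact (restrict_comod C M S) m)"
proof -
  have "\<exists>t. Poly_Mapping.keys t \<subseteq> S \<times> vcarrier C \<and> tensor_eq M C (coact M m) t"
    using S assms by (simp add: subcomodule_def)
  from someI_ex[OF this] show "Poly_Mapping.keys (coact (restrict_comod C M S) m) \<subseteq> S \<times> vcarrier C"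
    "tensor_eq M C (coact M m) (coact (restrict_comod C M S) m)"
    by (simp_all add: restrict_comod_def)
qed

lemma restrict_subset: "S \<subseteq> vcarrier M" using S by (simp add: subcomodule_def)

lemma restrict_functional_extend:
  assumes "functional (restrict_comod C M S) \<phi>"
  obtains \<phi>' where "functional M \<phi>'" "\<And>x. x \<in> S \<Longrightarrow> \<phi>' x = \<phi> x"
proof -
  note V = precomodule_vspace[OF right_comodule_precomodule[OF C M]]
  let ?R = "restrict_comod C M S"
  have "vspace ?R" using V S by (simp add: vspace_def subcomodule_def)
  from functional_extend[OF this assms] obtain \<phi>' where
    "functional (?R\<lparr>vcarrier := UNIV\<rparr>) \<phi>'" "\<forall>x\<in>S. \<phi>' x = \<phi> x" by auto
  then show thesis using that functional_mono[of "?R\<lparr>vcarrier := UNIV\<rparr>" \<phi>' M] by simp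
qed

lemma restrict_ev:
  assumes \<phi>: "functional M \<phi>" "\<And>x. x \<in> S \<Longrightarrow> \<phi> x = \<phi>' x" and \<psi>: "functional C \<psi>" and m: "m \<in> S"
  shows "ev \<phi>' \<psi> (coact (restrict_comod C M S) m) = ev \<phi> \<psi> (coact M m)"
proof -
  have "ev \<phi>' \<psi> (coact (restrict_comod C M S) m) = ev \<phi> \<psi> (coact (restrict_comod C M S) m)"
    by (rule ev_cong) (use restrict_coact(1)[OF m] \<phi>(2) in auto)
  then show ?thesis using tensor_eq_imp_ev[OF restrict_coact(2)[OF m] \<phi>(1) \<psi>] by simp
qed

lemma right_comodule_restrict:
  "right_comodule C (restrict_comod C M S)"
  and act_restrict: "functional C \<psi> \<Longrightarrow> m \<in> S \<Longrightarrow> act (restrict_comod C M S) \<psi> m = act M \<psi> m"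
proof -
  let ?R = "restrict_comod C M S"
  note pre = right_comodule_precomodule[OF C M]
  note V = precomodule_vspace[OF pre] and VC = coalgebra_vspace[OF C]
  have VR: "vspace ?R" using V S by (simp add: vspace_def subcomodule_def)
  have k: "coact ?R m \<in> tensors ?R C" if "m \<in> S" for m
    using restrict_coact(1)[OF that] by (simp add: tensors_def)
  have SM: "m \<in> vcarrier M" if "m \<in> S" for m using restrict_subset that by blast
  have st: "act M \<psi> m \<in> S" if "functional C \<psi>" "m \<in> S" for \<psi> m
    using S that unfolding subcomodule_iff[OF pre] by blast
  have "linear_to_tensor ?R ?R C (coact ?R)"
  proof (rule linear_to_tensorI[OF VR VR VC])
    fix \<phi> \<psi> assume \<phi>: "functional ?R \<phi>" and \<psi>: "functional C \<psi>"
    obtain \<phi>' where \<phi>': "functional M \<phi>'" "\<And>x. x \<in> S \<Longrightarrow> \<phi>' x = \<phi> x" using restrict_functional_extend[OF \<phi>] by blast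
    have "functional ?R (\<lambda>m. ev \<phi>' \<psi> (coact M m))"
      by (rule functional_mono[OF functional_coact[OF pre \<phi>'(1) \<psi>]]) (use restrict_subset in auto)
    then show "functional ?R (\<lambda>m. ev \<phi> \<psi> (coact ?R m))"
      by (rule linear_map_cong[OF VR]) (simp add: restrict_ev[OF \<phi>' \<psi>])
  qed (simp add: k)
  then have preR: "precomodule C ?R" using VC VR by (simp add: precomodule_def)
  show act: "act ?R \<psi> m = act M \<psi> m" if \<psi>: "functional C \<psi>" and m: "m \<in> S" for \<psi> m
  proof (rule act_eqI[OF preR])
    show "m \<in> vcarrier ?R" "act M \<psi> m \<in> vcarrier ?R" using m st[OF \<psi> m] by auto
    fix \<phi> assume \<phi>: "functional ?R \<phi>"
    obtain \<phi>' where \<phi>': "functional M \<phi>'" "\<And>x. x \<in> S \<Longrightarrow> \<phi>' x = \<phi> x" using restrict_functional_extend[OF \<phi>] by blast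
    show "ev \<phi> \<psi> (coact ?R m) = \<phi> (act M \<psi> m)"
      using restrict_ev[OF \<phi>' \<psi> m] functional_act[OF pre \<phi>'(1) SM[OF m]] \<phi>'(2)[OF st[OF \<psi> m]] by simp
  qed
  show "right_comodule C ?R"
    unfolding right_comodule_iff[OF C]
  proof (intro conjI allI impI ballI)
    show "precomodule C ?R" by (rule preR)
    fix m assume "m \<in> vcarrier ?R"
    then have m: "m \<in> S" by simp
    show "act ?R (counit C) m = m" using act[OF functional_counit[OF C] m] act_counit[OF C M SM[OF m]] by simp
    fix \<psi> \<chi> assume \<psi>: "functional C \<psi>" and \<chi>: "functional C \<chi>"
    show "act ?R \<psi> (act ?R \<chi> m) = act ?R (conv C \<psi> \<chi>) m"
      using act[OF \<chi> m] act[OF \<psi> st[OF \<chi> m]] act[OF functional_conv[OF C \<psi> \<chi>] m] act_act[OF C M \<psi> \<chi> SM[OF m]] by simp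
  qed
qed

lemma subcomodule_of_restrict:
  assumes N: "subcomodule C (restrict_comod C M S) N"
  shows "subcomodule C M N" "N \<subseteq> S"
proof -
  note pre = right_comodule_precomodule[OF C M]
  note preR = right_comodule_precomodule[OF C right_comodule_restrict]
  have N': "module.subspace (vscale M) N" "N \<subseteq> S"
    "\<And>\<psi> n. functional C \<psi> \<Longrightarrow> n \<in> N \<Longrightarrow> act (restrict_comod C M S) \<psi> n \<in> N"
    using N unfolding subcomodule_iff[OF preR] by auto
  then show "N \<subseteq> S" by blast
  have "act M \<psi> n \<in> N" if "functional C \<psi>" "n \<in> N" for \<psi> n
    using N'(3)[OF that] act_restrict[OF that(1), of n] N'(2) that(2) by auto
  then show "subcomodule C M N"
    unfolding subcomodule_iff[OF pre] using N'(1,2) restrict_subset by blast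
qed

end

text \<open>
  The index of a summand is itself the homomorphism that is applied to this summand, so one map
  on the direct sum combines all homomorphisms.
\<close>

definition evaluate :: "(('c \<Rightarrow> 'n) \<Rightarrow>\<^sub>0 'c::zero) \<Rightarrow> 'n::ab_group_add" where
  "evaluate x = (\<Sum>f\<in>Poly_Mapping.keys x. f (Poly_Mapping.lookup x f))"

lemma evaluate_superset:
  assumes "finite K" "Poly_Mapping.keys x \<subseteq> K" "\<And>f. f \<in> K \<Longrightarrow> f 0 = 0"
  shows "evaluate x = (\<Sum>f\<in>K. f (Poly_Mapping.lookup x f))"
  unfolding evaluate_def by (rule sum.mono_neutral_left) (use assms in \<open>auto simp: in_keys_iff\<close>)

lemma copower_simps:
  "x \<in> vcarrier (copower I M) \<longleftrightarrow> Poly_Mapping.keys x \<subseteq> I \<and> (\<forall>i\<in>I. Poly_Mapping.lookup x i \<in> vcarrier M)"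
  "vscale (copower I M) r x = Poly_Mapping.map (vscale M r) x"
  "coact (copower I M) x = (\<Sum>i\<in>Poly_Mapping.keys x.
      tmap (Poly_Mapping.single i) id (coact M (Poly_Mapping.lookup x i)))"
  by (simp_all add: copower_def)

lemma comod_hom_evaluate:
  fixes N :: "('k::field, 'c::ab_group_add, 'n::ab_group_add) comod"
  assumes C: "coalgebra C" and N: "right_comodule C N"
    and I: "\<And>f. f \<in> I \<Longrightarrow> comod_hom C (regular_comod C) N f"
  shows "comod_hom C (copower I (regular_comod C)) N evaluate"
proof -
  note V = coalgebra_vspace[OF C] and pre = right_comodule_precomodule[OF C N]
  note VN = precomodule_vspace[OF pre]
  let ?P = "copower I (regular_comod C)"
  have lin: "linear_map C N f" if "f \<in> I" for f
    using I[OF that] by (simp add: comod_hom_def linear_map_def)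
  have f0: "f 0 = 0" if "f \<in> I" for f by (rule linear_map_zero[OF V lin[OF that]])
  have lin_ev: "linear_map ?P N evaluate"
  proof (rule linear_mapI)
    fix x y r assume x: "x \<in> vcarrier ?P"
    show "evaluate x \<in> vcarrier N"
      unfolding evaluate_def
      by (rule vspace_sum[OF VN]) (use x linear_map_closed[OF lin] in \<open>auto simp: copower_simps\<close>)
    have look: "Poly_Mapping.lookup (vscale ?P r x) f = vscale C r (Poly_Mapping.lookup x f)" for f
      by (simp add: copower_simps lookup_map_zero vspace_scale_simps[OF V])
    have "Poly_Mapping.keys (vscale ?P r x) \<subseteq> Poly_Mapping.keys x"
      by (auto simp: in_keys_iff look vspace_scale_simps[OF V])
    then have "evaluate (vscale ?P r x) = (\<Sum>f\<in>Poly_Mapping.keys x. f (Poly_Mapping.lookup (vscale ?P r x) f))"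
      by (rule evaluate_superset[OF finite_keys]) (use x f0 in \<open>auto simp: copower_simps(1)\<close>)
    also have "\<dots> = (\<Sum>f\<in>Poly_Mapping.keys x. f (vscale C r (Poly_Mapping.lookup x f)))"
      by (simp only: look)
    also have "\<dots> = (\<Sum>f\<in>Poly_Mapping.keys x. vscale N r (f (Poly_Mapping.lookup x f)))"
      by (rule sum.cong[OF refl], rule linear_map_scale[OF lin]) (use x in \<open>auto simp: copower_simps\<close>)
    finally show "evaluate (vscale ?P r x) = vscale N r (evaluate x)"
      by (simp add: evaluate_def module.scale_sum_right[OF vspace_module[OF VN]])
    assume y: "y \<in> vcarrier ?P"
    let ?K = "Poly_Mapping.keys x \<union> Poly_Mapping.keys y"
    have K: "finite ?K" "\<And>f. f \<in> ?K \<Longrightarrow> f 0 = 0" "?K \<subseteq> I"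
      using x y f0 by (auto simp: copower_simps)
    have sup: "evaluate z = (\<Sum>f\<in>?K. f (Poly_Mapping.lookup z f))" if "Poly_Mapping.keys z \<subseteq> ?K" for z
      by (rule evaluate_superset[OF K(1) that]) (rule K(2))
    have "evaluate (x + y) = (\<Sum>f\<in>?K. f (Poly_Mapping.lookup x f + Poly_Mapping.lookup y f))"
      using sup[OF Poly_Mapping.keys_add[of x y]] by (simp only: lookup_add)
    also have "\<dots> = (\<Sum>f\<in>?K. f (Poly_Mapping.lookup x f) + f (Poly_Mapping.lookup y f))"
      by (rule sum.cong[OF refl], rule linear_map_add[OF lin]) (use x y in \<open>auto simp: copower_simps\<close>)
    also have "\<dots> = evaluate x + evaluate y"
      using sup[of x] sup[of y] by (simp add: sum.distrib)
    finally show "evaluate (x + y) = evaluate x + evaluate y" .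
  qed
  have "tensor_eq N C (coact N (evaluate x)) (tmap evaluate id (coact ?P x))" if x: "x \<in> vcarrier ?P" for x
  proof -
    have xi: "f \<in> I" "Poly_Mapping.lookup x f \<in> vcarrier C" if "f \<in> Poly_Mapping.keys x" for f
      using x that by (auto simp: copower_simps)
    have fx: "f (Poly_Mapping.lookup x f) \<in> vcarrier N" if "f \<in> Poly_Mapping.keys x" for f
      using linear_map_closed[OF lin] xi[OF that] by blast
    have ex: "evaluate x \<in> vcarrier N" by (rule linear_map_closed[OF lin_ev x])
    have es: "evaluate (Poly_Mapping.single f c) = f c" if "f \<in> I" for f and c :: 'c
      using f0[OF that] by (cases "c = 0") (simp_all add: evaluate_def)
    have kP: "Poly_Mapping.keys (coact ?P x) \<subseteq> vcarrier ?P \<times> vcarrier C"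
    proof -
      have "Poly_Mapping.keys (tmap (Poly_Mapping.single f) id (comult C (Poly_Mapping.lookup x f)))
          \<subseteq> vcarrier ?P \<times> vcarrier C" if f: "f \<in> Poly_Mapping.keys x" for f
        using keys_tmap[of "Poly_Mapping.single f" id "comult C (Poly_Mapping.lookup x f)"]
          comult_tensors[OF C xi(2)[OF f]] xi(1)[OF f]
        by (fastforce simp: tensors_def copower_simps lookup_single when_def vspace_zero[OF V] split: if_splits)
      then show ?thesis unfolding copower_simps(3) regular_comod_simps by (rule keys_sum_subset)
    qed
    have k: "tmap evaluate id (coact ?P x) \<in> tensors N C"
      using keys_tmap[of evaluate id "coact ?P x"] kP linear_map_closed[OF lin_ev] by (fastforce simp: tensors_def)
    have "ev \<phi> \<psi> (coact N (evaluate x)) = ev \<phi> \<psi> (tmap evaluate id (coact ?P x))"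
      if \<phi>: "functional N \<phi>" and \<psi>: "functional C \<psi>" for \<phi> \<psi>
    proof -
      have summand: "ev \<phi> \<psi> (coact N (f (Poly_Mapping.lookup x f)))
          = ev (\<lambda>c. \<phi> (evaluate (Poly_Mapping.single f c))) \<psi> (comult C (Poly_Mapping.lookup x f))"
        if f: "f \<in> Poly_Mapping.keys x" for f
      proof -
        have "tensor_eq N C (coact N (f (Poly_Mapping.lookup x f))) (tmap f id (comult C (Poly_Mapping.lookup x f)))"
          using I[OF xi(1)[OF f]] xi(2)[OF f] by (simp add: comod_hom_def)
        from tensor_eq_imp_ev[OF this \<phi> \<psi>] show ?thesis by (simp add: ev_tmap es[OF xi(1)[OF f]])
      qed
      have "ev \<phi> \<psi> (coact N (evaluate x)) = (\<Sum>f\<in>Poly_Mapping.keys x. ev \<phi> \<psi> (coact N (f (Poly_Mapping.lookup x f))))"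
        unfolding evaluate_def by (rule linear_map_sum[OF VN functional_coact[OF pre \<phi> \<psi>] fx])
      also have "\<dots> = ev \<phi> \<psi> (tmap evaluate id (coact ?P x))"
        by (simp add: ev_tmap copower_simps(3) summand)
      finally show ?thesis .
    qed
    then show ?thesis by (simp only: tensor_eq_iff[OF VN V coact_tensors[OF pre ex] k]) blast
  qed
  then show ?thesis using lin_ev by (simp add: comod_hom_def)
qed

context tower
begin

lemma comod_hom_regular_iff:
  assumes N: "right_comodule U N"
  shows "comod_hom U (regular_comod U) N f \<longleftrightarrow> linear_map U N f \<and>
    (\<forall>\<psi>. functional U \<psi> \<longrightarrow> (\<forall>c\<in>vcarrier U. act N \<psi> (f c) = f (act (regular_comod U) \<psi> c)))"
proof -
  note pre = right_comodule_precomodule[OF U_coalgebra N]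
  have "linear_map (regular_comod U) N f \<longleftrightarrow> linear_map U N f" by (simp add: linear_map_def)
  then show ?thesis
    using comod_hom_iff[OF precomodule_regular[OF U_coalgebra] precomodule_vspace[OF pre] coact_tensors[OF pre], of f]
    by simp
qed

lemma indecomposable_is_quotient:
  fixes M :: "('k, 'd, 'm::ab_group_add) comod"
  assumes M: "right_comodule U M" and fin: "fin_dim M" and ind: "indecomposable U M"
  shows "is_quotient_of U M (regular_comod U)"
proof -
  obtain F where "linear_map U M F" "F ` vcarrier U = vcarrier M"
    "\<And>\<psi> c. functional U \<psi> \<Longrightarrow> c \<in> vcarrier U \<Longrightarrow> act M \<psi> (F c) = F (act (regular_comod U) \<psi> c)"
    using surjection_onto_indecomposable[OF assms] by blast
  then show ?thesis unfolding is_quotient_of_def comod_hom_regular_iff[OF M] by auto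
qed

text \<open>
  By induction on the dimension: an indecomposable subcomodule is the image of the union under one
  homomorphism, and a decomposable one is the sum of two smaller subcomodules.
\<close>

lemma finite_subcomodule_generated:
  fixes N :: "('k, 'd, 'n::ab_group_add) comod"
  assumes N: "right_comodule U N" and W: "0 \<in> W" "\<And>x y. x \<in> W \<Longrightarrow> y \<in> W \<Longrightarrow> x + y \<in> W"
    "\<And>f c. comod_hom U (regular_comod U) N f \<Longrightarrow> c \<in> vcarrier U \<Longrightarrow> f c \<in> W"
    and S: "subcomodule U N S" "fin_spanned N S"
  shows "S \<subseteq> W"
  using S
proof (induction "vector_space.dim (vscale N) S" arbitrary: S rule: less_induct)
  case less
  note pre = right_comodule_precomodule[OF U_coalgebra N]
  note V = precomodule_vspace[OF pre]
  let ?R = "restrict_comod U N S"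
  note R = right_comodule_restrict[OF U_coalgebra N less.prems(1)]
  note VR = precomodule_vspace[OF right_comodule_precomodule[OF U_coalgebra R]]
  have sub: "module.subspace (vscale N) S" "S \<subseteq> vcarrier N" using less.prems(1) by (auto simp: subcomodule_def)
  have fin: "fin_dim ?R" using less.prems(2) by (simp add: fin_dim_iff[OF VR] fin_spanned_def)
  consider "S = {0}" | "indecomposable U ?R" | "S \<noteq> {0}" "\<not> indecomposable U ?R" by blast
  then show ?case
  proof cases
    case 1
    then show ?thesis using W(1) by simp
  next
    case 2
    obtain F where F: "linear_map U ?R F" "F ` vcarrier U = S"
      "\<And>\<psi> c. functional U \<psi> \<Longrightarrow> c \<in> vcarrier U \<Longrightarrow> act ?R \<psi> (F c) = F (act (regular_comod U) \<psi> c)"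
      using surjection_onto_indecomposable[OF R fin 2] by auto
    have "linear_map U N F" using F(1) sub(2) by (auto simp: linear_map_def)
    moreover have "act N \<psi> (F c) = F (act (regular_comod U) \<psi> c)" if "functional U \<psi>" "c \<in> vcarrier U" for \<psi> c
    proof -
      have "F c \<in> S" using F(2) that(2) by blast
      then show ?thesis using F(3)[OF that] act_restrict[OF U_coalgebra N less.prems(1) that(1)] by simp
    qed
    ultimately have "comod_hom U (regular_comod U) N F" by (simp add: comod_hom_regular_iff[OF N])
    then show ?thesis using W(3) F(2) by blast
  next
    case 3
    then obtain P Q where P: "subcomodule U ?R P" and Q: "subcomodule U ?R Q" and PQ: "P \<inter> Q = {0}"
      and s: "{p + q | p q. p \<in> P \<and> q \<in> Q} = S" and nz: "P \<noteq> {0}" "Q \<noteq> {0}"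
      unfolding indecomposable_def by auto
    note P' = subcomodule_of_restrict[OF U_coalgebra N less.prems(1) P]
    note Q' = subcomodule_of_restrict[OF U_coalgebra N less.prems(1) Q]
    have "P \<subset> S" "Q \<subset> S" using P'(2) Q'(2) PQ nz by auto
    moreover have "module.subspace (vscale N) P" "module.subspace (vscale N) Q"
      using P'(1) Q'(1) by (auto simp: subcomodule_def)
    ultimately have "P \<subseteq> W" "Q \<subseteq> W"
      using less.hyps[OF dim_strict_mono[OF V less.prems(2)] _ fin_spanned_mono[OF less.prems(2)]] P' Q' by auto
    then show ?thesis using s W(2) by blast
  qed
qed

lemma comodule_is_quotient_of_copower:
  fixes N :: "('k, 'd, 'n::ab_group_add) comod"
  assumes N: "right_comodule U N"
  shows "is_quotient_of U N (copower {f. comod_hom U (regular_comod U) N f} (regular_comod U))"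
proof -
  let ?I = "{f. comod_hom U (regular_comod U) N f}"
  let ?P = "copower ?I (regular_comod U)"
  have hom: "comod_hom U ?P N evaluate"
    by (rule comod_hom_evaluate[OF U_coalgebra N]) simp
  then have lin: "linear_map ?P N evaluate" by (simp add: comod_hom_def)
  have "vcarrier N \<subseteq> evaluate ` vcarrier ?P"
  proof
    fix n assume "n \<in> vcarrier N"
    then obtain S where S: "subcomodule U N S" "n \<in> S" "fin_spanned N S"
      using finite_subcomodule[OF U_coalgebra N] by blast
    have "S \<subseteq> evaluate ` vcarrier ?P"
    proof (rule finite_subcomodule_generated[OF N _ _ _ S(1,3)])
      have "0 \<in> vcarrier ?P" by (simp add: copower_simps vspace_zero[OF VU])
      then show "0 \<in> evaluate ` vcarrier ?P" by (auto simp: evaluate_def intro!: image_eqI[of _ _ 0])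
      fix x y assume "x \<in> evaluate ` vcarrier ?P" "y \<in> evaluate ` vcarrier ?P"
      then obtain a b where ab: "a \<in> vcarrier ?P" "b \<in> vcarrier ?P" "x = evaluate a" "y = evaluate b" by blast
      have "a + b \<in> vcarrier ?P"
        using ab(1,2) Poly_Mapping.keys_add[of a b] by (auto simp: copower_simps lookup_add vspace_add[OF VU])
      moreover have "x + y = evaluate (a + b)" using linear_map_add[OF lin ab(1,2)] ab(3,4) by simp
      ultimately show "x + y \<in> evaluate ` vcarrier ?P" by blast
    next
      fix f c assume f: "comod_hom U (regular_comod U) N f" and c: "c \<in> vcarrier U"
      have "f 0 = 0" using linear_map_zero[OF VU] f by (auto simp: comod_hom_regular_iff[OF N])
      then have "f c = evaluate (Poly_Mapping.single f c)" by (cases "c = 0") (simp_all add: evaluate_def)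
      moreover have "Poly_Mapping.single f c \<in> vcarrier ?P"
        using f c by (auto simp: copower_simps lookup_single when_def vspace_zero[OF VU] split: if_splits)
      ultimately show "f c \<in> evaluate ` vcarrier ?P" by blast
    qed
    then show "n \<in> evaluate ` vcarrier ?P" using S(2) by blast
  qed
  then have "evaluate ` vcarrier ?P = vcarrier N" using linear_map_closed[OF lin] by blast
  then show ?thesis using hom unfolding is_quotient_of_def by blast
qed

end

theorem theorem4p9:
  fixes C :: "('k::alg_closed_field, 'c::ab_group_add) coalg"
    and X :: "nat \<Rightarrow> ('k, 'd::ab_group_add) coalg"
    and Cinf :: "('k, 'd) coalg"
  assumes "pointed_colocal C"
    and "vee_tower C X"
    and "Cinf = coalg_union X"
  shows "colocal Cinf
    \<and> (\<forall>M :: ('k, 'd, 'm::ab_group_add) comod.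
         right_comodule Cinf M \<and> fin_dim M \<and> indecomposable Cinf M \<longrightarrow>
         is_quotient_of Cinf M (regular_comod Cinf))
    \<and> (\<forall>N :: ('k, 'd, 'n::ab_group_add) comod.
         right_comodule Cinf N \<longrightarrow>
         (\<exists>I :: ('d \<Rightarrow> 'n) set. is_quotient_of Cinf N (copower I (regular_comod Cinf))))"
proof -
  obtain g where "connected_at C g" using pointed_colocal_connected[OF assms(1)] .
  then obtain g' where "connected_at (X 0) g'"
    using connected_at_iso assms(2) unfolding vee_tower_def by metis
  then interpret tower X g'
    using assms(2) by unfold_locales (auto simp: vee_tower_def)
  show ?thesis
    unfolding assms(3)
    using connected_at_colocal[OF U_connected] indecomposable_is_quotient comodule_is_quotient_of_copower by blast
qed

end
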